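(* There is an absolute constant $C>0$ such that the following holds. Let $x_1,\dots,x_n\in\mathbb{R}^d$, $\gamma>0$, let each $l_j:\mathbb{R}\to\mathbb{R}$ be convex and twice differentiable, and let $F(w)=\frac1n\sum_{j=1}^n l_j(x_j^Tw)+\frac{\gamma}{2}\|w\|_2^2$ with unique minimizer $w^\star$. For an iterate $w_t$ let $A_t\in\mathbb{R}^{n\times d}$ have $j$-th row $\sqrt{l_j''(x_j^Tw_t)}\,x_j^T$, and let $H_t=\nabla^2F(w_t)=\frac1nA_t^TA_t+\gamma I_d$. Consider the Sub-Sampled Newton update with ridge leverage score sampling, $$ w_{t+1}=w_t-\widetilde H_t^{-1}\nabla F(w_t),\qquad \widetilde H_t=\tfrac1nA_t^TUU^TA_t+\gamma I_d, $$ where $U\in\mathbb{R}^{n\times s}$ is a ridge leverage score sampling matrix for $A_t$. Let $\varepsilon\in(0,\frac14)$ and $\delta\in(0,1)$. (i) Suppose all $l_j$ are quadratic, so that $A_t\equiv A$ and $H_t\equiv H$ are constant (and one sampling matrix $U$ is used for all iterations). Let $d_{\mathrm{eff}}^\gamma$ be the $\gamma$-effective dimension of $A$ and $\kappa=\sigma_{\max}(H)/\sigma_{\min}(H)$. If $s\ge C\frac{d_{\mathrm{eff}}^\gamma}{\varepsilon^2}\log\frac{d_{\mathrm{eff}}^\gamma}{\delta}$, then with probability at least $1-\delta$, for all $t\ge0$, $\|w_t-w^\star\|_2\le\varepsilon^t\sqrt\kappa\,\|w_0-w^\star\|_2$. (ii) Suppose $\|\nabla^2F(w)-\nabla^2F(w')\|_2\le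 L\|w-w'\|_2$ for all $w,w'\in\mathbb{R}^d$. Let $w_t$ be given, let $d_{\mathrm{eff}}^\gamma$ be the $\gamma$-effective dimension of $A_t$ and $\kappa_t=\sigma_{\max}(H_t)/\sigma_{\min}(H_t)$. If $s\ge C\frac{d_{\mathrm{eff}}^\gamma}{\varepsilon^2}\log\frac{d_{\mathrm{eff}}^\gamma}{\delta}$, then with probability at least $1-\delta$, $$ \|w_{t+1}-w^\star\|_2\le\varepsilon\sqrt{\kappa_t}\,\|w_t-w^\star\|_2+\frac{L}{\sigma_{\min}(H_t)}\|w_t-w^\star\|_2^2 . $$
   Context: For $A=[a_1^T;\dots;a_n^T]\in\mathbb{R}^{n\times d}$ and $\gamma\ge0$, the row $\gamma$-ridge leverage scores are $l_j^\gamma=a_j^T(A^TA+n\gamma I_d)^\dagger a_j$, $j=1,\dots,n$. The $\gamma$-effective dimension is $d_{\mathrm{eff}}^\gamma(A)=\sum_{j=1}^n l_j^\gamma=\sum_{k=1}^d\frac{\sigma_k^2}{\sigma_k^2+n\gamma}$, where $\sigma_1,\dots,\sigma_d$ are the singular values of $A$. Ridge leverage score sampling matrix $U\in\mathbb{R}^{n\times s}$ for $A$: put $p_j=l_j^\gamma/\sum_{i=1}^n l_i^\gamma$; independently for each column $c=1,\dots,s$, draw an index $k\in\{1,\dots,n\}$ with probability $p_k$, and let the $c$-th column of $U$ have the single nonzero entry $1/\sqrt{s\,p_k}$ in position $k$. $\sigma_{\max},\sigma_{\min}$ denote largest and smallest singular values.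
   Formalization: The sample-size condition uses max(1, log(d_eff/δ)) in place of log(d_eff/δ), since the literal claim fails when d_eff/δ is close to 1 or smaller: the bare logarithm then asks for almost no samples. *)

theory Defs
  imports
    "HOL-Probability.Probability"
    "Jordan_Normal_Form.Gauss_Jordan_Elimination"
    "Jordan_Normal_Form.Spectral_Radius"
begin

text \<open>
  The absolute constant of the theorem has to be chosen before the dimensions \<open>n\<close>, \<open>d\<close>, \<open>s\<close>.
  Dimensions that are encoded in types could not be bound below an existential quantifier, so
  vectors and matrices are those with explicit dimensions, and all laws are on types that do not
  depend on the dimensions. Rows and samples are indexed from 0.
\<close>

definition norm2 :: "real vec \<Rightarrow> real" where
  "norm2 v = sqrt (scalar_prod v v)"

definition spectral_norm :: "real mat \<Rightarrow> real" where
  "spectral_norm M = (SUP v \<in> {v \<in> carrier_vec (dim_col M). norm2 v = 1}. norm2 (M *\<^sub>v v))"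

text \<open>All \<open>dim_col M\<close> singular values of \<open>M\<close>, zero included; for a square matrix these are
  exactly its singular values.\<close>

definition singular_values :: "real mat \<Rightarrow> real set" where
  "singular_values M = sqrt ` spectrum (transpose_mat M * M)"

definition sigma_max :: "real mat \<Rightarrow> real" where
  "sigma_max M = Max (singular_values M)"

definition sigma_min :: "real mat \<Rightarrow> real" where
  "sigma_min M = Min (singular_values M)"

definition cond_num :: "real mat \<Rightarrow> real" where
  "cond_num M = sigma_max M / sigma_min M"

text \<open>Moore--Penrose pseudo-inverse, by the four Penrose equations.\<close>

definition pinv :: "real mat \<Rightarrow> real mat" where
  "pinv M = (THE X. X \<in> carrier_mat (dim_col M) (dim_row M)
     \<and> M * X * M = M \<and> X * M * X = X
     \<and> transpose_mat (M * X) = M * X \<and> transpose_mat (X * M) = X * M)"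

definition ridge_leverage :: "real \<Rightarrow> real mat \<Rightarrow> nat \<Rightarrow> real" where
  "ridge_leverage \<gamma> A j =
     scalar_prod (row A j)
       (pinv (transpose_mat A * A + (real (dim_row A) * \<gamma>) \<cdot>\<^sub>m 1\<^sub>m (dim_col A)) *\<^sub>v row A j)"

definition eff_dim :: "real \<Rightarrow> real mat \<Rightarrow> real" where
  "eff_dim \<gamma> A = (\<Sum>j<dim_row A. ridge_leverage \<gamma> A j)"

definition ridge_prob :: "real \<Rightarrow> real mat \<Rightarrow> nat \<Rightarrow> real" where
  "ridge_prob \<gamma> A k = ridge_leverage \<gamma> A k / eff_dim \<gamma> A"

text \<open>For \<open>A = 0\<close> the quotients \<open>ridge_prob \<gamma> A k\<close> are 0/0 in the mathematics and no sampling
  matrix is defined. The following law is then unspecified; this is harmless, since every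
  sketch of a zero matrix is zero.\<close>

definition ridge_index_pmf :: "real \<Rightarrow> real mat \<Rightarrow> nat pmf" where
  "ridge_index_pmf \<gamma> A = embed_pmf (\<lambda>k. if k < dim_row A then ridge_prob \<gamma> A k else 0)"

definition sampling_mat :: "real \<Rightarrow> real mat \<Rightarrow> nat \<Rightarrow> (nat \<Rightarrow> nat) \<Rightarrow> real mat" where
  "sampling_mat \<gamma> A s k = mat (dim_row A) s
     (\<lambda>(i, c). if i = k c then 1 / sqrt (real s * ridge_prob \<gamma> A i) else 0)"

definition ridge_sampling_pmf :: "real \<Rightarrow> real mat \<Rightarrow> nat \<Rightarrow> real mat pmf" where
  "ridge_sampling_pmf \<gamma> A s =
     map_pmf (sampling_mat \<gamma> A s) (Pi_pmf {..<s} 0 (\<lambda>_. ridge_index_pmf \<gamma> A))"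

text \<open>Gradient and Hessian in coordinates. The type of vectors of varying dimension carries no
  topology, so the derivatives are the ordinary partial derivatives.\<close>

definition grad :: "(real vec \<Rightarrow> real) \<Rightarrow> real vec \<Rightarrow> real vec" where
  "grad f w = vec (dim_vec w) (\<lambda>i. deriv (\<lambda>h. f (w + h \<cdot>\<^sub>v unit_vec (dim_vec w) i)) 0)"

definition hess :: "(real vec \<Rightarrow> real) \<Rightarrow> real vec \<Rightarrow> real mat" where
  "hess f w = mat (dim_vec w) (dim_vec w)
     (\<lambda>(i, j). deriv (\<lambda>h. grad f (w + h \<cdot>\<^sub>v unit_vec (dim_vec w) j) $ i) 0)"

definition objective ::
  "nat \<Rightarrow> (nat \<Rightarrow> real vec) \<Rightarrow> (nat \<Rightarrow> real \<Rightarrow> real) \<Rightarrow> real \<Rightarrow> real vec \<Rightarrow> real" where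
  "objective n x l \<gamma> w =
     1 / real n * (\<Sum>j<n. l j (scalar_prod (x j) w)) + \<gamma> / 2 * (norm2 w)\<^sup>2"

definition unique_minimizer :: "nat \<Rightarrow> (real vec \<Rightarrow> real) \<Rightarrow> real vec \<Rightarrow> bool" where
  "unique_minimizer d f w \<longleftrightarrow>
     w \<in> carrier_vec d \<and> (\<forall>v \<in> carrier_vec d. v \<noteq> w \<longrightarrow> f w < f v)"

text \<open>The matrix \<open>A\<^sub>t\<close> at the point \<open>w = w\<^sub>t\<close>.\<close>

definition scaled_data ::
  "nat \<Rightarrow> (nat \<Rightarrow> real vec) \<Rightarrow> (nat \<Rightarrow> real \<Rightarrow> real) \<Rightarrow> real vec \<Rightarrow> real mat" where
  "scaled_data n x l w =
     mat_of_rows (dim_vec w)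
       (map (\<lambda>j. sqrt (deriv (deriv (l j)) (scalar_prod (x j) w)) \<cdot>\<^sub>v x j) [0..<n])"

definition sketched_hess :: "real \<Rightarrow> real mat \<Rightarrow> real mat \<Rightarrow> real mat" where
  "sketched_hess \<gamma> A U =
     (1 / real (dim_row A)) \<cdot>\<^sub>m (transpose_mat A * U * transpose_mat U * A)
     + \<gamma> \<cdot>\<^sub>m 1\<^sub>m (dim_col A)"

definition ssn_step ::
  "nat \<Rightarrow> (nat \<Rightarrow> real vec) \<Rightarrow> (nat \<Rightarrow> real \<Rightarrow> real) \<Rightarrow> real \<Rightarrow> real mat \<Rightarrow> real vec \<Rightarrow> real vec" where
  "ssn_step n x l \<gamma> U w =
     w - the (mat_inverse (sketched_hess \<gamma> (scaled_data n x l w) U))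
           *\<^sub>v grad (objective n x l \<gamma>) w"

end

theory Submission
  imports Defs
begin

text \<open>
  Let \<open>K = A\<^sup>T A + n\<gamma> I\<close> and choose \<open>T\<close> with \<open>T\<^sup>T K T = I\<close>. The rows \<open>v\<^sub>j = T\<^sup>T a\<^sub>j\<close> satisfy
  \<open>M = \<Sum> v\<^sub>j v\<^sub>j\<^sup>T \<le> I\<close>, their squared lengths are the ridge leverage scores, and so \<open>tr M\<close> is the effective
  dimension. Ridge leverage score sampling estimates \<open>M\<close> by an average of independent rank one
  matrices, and an error of at most \<open>\<epsilon>/2\<close> in operator norm means
  \<open>(1 - \<epsilon>/2) H \<le> Ht \<le> (1 + \<epsilon>/2) H\<close> for the sketched Hessian \<open>Ht\<close>. Then \<open>I - Ht\<^sup>-\<^sup>1 H\<close> is an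
  \<open>\<epsilon>\<close>-contraction in the \<open>H\<close>-norm, which gives both parts.

  The error of the average \<open>Y\<close> of centred matrices \<open>X\<close> is controlled through
  \<open>E tr (exp Y - 1 - Y)\<close>. By Golden--Thompson and \<open>E exp X \<le> I + a M\<close>, one more sample multiplies this
  quantity by at most \<open>1 + a\<close> and adds at most \<open>a (tr M + tr (Y M))\<close>, where \<open>E tr (Y M) = 0\<close>; since it starts
  at 0, the ambient dimension never enters. The exponential is replaced throughout by
  \<open>(1 + y / N)\<^sup>N\<close> with \<open>N = 2\<^sup>k\<close>, for which all the inequalities are polynomial identities and
  Cauchy--Schwarz, so that no spectral theorem is needed; \<open>k\<close> tends to infinity at the end.
\<close>

section \<open>Trace inequalities for approximate exponentials\<close>

text \<open>The Lie product error does carry the ambient dimension, as \<open>tr 1 / 2 ^ k\<close>;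
  it disappears only because \<open>k\<close> tends to infinity with the dimension and the number of
  samples fixed. Subtracting the affine part costs almost nothing in Markov's inequality, since e^t
  - 1 - t is still at least e^t / 2 at the threshold used.

  The constant 64: let D be the effective dimension and L = max 1 (ln (D / \<delta>)). The centred
  average is scaled by 8 L / \<epsilon>, so an error \<epsilon> / 2 becomes the threshold 4 L, while
  the accumulated variance 64 L^2 D / (\<epsilon>^2 s) is at most L. The two tails together cost 4 D
  e^(-3L): one factor e^(-L) pays for D / \<delta>, the other two for the 4.

  Randomness enters through one event on the sketch. In part (i) that event does not depend on the
  iterate, so no union bound over t is taken, and the contraction is iterated in the H-norm so that
  the condition number is paid once. In part (ii) the Taylor remainder contributes L / 2, and Ht >=
  (7/8) H inflates it by 8/7, which stays below L.\<close>

definition exp_approx :: "nat \<Rightarrow> 'a::real_algebra_1 \<Rightarrow> 'a" where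
  "exp_approx k x = (1 + (1 / 2 ^ k) *\<^sub>R x) ^ (2 ^ k)"

definition exp_approx_rem :: "nat \<Rightarrow> 'a::real_algebra_1 \<Rightarrow> 'a" where
  "exp_approx_rem k x = exp_approx k x - 1 - x"

section \<open>Real algebras with an involution and a trace\<close>

lemma power_mult_shift:
  fixes x y :: "'a::monoid_mult"
  shows "(x * y) ^ m * x = x * (y * x) ^ m"
  by (induction m) (simp_all add: mult.assoc)

text \<open>The ring laws hold on the whole type, while cyclicity and positivity of the trace are
  required on the carrier \<open>S\<close>. Positivity is not faithfulness:
  \<open>tr (star x * x)\<close> may vanish for nonzero \<open>x\<close>, as it does for matrices
  supported outside the block that the trace sees.\<close>

locale trace_algebra =
  fixes S :: "'a::real_algebra_1 set" and star :: "'a \<Rightarrow> 'a" and tr :: "'a \<Rightarrow> real"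
  assumes one_closed [simp]: "1 \<in> S"
    and add_closed [simp]: "x \<in> S \<Longrightarrow> y \<in> S \<Longrightarrow> x + y \<in> S"
    and mult_closed [simp]: "x \<in> S \<Longrightarrow> y \<in> S \<Longrightarrow> x * y \<in> S"
    and scaleR_closed [simp]: "x \<in> S \<Longrightarrow> c *\<^sub>R x \<in> S"
    and star_closed [simp]: "x \<in> S \<Longrightarrow> star x \<in> S"
    and star_add [simp]: "star (x + y) = star x + star y"
    and star_mult [simp]: "star (x * y) = star y * star x"
    and star_scaleR [simp]: "star (c *\<^sub>R x) = c *\<^sub>R star x"
    and star_star [simp]: "star (star x) = x"
    and tr_add [simp]: "tr (x + y) = tr x + tr y"
    and tr_scaleR [simp]: "tr (c *\<^sub>R x) = c * tr x"
    and tr_star [simp]: "tr (star x) = tr x"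
    and tr_commute: "x \<in> S \<Longrightarrow> y \<in> S \<Longrightarrow> tr (x * y) = tr (y * x)"
    and tr_nonneg: "x \<in> S \<Longrightarrow> 0 \<le> tr (star x * x)"
begin

lemma uminus_closed [simp]: "x \<in> S \<Longrightarrow> - x \<in> S"
  using scaleR_closed[of x "-1"] by simp

lemma diff_closed [simp]: "x \<in> S \<Longrightarrow> y \<in> S \<Longrightarrow> x - y \<in> S"
  using add_closed[of x "- y"] by simp

lemma zero_closed [simp]: "0 \<in> S"
  using diff_closed[of 1 1] by simp

lemma power_closed [simp]: "x \<in> S \<Longrightarrow> x ^ m \<in> S"
  by (induction m) auto

lemma sum_closed [simp]: "(\<And>i. i \<in> A \<Longrightarrow> f i \<in> S) \<Longrightarrow> sum f A \<in> S"
  by (induction A rule: infinite_finite_induct) auto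

lemma star_one [simp]: "star 1 = 1"
  by (metis mult.right_neutral star_mult star_star)

lemma star_uminus [simp]: "star (- x) = - star x"
  using star_scaleR[of "-1" x] by simp

lemma star_diff [simp]: "star (x - y) = star x - star y"
  using star_add[of x "- y"] by simp

lemma star_zero [simp]: "star 0 = 0"
  using star_diff[of 1 1] by simp

lemma star_power [simp]: "star (x ^ m) = star x ^ m"
  by (induction m) (simp_all add: power_commutes)

lemma star_sum [simp]: "star (sum f A) = (\<Sum>i\<in>A. star (f i))"
  by (induction A rule: infinite_finite_induct) auto

lemma tr_uminus [simp]: "tr (- x) = - tr x"
  using tr_scaleR[of "-1" x] by simp

lemma tr_diff [simp]: "tr (x - y) = tr x - tr y"
  using tr_add[of x "- y"] by simp

lemma tr_zero [simp]: "tr 0 = 0"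
  using tr_diff[of 1 1] by simp

lemma tr_sum: "tr (sum f A) = (\<Sum>i\<in>A. tr (f i))"
  by (induction A rule: infinite_finite_induct) auto

lemma tr_one_nonneg: "0 \<le> tr 1"
  using tr_nonneg[of 1] by simp

section \<open>Traces of powers of products\<close>

lemma tr_power_commute:
  assumes "x \<in> S" "y \<in> S"
  shows "tr ((x * y) ^ m) = tr ((y * x) ^ m)"
proof (cases m)
  case (Suc i)
  have "(x * y) ^ m = x * ((y * x) ^ i * y)"
    unfolding Suc power_Suc2 by (metis mult.assoc power_mult_shift)
  also have "tr \<dots> = tr ((y * x) ^ i * y * x)"
    using assms by (simp add: tr_commute)
  finally show ?thesis by (simp add: Suc power_Suc2 mult.assoc del: power_Suc)
qed simp

text \<open>Positivity of the trace at \<open>x - star x\<close>. This is the base case of the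
  dyadic power inequalities.\<close>

lemma tr_square_le: "x \<in> S \<Longrightarrow> tr (x * x) \<le> tr (x * star x)"
proof -
  assume x: "x \<in> S"
  have "0 \<le> tr (star (x - star x) * (x - star x))"
    using x by (intro tr_nonneg) simp
  also have "\<dots> = tr (star x * x) - tr (star x * star x) - tr (x * x) + tr (x * star x)"
    by (simp add: algebra_simps)
  also have "tr (star x * star x) = tr (x * x)"
    using tr_star[of "x * x"] by simp
  finally show ?thesis using x by (simp add: tr_commute)
qed

lemma tr_mult_le:
  assumes "p \<in> S" "q \<in> S" "star p = p" "star q = q"
  shows "tr (p * q) \<le> (tr (p * p) + tr (q * q)) / 2"
proof -
  have "0 \<le> tr (star (p - q) * (p - q))"
    using assms by (intro tr_nonneg) simp
  also have "\<dots> = tr (p * p) - 2 * tr (p * q) + tr (q * q)"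
    using assms by (simp add: algebra_simps tr_commute[of q p])
  finally show ?thesis by simp
qed

text \<open>Dyadic cases of Hoelder's inequality for Schatten norms; the two inequalities feed each
  other in the induction.\<close>

lemma tr_dyadic_power_aux:
  "(\<forall>c\<in>S. tr (c ^ (2 * 2 ^ k)) \<le> tr ((c * star c) ^ (2 ^ k))) \<and>
   (\<forall>p\<in>S. \<forall>q\<in>S. star p = p \<longrightarrow> star q = q \<longrightarrow>
      tr ((p * q) ^ (2 ^ k)) \<le> (tr (p ^ (2 * 2 ^ k)) + tr (q ^ (2 * 2 ^ k))) / 2)"
proof (induction k)
  case 0
  then show ?case using tr_square_le tr_mult_le by (simp add: power2_eq_square)
next
  case (Suc k)
  let ?N = "2 ^ k :: nat"
  have P: "tr (c ^ (2 * ?N)) \<le> tr ((c * star c) ^ ?N)" if "c \<in> S" for c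
    using Suc that by blast
  have R: "tr ((p * q) ^ ?N) \<le> (tr (p ^ (2 * ?N)) + tr (q ^ (2 * ?N))) / 2"
    if "p \<in> S" "q \<in> S" "star p = p" "star q = q" for p q
    using Suc that by blast
  have "tr (c ^ (2 * 2 ^ Suc k)) \<le> tr ((c * star c) ^ (2 ^ Suc k))" if c: "c \<in> S" for c
  proof -
    have "c ^ (2 * 2 ^ Suc k) = (c * c) ^ (2 * ?N)"
      by (simp add: power_mult power2_eq_square[symmetric])
    also have "tr \<dots> \<le> tr ((c * (c * star c * star c)) ^ ?N)"
      using P[of "c * c"] c by (simp add: mult.assoc)
    also have "\<dots> = tr ((c * star c * (star c * c)) ^ ?N)"
      using c by (subst tr_power_commute) (simp_all add: mult.assoc)
    also have "\<dots> \<le> (tr ((c * star c) ^ (2 * ?N)) + tr ((star c * c) ^ (2 * ?N))) / 2"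
      using c by (intro R) auto
    \<comment> \<open>\<open>c * star c\<close> and \<open>star c * c\<close> have equal power
      traces, so the arithmetic mean collapses to one term.\<close>
    also have "\<dots> = tr ((c * star c) ^ (2 * ?N))"
      using c by (simp add: tr_power_commute[of "star c" c])
    finally show ?thesis by simp
  qed
  moreover have "tr ((p * q) ^ (2 ^ Suc k)) \<le>
      (tr (p ^ (2 * 2 ^ Suc k)) + tr (q ^ (2 * 2 ^ Suc k))) / 2"
    if p: "p \<in> S" "star p = p" and q: "q \<in> S" "star q = q" for p q
  proof -
    have "tr ((p * q) ^ (2 ^ Suc k)) \<le> tr ((p * (q * q * p)) ^ ?N)"
      using P[of "p * q"] p q by (simp add: mult.assoc)
    also have "\<dots> = tr (((q * q) * (p * p)) ^ ?N)"
      using p q by (subst tr_power_commute) (simp_all add: mult.assoc)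
    also have "\<dots> \<le> (tr ((q * q) ^ (2 * ?N)) + tr ((p * p) ^ (2 * ?N))) / 2"
      using p q by (intro R) auto
    finally show ?thesis
      by (simp add: power_mult power2_eq_square[symmetric] add.commute)
  qed
  ultimately show ?case by blast
qed

lemma tr_dyadic_power_le:
  "c \<in> S \<Longrightarrow> tr (c ^ (2 * 2 ^ k)) \<le> tr ((c * star c) ^ (2 ^ k))"
  using tr_dyadic_power_aux by blast

text \<open>A dyadic Lieb--Thirring inequality. The previous lemma replaces the non-normal
  \<open>p * q\<close> by \<open>p * q * q * p\<close> at half the exponent; cyclically this is the
  product of the squares of \<open>p\<close> and \<open>q\<close>, to which the induction hypothesis
  applies.\<close>

lemma tr_mult_dyadic_power_le:
  "p \<in> S \<Longrightarrow> q \<in> S \<Longrightarrow> star p = p \<Longrightarrow> star q = q \<Longrightarrow>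
    tr ((p * q) ^ (2 ^ k)) \<le> tr (p ^ (2 ^ k) * q ^ (2 ^ k))"
proof (induction k arbitrary: p q)
  case (Suc k)
  let ?N = "2 ^ k :: nat"
  have "tr ((p * q) ^ (2 ^ Suc k)) \<le> tr ((p * (q * q * p)) ^ ?N)"
    using tr_dyadic_power_le[of "p * q" k] Suc.prems by (simp add: mult.assoc)
  also have "\<dots> = tr (((q * q) * (p * p)) ^ ?N)"
    using Suc.prems by (subst tr_power_commute) (simp_all add: mult.assoc)
  also have "\<dots> = tr (((p * p) * (q * q)) ^ ?N)"
    using Suc.prems by (simp add: tr_power_commute)
  also have "\<dots> \<le> tr ((p * p) ^ ?N * (q * q) ^ ?N)"
    using Suc.prems by (intro Suc.IH) auto
  finally show ?case
    by (simp add: power_mult power2_eq_square[symmetric])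
qed simp

section \<open>Hilbert--Schmidt seminorm and operator bounds\<close>

definition frob :: "'a \<Rightarrow> real" where
  "frob x = sqrt (tr (star x * x))"

lemma frob_nonneg [simp]: "x \<in> S \<Longrightarrow> 0 \<le> frob x"
  by (simp add: frob_def tr_nonneg)

lemma frob_square: "x \<in> S \<Longrightarrow> (frob x)\<^sup>2 = tr (star x * x)"
  by (simp add: frob_def tr_nonneg)

lemma abs_tr_star_mult_le:
  assumes x: "x \<in> S" and y: "y \<in> S"
  shows "\<bar>tr (star x * y)\<bar> \<le> frob x * frob y"
proof -
  define a b c where "a = tr (star x * x)" and "b = tr (star x * y)" and "c = tr (star y * y)"
  have ac: "0 \<le> a" "0 \<le> c" using x y by (auto simp: a_def c_def tr_nonneg)
  have q: "0 \<le> a - 2 * t * b + t\<^sup>2 * c" for t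
  proof -
    have "0 \<le> tr (star (x - t *\<^sub>R y) * (x - t *\<^sub>R y))"
      using x y by (intro tr_nonneg) simp
    also have "\<dots> = a - t * b - t * tr (star y * x) + t\<^sup>2 * c"
      by (simp add: algebra_simps a_def b_def c_def power2_eq_square)
    also have "tr (star y * x) = b"
      using tr_star[of "star y * x"] by (simp add: b_def)
    finally show ?thesis by (simp add: algebra_simps)
  qed
  have "b\<^sup>2 \<le> a * c"
  proof (cases "c = 0")
    case True
    have "b = 0"
    proof (rule ccontr)
      assume "b \<noteq> 0"
      \<comment> \<open>For \<open>c = 0\<close> the quadratic degenerates to
        \<open>a - 2 * t * b\<close>, and this \<open>t\<close> gives it the value -1.\<close>
      then show False using q[of "(a + 1) / (2 * b)"] True by (simp add: field_simps)
    qed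
    then show ?thesis using True by simp
  next
    case False
    then have "0 \<le> a - b\<^sup>2 / c" using q[of "b / c"] by (simp add: power2_eq_square)
    then show ?thesis using False ac by (simp add: field_simps)
  qed
  then have "\<bar>b\<bar> \<le> sqrt (a * c)"
    by (metis real_sqrt_abs real_sqrt_le_mono)
  then show ?thesis by (simp add: real_sqrt_mult frob_def a_def b_def c_def)
qed

lemma frob_add_le:
  assumes x: "x \<in> S" and y: "y \<in> S"
  shows "frob (x + y) \<le> frob x + frob y"
proof (rule power2_le_imp_le)
  have "(frob (x + y))\<^sup>2 = tr (star x * x) + tr (star x * y) + tr (star y * x) + tr (star y * y)"
    using x y by (simp add: frob_square algebra_simps)
  also have "tr (star y * x) = tr (star x * y)"
    using tr_star[of "star y * x"] by simp
  also have "tr (star x * x) + tr (star x * y) + tr (star x * y) + tr (star y * y)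
      \<le> (frob x)\<^sup>2 + 2 * (frob x * frob y) + (frob y)\<^sup>2"
    using abs_tr_star_mult_le[OF x y] by (simp add: frob_square x y)
  finally show "(frob (x + y))\<^sup>2 \<le> (frob x + frob y)\<^sup>2"
    by (simp add: power2_eq_square algebra_simps)
qed (use x y in simp)

lemma frob_scaleR: "frob (c *\<^sub>R x) = \<bar>c\<bar> * frob x"
  by (simp add: frob_def real_sqrt_mult mult.assoc[symmetric])

text \<open>A substitute for the operator norm that needs neither vectors nor a spectrum:
  \<open>c\<close> bounds left multiplication by \<open>x\<close> in the Hilbert--Schmidt
  seminorm.\<close>

definition op_bounded :: "real \<Rightarrow> 'a \<Rightarrow> bool" where
  "op_bounded c x \<longleftrightarrow> x \<in> S \<and> 0 \<le> c \<and> (\<forall>z\<in>S. frob (x * z) \<le> c * frob z)"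

lemma op_boundedD: "op_bounded c x \<Longrightarrow> z \<in> S \<Longrightarrow> frob (x * z) \<le> c * frob z"
  by (simp add: op_bounded_def)

lemma op_bounded_closed [simp]: "op_bounded c x \<Longrightarrow> x \<in> S"
  by (simp add: op_bounded_def)

lemma op_bounded_nonneg: "op_bounded c x \<Longrightarrow> 0 \<le> c"
  by (simp add: op_bounded_def del: op_bounded_closed)

lemma op_bounded_mono: "op_bounded b x \<Longrightarrow> b \<le> c \<Longrightarrow> op_bounded c x"
  unfolding op_bounded_def by (meson frob_nonneg mult_right_mono order_trans)

lemma op_bounded_one: "op_bounded 1 1"
  by (simp add: op_bounded_def del: op_bounded_closed)

lemma op_bounded_zero: "op_bounded 0 0"
  by (simp add: op_bounded_def frob_def del: op_bounded_closed)

lemma op_bounded_add: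
  assumes "op_bounded a x" "op_bounded b y"
  shows "op_bounded (a + b) (x + y)"
  unfolding op_bounded_def
proof (intro conjI ballI)
  fix z assume z: "z \<in> S"
  have "frob ((x + y) * z) \<le> frob (x * z) + frob (y * z)"
    using assms z by (simp add: distrib_right frob_add_le)
  also have "\<dots> \<le> a * frob z + b * frob z"
    using assms z by (intro add_mono op_boundedD)
  finally show "frob ((x + y) * z) \<le> (a + b) * frob z" by (simp add: distrib_right)
qed (use assms in \<open>auto simp: op_bounded_def simp del: op_bounded_closed\<close>)

lemma op_bounded_mult:
  assumes "op_bounded a x" "op_bounded b y"
  shows "op_bounded (a * b) (x * y)"
  unfolding op_bounded_def
proof (intro conjI ballI)
  fix z assume z: "z \<in> S"
  have "frob (x * y * z) \<le> a * frob (y * z)"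
    using assms z by (simp add: mult.assoc op_boundedD)
  also have "\<dots> \<le> a * (b * frob z)"
    using assms z by (intro mult_left_mono op_boundedD) (auto dest: op_bounded_nonneg)
  finally show "frob (x * y * z) \<le> a * b * frob z" by simp
qed (use assms in \<open>auto simp: op_bounded_def simp del: op_bounded_closed\<close>)

lemma op_bounded_scaleR:
  "op_bounded a x \<Longrightarrow> op_bounded (\<bar>c\<bar> * a) (c *\<^sub>R x)"
  by (auto simp: op_bounded_def frob_scaleR mult.assoc simp del: op_bounded_closed intro: mult_left_mono)

lemma op_bounded_power: "op_bounded a x \<Longrightarrow> op_bounded (a ^ m) (x ^ m)"
  by (induction m) (auto intro: op_bounded_one op_bounded_mult)

lemma op_bounded_sum:
  "(\<And>i. i \<in> A \<Longrightarrow> op_bounded (c i) (f i)) \<Longrightarrow> op_bounded (sum c A) (sum f A)"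
  by (induction A rule: infinite_finite_induct) (auto intro: op_bounded_zero op_bounded_add)

text \<open>Pythagoras: the squared seminorm of \<open>z\<close> exceeds that of
  \<open>p * z\<close> by that of \<open>(1 - p) * z\<close>.\<close>

lemma op_bounded_projection:
  assumes "p \<in> S" "star p = p" "p * p = p"
  shows "op_bounded 1 p"
  unfolding op_bounded_def
proof (intro conjI ballI)
  fix z assume z: "z \<in> S"
  have "0 \<le> tr (star ((1 - p) * z) * ((1 - p) * z))"
    using z assms by (intro tr_nonneg) simp
  also have "star ((1 - p) * z) * ((1 - p) * z) = star z * ((1 - p) * (1 - p)) * z"
    using assms by (simp add: mult.assoc)
  also have "(1 - p) * (1 - p) = 1 - p"
    using assms by (simp add: algebra_simps)
  also have "tr (star z * (1 - p) * z) = tr (star z * z) - tr (star (p * z) * (p * z))"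
    using assms by (simp add: algebra_simps) (metis mult.assoc)
  finally show "frob (p * z) \<le> 1 * frob z"
    by (simp add: frob_def)
qed (use assms in auto)

text \<open>Cauchy--Schwarz against 1. The ambient dimension \<open>tr 1\<close> enters the
  estimates here, and the bound is applied only to the Lie product error.\<close>

lemma abs_tr_le:
  assumes "op_bounded c x"
  shows "\<bar>tr x\<bar> \<le> c * tr 1"
proof -
  have "\<bar>tr x\<bar> \<le> frob 1 * frob x"
    using abs_tr_star_mult_le[of 1 x] assms by simp
  also have "\<dots> \<le> frob 1 * (c * frob 1)"
    using op_boundedD[OF assms, of 1] by (intro mult_left_mono) auto
  also have "\<dots> = c * tr 1"
    using frob_square[of 1] by (simp add: power2_eq_square)
  finally show ?thesis .
qed

text \<open>Telescoping one factor at a time. Each of the \<open>m\<close> terms carries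
  \<open>m - 1\<close> powers of \<alpha>; \<open>1 \<le> \<alpha>\<close> rounds this up to
  \<open>m\<close>.\<close>

lemma op_bounded_power_diff:
  assumes "op_bounded \<alpha> a" "op_bounded \<alpha> b" "op_bounded \<eta> (a - b)" "1 \<le> \<alpha>"
  shows "op_bounded (real m * \<eta> * \<alpha> ^ m) (a ^ m - b ^ m)"
proof (induction m)
  case 0
  then show ?case by (simp add: op_bounded_zero)
next
  case (Suc m)
  have "a ^ Suc m - b ^ Suc m = a * (a ^ m - b ^ m) + (a - b) * b ^ m"
    by (simp add: algebra_simps)
  moreover have "op_bounded (\<alpha> * (real m * \<eta> * \<alpha> ^ m) + \<eta> * \<alpha> ^ m) \<dots>"
    using assms Suc by (intro op_bounded_add op_bounded_mult op_bounded_power)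
  moreover have "\<alpha> * (real m * \<eta> * \<alpha> ^ m) + \<eta> * \<alpha> ^ m \<le> real (Suc m) * \<eta> * \<alpha> ^ Suc m"
  proof -
    have "\<eta> * \<alpha> ^ m \<le> \<eta> * \<alpha> ^ Suc m"
      using assms op_bounded_nonneg by (intro mult_left_mono power_increasing) auto
    then show ?thesis by (simp add: algebra_simps)
  qed
  ultimately show ?case using op_bounded_mono by metis
qed

section \<open>Golden--Thompson and monotonicity for approximate exponentials\<close>

lemma exp_approx_closed [simp]: "x \<in> S \<Longrightarrow> exp_approx k x \<in> S"
  by (simp add: exp_approx_def)

lemma exp_approx_rem_closed [simp]: "x \<in> S \<Longrightarrow> exp_approx_rem k x \<in> S"
  by (simp add: exp_approx_rem_def)

text \<open>A Golden--Thompson inequality for the approximate exponentials; the error term is that of the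
  Lie product formula.\<close>

lemma tr_exp_approx_add_le:
  assumes x: "op_bounded \<beta> x" "star x = x" and y: "op_bounded \<beta> y" "star y = y"
  shows "tr (exp_approx k (y + x))
    \<le> tr (exp_approx k y * exp_approx k x) + \<beta>\<^sup>2 * exp (2 * \<beta>) * tr 1 / 2 ^ k"
proof -
  define N :: real where "N = 2 ^ k"
  have N: "N > 0" by (simp add: N_def)
  have \<beta>: "0 \<le> \<beta>" using x op_bounded_nonneg by blast
  define p q a where "p = 1 + (1 / N) *\<^sub>R y" and "q = 1 + (1 / N) *\<^sub>R x"
    and "a = 1 + (1 / N) *\<^sub>R (y + x)"
  define \<alpha> where "\<alpha> = (1 + \<beta> / N) * (1 + \<beta> / N)"
  have pq: "op_bounded (1 + \<beta> / N) p" "op_bounded (1 + \<beta> / N) q"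
    using op_bounded_add[OF op_bounded_one op_bounded_scaleR[OF y(1), of "1 / N"]]
      op_bounded_add[OF op_bounded_one op_bounded_scaleR[OF x(1), of "1 / N"]] N
    by (simp_all add: p_def q_def)
  then have pq\<alpha>: "op_bounded \<alpha> (p * q)"
    unfolding \<alpha>_def by (rule op_bounded_mult)
  have "op_bounded (1 + (1 / N) * (\<beta> + \<beta>)) a"
    using op_bounded_add[OF op_bounded_one op_bounded_scaleR[OF op_bounded_add[OF y(1) x(1)],
        of "1 / N"]] N by (simp add: a_def)
  then have a: "op_bounded \<alpha> a"
    by (rule op_bounded_mono) (use N \<beta> in \<open>simp add: \<alpha>_def field_simps\<close>)
  have \<alpha>1: "1 \<le> \<alpha>"
    unfolding \<alpha>_def using N \<beta> mult_mono[of 1 "1 + \<beta> / N" 1 "1 + \<beta> / N"] by simp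
  \<comment> \<open>The factors agree up to order 1/N^2, hence their N-th powers up to order
    1/N.\<close>
  have "p * q - a = (1 / N\<^sup>2) *\<^sub>R (y * x)"
    using N by (simp add: p_def q_def a_def algebra_simps power2_eq_square)
  then have "a - p * q = (- 1 / N\<^sup>2) *\<^sub>R (y * x)"
    by (metis minus_diff_eq minus_divide_left scaleR_minus_left)
  then have d: "op_bounded (\<beta>\<^sup>2 / N\<^sup>2) (a - p * q)"
    using op_bounded_scaleR[OF op_bounded_mult[OF y(1) x(1)], of "- 1 / N\<^sup>2"]
    by (simp add: power2_eq_square)
  have "\<bar>tr (a ^ (2 ^ k) - (p * q) ^ (2 ^ k))\<bar>
      \<le> real (2 ^ k) * (\<beta>\<^sup>2 / N\<^sup>2) * \<alpha> ^ (2 ^ k) * tr 1"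
    by (rule abs_tr_le[OF op_bounded_power_diff[OF a pq\<alpha> d \<alpha>1]])
  also have "\<dots> = \<beta>\<^sup>2 * \<alpha> ^ (2 ^ k) * tr 1 / N"
    using N by (simp add: N_def power2_eq_square)
  also have "\<alpha> ^ (2 ^ k) \<le> exp (2 * \<beta>)"
  proof -
    have "\<alpha> \<le> exp (\<beta> / N) * exp (\<beta> / N)"
      unfolding \<alpha>_def using N \<beta> by (intro mult_mono exp_ge_add_one_self) auto
    then have "\<alpha> ^ (2 ^ k) \<le> (exp (2 * \<beta> / N)) ^ (2 ^ k)"
      using \<alpha>1 by (intro power_mono) (auto simp: mult_exp_exp)
    also have "\<dots> = exp (2 * \<beta>)"
      using N by (simp add: exp_of_nat_mult[symmetric] N_def)
    finally show ?thesis .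
  qed
  finally have "tr (a ^ (2 ^ k)) \<le> tr ((p * q) ^ (2 ^ k)) + \<beta>\<^sup>2 * exp (2 * \<beta>) * tr 1 / N"
    using N tr_one_nonneg by (simp add: mult_left_mono mult_right_mono divide_right_mono abs_le_iff)
  also have "tr ((p * q) ^ (2 ^ k)) \<le> tr (p ^ (2 ^ k) * q ^ (2 ^ k))"
    using x y by (intro tr_mult_dyadic_power_le) (auto simp: p_def q_def)
  finally show ?thesis
    by (simp add: exp_approx_def p_def q_def a_def N_def)
qed

text \<open>The Loewner order, tested on elements \<open>z\<close> of the algebra, which act as
  tuples of column vectors.\<close>

definition form_le :: "'a \<Rightarrow> 'a \<Rightarrow> bool" where
  "form_le x y \<longleftrightarrow> (\<forall>z\<in>S. tr (star z * x * z) \<le> tr (star z * y * z))"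

text \<open>By cyclicity the trace against a square \<open>g * g\<close> is the trace of the
  conjugate by \<open>g\<close>. Positive factors therefore enter as explicit squares, and square
  roots of operators are avoided.\<close>

lemma tr_square_mult_mono:
  assumes "form_le x y" "x \<in> S" "y \<in> S" "g \<in> S" "star g = g"
  shows "tr (g * g * x) \<le> tr (g * g * y)"
proof -
  have "tr (g * g * u) = tr (star g * u * g)" if "u \<in> S" for u
    using assms that tr_commute[of g "g * u"] by (simp add: mult.assoc)
  then show ?thesis
    using assms(1)[unfolded form_le_def, THEN bspec, OF assms(4)] assms(2,3) by simp
qed

text \<open>The remainder is a sum of squares, since
  \<open>w\<^sup>2 - 1 - 2Nz = (w - 1)\<^sup>2 + 2(w - 1 - Nz)\<close> for \<open>w = (1 + z)\<^sup>N\<close>.\<close>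

lemma tr_exp_approx_rem_mult_mono:
  assumes xy: "form_le x y" "x \<in> S" "y \<in> S" and u: "u \<in> S" "star u = u"
  shows "tr (exp_approx_rem k u * x) \<le> tr (exp_approx_rem k u * y)"
proof -
  define f where "f z m = (1 + z) ^ (2 ^ m) - 1 - (2 ^ m) *\<^sub>R z" for z :: 'a and m
  have "tr (f z m * x) \<le> tr (f z m * y)" if z: "z \<in> S" "star z = z" for z m
  proof (induction m)
    case 0
    then show ?case by (simp add: f_def)
  next
    case (Suc m)
    define w g where "w = (1 + z) ^ (2 ^ m)" and "g = w - 1"
    have "(1 + z) ^ (2 ^ Suc m) = w * w"
      by (simp add: w_def mult_2 power_add)
    then have "f z (Suc m) = w * w - 1 - (2 * 2 ^ m) *\<^sub>R z"
      by (simp add: f_def)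
    also have "\<dots> = g * g + 2 *\<^sub>R (w - 1 - (2 ^ m) *\<^sub>R z)"
      by (simp add: g_def left_diff_distrib right_diff_distrib scaleR_2 scaleR_right_diff_distrib)
    finally have "f z (Suc m) = g * g + 2 *\<^sub>R f z m"
      by (simp add: f_def w_def)
    moreover have "tr (g * g * x) \<le> tr (g * g * y)"
      using z by (intro tr_square_mult_mono xy) (auto simp: g_def w_def)
    ultimately show ?case using Suc by (simp add: distrib_right)
  qed
  from this[of "(1 / 2 ^ k) *\<^sub>R u" k] u show ?thesis
    by (simp add: f_def exp_approx_rem_def exp_approx_def)
qed

text \<open>For \<open>k \<ge> 1\<close> the exponent \<open>2 ^ k\<close> is even, so the
  approximate exponential of a self-adjoint element is itself a square.\<close>

lemma tr_exp_approx_mult_mono: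
  assumes xy: "form_le x y" "x \<in> S" "y \<in> S" and u: "u \<in> S" "star u = u" and k: "1 \<le> k"
  shows "tr (exp_approx k u * x) \<le> tr (exp_approx k u * y)"
proof -
  define g where "g = (1 + (1 / 2 ^ k) *\<^sub>R u) ^ (2 ^ (k - 1))"
  have "2 ^ (k - 1) + 2 ^ (k - 1) = (2 ^ k :: nat)"
    using k by (cases k) simp_all
  then have "exp_approx k u = g * g"
    by (simp only: exp_approx_def g_def power_add[symmetric])
  moreover have "tr (g * g * x) \<le> tr (g * g * y)"
    using u by (intro tr_square_mult_mono xy) (auto simp: g_def)
  ultimately show ?thesis by simp
qed

text \<open>The scalar inequality e^x <= 1 + x + x^2 for |x| <= 1. Past its affine part the binomial
  expansion of (1 + x/N)^j is \<open>x * g * x\<close>, where \<open>g\<close> is a polynomial in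
  \<open>x\<close> with nonnegative coefficients; its norm is thus at most its value
  \<open>c j\<close> at the scalar 1. For j = N this value is (1 + 1/N)^N - 2, at most e -
  2.\<close>

lemma exp_approx_form_le:
  assumes x: "op_bounded 1 x" "star x = x"
  shows "form_le (exp_approx k x) (1 + x + x * x)"
proof -
  define N :: real where "N = 2 ^ k"
  have N: "N > 0" by (simp add: N_def)
  define c where "c j = (1 + 1 / N) ^ j - 1 - real j / N" for j
  have "\<exists>g. op_bounded (c j) g \<and> g * x = x * g \<and>
      (1 + (1 / N) *\<^sub>R x) ^ j = 1 + (real j / N) *\<^sub>R x + x * g * x" for j
  proof (induction j)
    case 0
    then show ?case by (intro exI[of _ 0]) (simp add: c_def op_bounded_zero)
  next
    case (Suc j)
    then obtain g where g: "op_bounded (c j) g" "g * x = x * g"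
      "(1 + (1 / N) *\<^sub>R x) ^ j = 1 + (real j / N) *\<^sub>R x + x * g * x" by blast
    define h where "h = g + (real j / N\<^sup>2) *\<^sub>R 1 + (1 / N) *\<^sub>R (g * x)"
    have "op_bounded (c j + \<bar>real j / N\<^sup>2\<bar> * 1 + \<bar>1 / N\<bar> * (c j * 1)) h"
      unfolding h_def by (intro op_bounded_add op_bounded_scaleR op_bounded_mult op_bounded_one g x)
    moreover have "c j + \<bar>real j / N\<^sup>2\<bar> * 1 + \<bar>1 / N\<bar> * (c j * 1) = c (Suc j)"
      using N by (simp add: c_def field_simps power2_eq_square)
    moreover have "h * x = x * h"
      using g(2) by (simp add: h_def algebra_simps)
    moreover have "(1 + (1 / N) *\<^sub>R x) ^ Suc j = 1 + (real (Suc j) / N) *\<^sub>R x + x * h * x"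
    proof -
      have "(1 + (1 / N) *\<^sub>R x) ^ Suc j = (1 + (real j / N) *\<^sub>R x + x * g * x) * (1 + (1 / N) *\<^sub>R x)"
        by (simp only: power_Suc2 g(3))
      also have "\<dots> = 1 + (real j / N) *\<^sub>R x + (1 / N) *\<^sub>R x
          + (x * g * x + (real j / N\<^sup>2) *\<^sub>R (x * x) + (1 / N) *\<^sub>R (x * g * x * x))"
        by (simp add: algebra_simps power2_eq_square)
      also have "x * g * x + (real j / N\<^sup>2) *\<^sub>R (x * x) + (1 / N) *\<^sub>R (x * g * x * x) = x * h * x"
        by (simp add: h_def algebra_simps)
      also have "1 + (real j / N) *\<^sub>R x + (1 / N) *\<^sub>R x = 1 + (real (Suc j) / N) *\<^sub>R x"
        by (simp add: add.assoc add_divide_distrib add.commute flip: scaleR_add_left)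
      finally show ?thesis .
    qed
    ultimately show ?case by metis
  qed
  from this[of "2 ^ k"] obtain g where g: "op_bounded (c (2 ^ k)) g"
    "exp_approx k x = 1 + x + x * g * x"
    by (auto simp: N_def exp_approx_def)
  have "c (2 ^ k) \<le> 1"
  proof -
    have "(1 + 1 / N) ^ (2 ^ k) \<le> exp (1 / N) ^ (2 ^ k)"
      using N by (intro power_mono exp_ge_add_one_self) auto
    also have "\<dots> = exp 1" using N by (simp add: exp_of_nat_mult[symmetric] N_def)
    also have "\<dots> \<le> 3" by (rule exp_le)
    finally show ?thesis by (simp add: c_def N_def)
  qed
  with g(1) have g1: "op_bounded 1 g" by (rule op_bounded_mono)
  show ?thesis unfolding form_le_def
  proof
    fix z assume z: "z \<in> S"
    have "tr (star z * (x * g * x) * z) = tr (star (x * z) * (g * (x * z)))"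
      using x by (simp add: mult.assoc)
    also have "\<dots> \<le> frob (x * z) * frob (g * (x * z))"
      using abs_tr_star_mult_le[of "x * z" "g * (x * z)"] x z g1 by simp
    also have "\<dots> \<le> frob (x * z) * (1 * frob (x * z))"
      using x z g1 by (intro mult_left_mono op_boundedD) auto
    also have "\<dots> = tr (star z * (x * x) * z)"
      using frob_square[of "x * z"] x z by (simp add: power2_eq_square mult.assoc)
    finally show "tr (star z * exp_approx k x * z) \<le> tr (star z * (1 + x + x * x) * z)"
      by (simp add: g(2) distrib_left distrib_right)
  qed
qed

text \<open>Jensen's inequality for the powers, by repeated squaring: for normalized
  \<open>z\<close>, Cauchy--Schwarz bounds the square of \<open>tr (star z * u * z)\<close> by
  \<open>tr (star z * (u * u) * z)\<close>. Nonnegativity lets the induction hypothesis be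
  squared.\<close>

lemma power_tr_le_tr_power:
  assumes z: "z \<in> S" "tr (star z * z) = 1" and w: "w \<in> S" "star w = w"
    and nonneg: "0 \<le> tr (star z * w * z)"
  shows "tr (star z * w * z) ^ (2 ^ k) \<le> tr (star z * w ^ (2 ^ k) * z)"
proof (induction k)
  case (Suc k)
  let ?u = "w ^ (2 ^ k)"
  have "tr (star z * w * z) ^ (2 ^ Suc k) = (tr (star z * w * z) ^ (2 ^ k))\<^sup>2"
    by (simp add: power_mult[symmetric] mult.commute)
  also have "\<dots> \<le> (tr (star z * ?u * z))\<^sup>2"
    using Suc nonneg by (intro power_mono) auto
  also have "\<dots> \<le> (frob z * frob (?u * z))\<^sup>2"
    using abs_tr_star_mult_le[of z "?u * z"] z w by (intro power2_le_iff_abs_le[THEN iffD2]) (auto simp: mult.assoc)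
  also have "\<dots> = tr (star z * (?u * ?u) * z)"
    using frob_square[of z] frob_square[of "?u * z"] z w by (simp add: power_mult_distrib mult.assoc)
  also have "?u * ?u = w ^ (2 ^ Suc k)"
    by (simp add: mult_2 power_add)
  finally show ?case .
qed simp

text \<open>This links a large Rayleigh quotient to a large trace, as Markov's inequality requires.
  A partial isometry \<open>z\<close> with \<open>tr (star z * z) = 1\<close> plays the part of a
  unit vector, and \<open>z * star z\<close> of the projection onto its line.\<close>

lemma exp_approx_rem_le_tr:
  assumes z: "z \<in> S" "z * star z * z = z" "tr (star z * z) = 1" and y: "y \<in> S" "star y = y"
    and t: "0 \<le> t" "t \<le> tr (star z * y * z)"
  shows "exp_approx_rem k t \<le> tr (exp_approx_rem k y)"
proof -
  define \<tau> where "\<tau> = tr (star z * y * z)"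
  define w where "w = 1 + (1 / 2 ^ k) *\<^sub>R y"
  have w\<tau>: "tr (star z * w * z) = 1 + \<tau> / 2 ^ k"
    using z by (simp add: w_def \<tau>_def algebra_simps)
  have "z * star z * (z * star z) = z * star z"
    using z(2) by (metis mult.assoc)
  then have "op_bounded 1 (z * star z)"
    using z by (intro op_bounded_projection) auto
  have le1: "form_le (z * star z) 1" unfolding form_le_def
  proof
    fix u assume u: "u \<in> S"
    let ?p = "z * star z"
    have "tr (star u * ?p * u) = tr (star (?p * u) * (?p * u))"
      using z(2) by (simp add: mult.assoc) (metis mult.assoc)
    also have "\<dots> \<le> tr (star u * u)"
      using op_boundedD[OF \<open>op_bounded 1 ?p\<close> u] by (simp add: frob_def)
    finally show "tr (star u * ?p * u) \<le> tr (star u * 1 * u)" by simp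
  qed
  \<comment> \<open>The derivative of (1 + u/N)^N - u is (1 + u/N)^(N-1) - 1, which is nonnegative
    for u >= 0.\<close>
  have mono: "exp_approx_rem k t \<le> exp_approx_rem k \<tau>"
  proof -
    have "\<tau> - t \<le> (1 + \<tau> / 2 ^ k) ^ (2 ^ k) - (1 + t / 2 ^ k) ^ (2 ^ k)"
    proof -
      define f where "f u = (1 + u / 2 ^ k) ^ (2 ^ k) - u" for u :: real
      have "f t \<le> f \<tau>"
      proof (rule DERIV_nonneg_imp_nondecreasing[of t \<tau> f])
        show "t \<le> \<tau>" using t by (simp add: \<tau>_def)
        fix u assume u: "t \<le> u" "u \<le> \<tau>"
        have "(f has_real_derivative (real (2 ^ k) * (1 + u / 2 ^ k) ^ (2 ^ k - 1) * (1 / 2 ^ k) - 1)) (at u)"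
          unfolding f_def by (auto intro!: derivative_eq_intros)
        moreover have "0 \<le> real (2 ^ k) * (1 + u / 2 ^ k) ^ (2 ^ k - 1) * (1 / 2 ^ k) - 1"
          using u t by (simp add: one_le_power)
        ultimately show "\<exists>y. (f has_real_derivative y) (at u) \<and> 0 \<le> y" by blast
      qed
      then show ?thesis by (simp add: f_def)
    qed
    then show ?thesis by (simp add: exp_approx_rem_def exp_approx_def)
  qed
  also have "exp_approx_rem k \<tau> = tr (star z * w * z) ^ (2 ^ k) - 1 - \<tau>"
    by (simp add: exp_approx_rem_def exp_approx_def w\<tau>)
  also have "\<dots> \<le> tr (star z * w ^ (2 ^ k) * z) - 1 - \<tau>"
    using z y t w\<tau> by (intro diff_mono power_tr_le_tr_power) (auto simp: w_def \<tau>_def)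
  also have "\<dots> = tr (star z * (exp_approx_rem k y * z))"
    using z by (simp add: exp_approx_rem_def exp_approx_def w_def \<tau>_def algebra_simps)
  also have "\<dots> = tr (exp_approx_rem k y * (z * star z))"
    using z y tr_commute[of "star z" "exp_approx_rem k y * z"] by (simp add: mult.assoc)
  \<comment> \<open>The remainder is a sum of squares, so replacing the projection by 1 can only
    increase the trace.\<close>
  also have "\<dots> \<le> tr (exp_approx_rem k y * 1)"
    using z y by (intro tr_exp_approx_rem_mult_mono le1) auto
  finally show ?thesis by simp
qed

end

section \<open>Matrix concentration\<close>

lemma finite_set_Pi_pmf:
  "finite A \<Longrightarrow> finite (set_pmf P) \<Longrightarrow> finite (set_pmf (Pi_pmf A d (\<lambda>_. P)))"
  by (rule finite_subset[OF set_Pi_pmf_subset']) auto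

lemma LIMSEQ_two_power: "filterlim (\<lambda>k. 2 ^ k :: real) at_top sequentially"
  using filterlim_realpow_sequentially_gt1[of "2::real"]
  by (auto simp: filterlim_at_infinity_conv_norm_at_top filterlim_real_sequentially)

text \<open>The newest sample is averaged first, with the earlier ones held fixed. This is the
  recursion that drives the induction on the number of samples.\<close>

lemma expectation_Pi_pmf_Suc:
  fixes F :: "(nat \<Rightarrow> 'i) \<Rightarrow> real"
  assumes J: "finite J" "set_pmf P \<subseteq> J"
  shows "measure_pmf.expectation (Pi_pmf {..<Suc s} d (\<lambda>_. P)) F =
    measure_pmf.expectation (Pi_pmf {..<s} d (\<lambda>_. P)) (\<lambda>f. \<Sum>j\<in>J. pmf P j * F (f(s := j)))"
proof -
  have fin: "finite (set_pmf (Pi_pmf {..<s} d (\<lambda>_. P)))"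
    using J finite_subset by (intro finite_set_Pi_pmf) auto
  have "Pi_pmf {..<Suc s} d (\<lambda>_. P) =
      P \<bind> (\<lambda>j. map_pmf (\<lambda>f. f(s := j)) (Pi_pmf {..<s} d (\<lambda>_. P)))"
    by (simp add: lessThan_Suc Pi_pmf_insert' map_pmf_def)
  then have "measure_pmf.expectation (Pi_pmf {..<Suc s} d (\<lambda>_. P)) F =
      (\<Sum>j\<in>J. pmf P j * measure_pmf.expectation (Pi_pmf {..<s} d (\<lambda>_. P)) (\<lambda>f. F (f(s := j))))"
    using J fin by (simp add: pmf_expectation_bind[of J])
  also have "\<dots> = measure_pmf.expectation (Pi_pmf {..<s} d (\<lambda>_. P))
      (\<lambda>f. \<Sum>j\<in>J. pmf P j * F (f(s := j)))"
    by (subst Bochner_Integration.integral_sum)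
      (auto intro!: integrable_measure_pmf_finite fin)
  finally show ?thesis .
qed

context trace_algebra
begin

lemma tr_exp_approx_rem_nonneg:
  assumes "u \<in> S" "star u = u"
  shows "0 \<le> tr (exp_approx_rem k u)"
proof -
  have "form_le 0 1" by (simp add: form_le_def tr_nonneg)
  then show ?thesis using tr_exp_approx_rem_mult_mono[of 0 1 u k] assms by simp
qed

text \<open>One new sample. After Golden--Thompson its exponential is bounded by
  \<open>1 + X j + X j * X j\<close>; on averaging, the linear term vanishes and the quadratic term
  is at most \<open>a *\<^sub>R M\<close>.\<close>

lemma tr_exp_approx_rem_step:
  assumes J: "\<And>j. j \<in> J \<Longrightarrow> 0 \<le> p j" "sum p J = 1"
    and X: "\<And>j. op_bounded 1 (X j)" "\<And>j. star (X j) = X j"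
      "(\<Sum>j\<in>J. p j *\<^sub>R X j) = 0"
      "form_le (\<Sum>j\<in>J. p j *\<^sub>R (X j * X j)) (a *\<^sub>R M)" "0 \<le> a"
    and M: "M \<in> S" "form_le M 1"
    and Y: "op_bounded \<beta> Y" "star Y = Y" "1 \<le> \<beta>" and k: "1 \<le> k"
  shows "(\<Sum>j\<in>J. p j * tr (exp_approx_rem k (Y + X j)))
    \<le> (1 + a) * tr (exp_approx_rem k Y) + a * (tr M + tr (Y * M))
      + \<beta>\<^sup>2 * exp (2 * \<beta>) * tr 1 / 2 ^ k"
proof -
  define err where "err = \<beta>\<^sup>2 * exp (2 * \<beta>) * tr 1 / 2 ^ k"
  define V where "V = (\<Sum>j\<in>J. p j *\<^sub>R (X j * X j))"
  let ?E = "exp_approx k Y"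
  have S: "X j \<in> S" "Y \<in> S" for j
    using op_bounded_closed[OF X(1)] op_bounded_closed[OF Y(1)] by auto
  have "tr (exp_approx k (Y + X j)) \<le> tr (?E * (1 + X j + X j * X j)) + err" for j
  proof -
    have "tr (exp_approx k (Y + X j)) \<le> tr (?E * exp_approx k (X j)) + err"
      unfolding err_def using X Y op_bounded_mono by (intro tr_exp_approx_add_le) blast+
    also have "tr (?E * exp_approx k (X j)) \<le> tr (?E * (1 + X j + X j * X j))"
      using S X Y k by (intro tr_exp_approx_mult_mono exp_approx_form_le) auto
    finally show ?thesis by simp
  qed
  then have "(\<Sum>j\<in>J. p j * tr (exp_approx k (Y + X j)))
      \<le> (\<Sum>j\<in>J. p j * (tr (?E * (1 + X j + X j * X j)) + err))"
    using J by (intro sum_mono mult_left_mono) auto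
  also have "\<dots> = (\<Sum>j\<in>J. p j * tr ?E) + (\<Sum>j\<in>J. p j * tr (?E * X j))
      + (\<Sum>j\<in>J. p j * tr (?E * (X j * X j))) + (\<Sum>j\<in>J. p j * err)"
    by (simp add: algebra_simps sum.distrib)
  also have "(\<Sum>j\<in>J. p j * tr ?E) = tr ?E"
    using J by (simp add: sum_distrib_right[symmetric])
  also have "(\<Sum>j\<in>J. p j * err) = err"
    using J by (simp add: sum_distrib_right[symmetric])
  also have "(\<Sum>j\<in>J. p j * tr (?E * X j)) = tr (?E * (\<Sum>j\<in>J. p j *\<^sub>R X j))"
    by (simp add: sum_distrib_left tr_sum)
  also have "\<dots> = 0" by (simp add: X(3))
  also have "(\<Sum>j\<in>J. p j * tr (?E * (X j * X j))) = tr (?E * V)"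
    by (simp add: sum_distrib_left tr_sum V_def)
  also have "tr (?E * V) \<le> tr (?E * (a *\<^sub>R M))"
    using S X Y M k by (intro tr_exp_approx_mult_mono) (auto simp: V_def)
  \<comment> \<open>The affine part of the exponential is kept against \<open>M\<close>. Only the
    remainder is compared with 1 through M <= 1, so \<open>tr M\<close> appears where a direct
    estimate would produce \<open>tr 1\<close>.\<close>
  also have "tr (?E * (a *\<^sub>R M)) = a * (tr M + tr (Y * M) + tr (exp_approx_rem k Y * M))"
    by (simp add: exp_approx_rem_def algebra_simps)
  also have "\<dots> \<le> a * (tr M + tr (Y * M) + tr (exp_approx_rem k Y * 1))"
    using S X Y M by (intro mult_left_mono add_left_mono tr_exp_approx_rem_mult_mono) auto
  finally have *: "(\<Sum>j\<in>J. p j * tr (exp_approx k (Y + X j)))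
      \<le> tr ?E + a * (tr M + tr (Y * M) + tr (exp_approx_rem k Y)) + err"
    by simp
  have "(\<Sum>j\<in>J. p j * tr (exp_approx_rem k (Y + X j)))
      = (\<Sum>j\<in>J. p j * tr (exp_approx k (Y + X j))) - (\<Sum>j\<in>J. p j * (tr 1 + tr Y))
        - (\<Sum>j\<in>J. p j * tr (X j))"
    by (simp add: exp_approx_rem_def algebra_simps sum.distrib sum_subtractf)
  also have "(\<Sum>j\<in>J. p j * tr (X j)) = tr (\<Sum>j\<in>J. p j *\<^sub>R X j)"
    by (simp add: tr_sum)
  also have "\<dots> = 0" by (simp add: X(3))
  also have "(\<Sum>j\<in>J. p j * (tr 1 + tr Y)) = tr 1 + tr Y"
    using J by (simp add: sum_distrib_right[symmetric])
  finally show ?thesis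
    using * by (simp add: exp_approx_rem_def err_def algebra_simps)
qed

text \<open>Markov's inequality for the trace of the remainder, followed by the limit in
  \<open>k\<close>. The dimensional factor is \<open>tr M\<close>. The conclusion is left in product
  form because \<open>exp t - 1 - t\<close> vanishes at t = 0.\<close>

theorem matrix_bernstein:
  fixes X :: "'i \<Rightarrow> 'a" and s :: nat
  assumes J: "finite J" "set_pmf P \<subseteq> J"
    and X: "\<And>j. op_bounded 1 (X j)" "\<And>j. star (X j) = X j"
      "(\<Sum>j\<in>J. pmf P j *\<^sub>R X j) = 0"
      "form_le (\<Sum>j\<in>J. pmf P j *\<^sub>R (X j * X j)) (a *\<^sub>R M)" "0 \<le> a"
    and M: "M \<in> S" "form_le M 1" "0 \<le> tr M"
    and t: "0 \<le> t"
  shows "measure_pmf.prob (Pi_pmf {..<s} d (\<lambda>_. P))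
      {f. \<exists>z\<in>S. z * star z * z = z \<and> tr (star z * z) = 1 \<and> t \<le> tr (star z * (\<Sum>c<s. X (f c)) * z)}
    * (exp t - 1 - t) \<le> tr M * (exp (a * s) - 1)"
proof -
  define E where "E s F = measure_pmf.expectation (Pi_pmf {..<s} d (\<lambda>_. P)) F"
    for s :: nat and F :: "(nat \<Rightarrow> 'i) \<Rightarrow> real"
  define Y where "Y s f = (\<Sum>c<s. X (f c))" for s :: nat and f :: "nat \<Rightarrow> 'i"
  \<comment> \<open>Bounds every partial sum, and is at least 1 so that it also bounds a single
    sample.\<close>
  define \<beta> where "\<beta> = real s + 1"
  define err where "err k = \<beta>\<^sup>2 * exp (2 * \<beta>) * tr 1 / 2 ^ k" for k
  have pmf1: "sum (pmf P) J = 1"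
    using J by (simp add: sum_pmf_eq_1)
  have int [simp]: "integrable (measure_pmf (Pi_pmf {..<s} d (\<lambda>_. P))) F"
    for s :: nat and F :: "(nat \<Rightarrow> 'i) \<Rightarrow> real"
    using J finite_subset by (intro integrable_measure_pmf_finite finite_set_Pi_pmf) auto
  have E_Suc: "E (Suc m) F = E m (\<lambda>f. \<Sum>j\<in>J. pmf P j * F (f(m := j)))" for m F
    unfolding E_def by (rule expectation_Pi_pmf_Suc[OF J])
  have E_mono: "E m F \<le> E m G" if "\<And>f. F f \<le> G f" for m F G
    unfolding E_def using that by (intro integral_mono) auto
  have Y_S: "Y m f \<in> S" "star (Y m f) = Y m f" for m f
    using X op_bounded_closed[OF X(1)] by (auto simp: Y_def)
  have Y_bd: "op_bounded (real m) (Y m f)" for m f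
    using op_bounded_sum[of "{..<m}" "\<lambda>_. 1" "\<lambda>c. X (f c)"] X by (simp add: Y_def)
  have Y_Suc: "Y (Suc m) (f(m := j)) = Y m f + X j" for m f j
    by (simp add: Y_def)
  \<comment> \<open>The partial sums stay centred, since a new sample averages to zero given the
    earlier ones; the linear term of the one-step bound thus disappears in expectation.\<close>
  have EYM: "E m (\<lambda>f. tr (Y m f * M)) = 0" for m
  proof (induction m)
    case 0
    then show ?case by (simp add: E_def Y_def)
  next
    case (Suc m)
    have "(\<Sum>j\<in>J. pmf P j * tr ((Y m f + X j) * M)) = tr (Y m f * M)" for f
    proof -
      have "(\<Sum>j\<in>J. pmf P j * tr ((Y m f + X j) * M))
          = (\<Sum>j\<in>J. pmf P j * tr (Y m f * M)) + (\<Sum>j\<in>J. pmf P j * tr (X j * M))"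
        by (simp add: algebra_simps sum.distrib)
      also have "(\<Sum>j\<in>J. pmf P j * tr (X j * M)) = tr ((\<Sum>j\<in>J. pmf P j *\<^sub>R X j) * M)"
        by (simp add: sum_distrib_right tr_sum)
      also have "\<dots> = 0" by (simp add: X(3))
      finally show ?thesis using pmf1 by (simp add: sum_distrib_right[symmetric])
    qed
    then show ?case using Suc by (simp add: E_Suc Y_Suc)
  qed
  \<comment> \<open>The solution of the recursion b -> (1 + a) b + a tr M + err started at 0, with
    the error terms rounded up.\<close>
  have bound: "E m (\<lambda>f. tr (exp_approx_rem k (Y m f)))
      \<le> tr M * ((1 + a) ^ m - 1) + real m * (1 + a) ^ m * err k" if "m \<le> s" "1 \<le> k" for m k
    using that
  proof (induction m)
    case 0
    then show ?case by (simp add: E_def Y_def exp_approx_rem_def exp_approx_def)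
  next
    case (Suc m)
    have err0: "0 \<le> err k" using tr_one_nonneg by (simp add: err_def)
    have "E (Suc m) (\<lambda>f. tr (exp_approx_rem k (Y (Suc m) f)))
        \<le> E m (\<lambda>f. (1 + a) * tr (exp_approx_rem k (Y m f)) + a * (tr M + tr (Y m f * M)) + err k)"
      unfolding E_Suc Y_Suc
    proof (rule E_mono)
      fix f
      have "op_bounded \<beta> (Y m f)"
        using Suc.prems by (intro op_bounded_mono[OF Y_bd]) (simp add: \<beta>_def)
      then show "(\<Sum>j\<in>J. pmf P j * tr (exp_approx_rem k (Y m f + X j)))
          \<le> (1 + a) * tr (exp_approx_rem k (Y m f)) + a * (tr M + tr (Y m f * M)) + err k"
        unfolding err_def using pmf1 X M Y_S Suc.prems
        by (intro tr_exp_approx_rem_step) (auto simp: \<beta>_def)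
    qed
    also have "\<dots> = (1 + a) * E m (\<lambda>f. tr (exp_approx_rem k (Y m f)))
        + a * (tr M + E m (\<lambda>f. tr (Y m f * M))) + err k"
      by (simp add: E_def)
    also have "\<dots> = (1 + a) * E m (\<lambda>f. tr (exp_approx_rem k (Y m f))) + a * tr M + err k"
      by (simp add: EYM)
    also have "\<dots> \<le> (1 + a) * (tr M * ((1 + a) ^ m - 1) + real m * (1 + a) ^ m * err k)
        + a * tr M + (1 + a) ^ Suc m * err k"
    proof -
      have "1 * err k \<le> (1 + a) ^ Suc m * err k"
        using X(5) err0 by (intro mult_right_mono one_le_power) auto
      then show ?thesis using Suc X(5) by (intro add_mono mult_left_mono) auto
    qed
    also have "\<dots> = tr M * ((1 + a) ^ Suc m - 1) + real (Suc m) * (1 + a) ^ Suc m * err k"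
      by (simp add: algebra_simps)
    finally show ?case .
  qed
  define B where "B = {f. \<exists>z\<in>S. z * star z * z = z \<and> tr (star z * z) = 1 \<and>
    t \<le> tr (star z * Y s f * z)}"
  define pr where "pr = measure_pmf.prob (Pi_pmf {..<s} d (\<lambda>_. P)) B"
  have markov: "pr * exp_approx_rem k t
      \<le> tr M * ((1 + a) ^ s - 1) + real s * (1 + a) ^ s * err k" if k: "1 \<le> k" for k
  proof -
    have "pr * exp_approx_rem k t = E s (\<lambda>f. indicator B f * exp_approx_rem k t)"
      by (simp add: E_def pr_def)
    also have "\<dots> \<le> E s (\<lambda>f. tr (exp_approx_rem k (Y s f)))"
    proof (rule E_mono)
      fix f
      show "indicator B f * exp_approx_rem k t \<le> tr (exp_approx_rem k (Y s f))"
      proof (cases "f \<in> B")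
        case True
        then obtain z where "z \<in> S" "z * star z * z = z" "tr (star z * z) = 1"
          "t \<le> tr (star z * Y s f * z)" by (auto simp: B_def)
        then show ?thesis
          using True exp_approx_rem_le_tr[of z "Y s f" t k] Y_S t by simp
      next
        case False
        then show ?thesis using tr_exp_approx_rem_nonneg Y_S by simp
      qed
    qed
    also note bound[OF order_refl k]
    finally show ?thesis .
  qed
  have "(\<lambda>k. (1 + t / real (2 ^ k)) powr real (2 ^ k)) \<longlonglongrightarrow> exp t"
    by (rule filterlim_compose[OF tendsto_exp_limit_at_top])
      (auto intro!: LIMSEQ_two_power)
  moreover have "(1 + t / real (2 ^ k)) powr real (2 ^ k) = exp_approx k t" for k
  proof -
    have "0 < 1 + t / real (2 ^ k)" using t by (intro add_pos_nonneg) auto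
    then show ?thesis unfolding exp_approx_def by (subst powr_realpow) auto
  qed
  ultimately have "(\<lambda>k. exp_approx k t) \<longlonglongrightarrow> exp t" by simp
  then have "(\<lambda>k. pr * exp_approx_rem k t) \<longlonglongrightarrow> pr * (exp t - 1 - t)"
    unfolding exp_approx_rem_def by (intro tendsto_intros)
  moreover have "(\<lambda>k. tr M * ((1 + a) ^ s - 1) + real s * (1 + a) ^ s * err k)
      \<longlonglongrightarrow> tr M * ((1 + a) ^ s - 1) + real s * (1 + a) ^ s * 0"
    unfolding err_def
    by (intro tendsto_add tendsto_mult tendsto_const LIMSEQ_divide_realpow_zero) simp
  ultimately have "pr * (exp t - 1 - t) \<le> tr M * ((1 + a) ^ s - 1) + real s * (1 + a) ^ s * 0"
    by (rule LIMSEQ_le) (use markov in blast)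
  also have "\<dots> \<le> tr M * (exp (a * s) - 1)"
  proof -
    have "(1 + a) ^ s \<le> exp a ^ s"
      using X(5) by (intro power_mono exp_ge_add_one_self) auto
    also have "\<dots> = exp (a * s)" by (simp add: exp_of_nat_mult[symmetric] mult.commute)
    finally show ?thesis using M(3) by (simp add: mult_left_mono)
  qed
  finally show ?thesis by (simp add: pr_def B_def Y_def)
qed

text \<open>Sampling proportionally to \<open>lev j\<close> turns each reweighted summand into D
  times a projection, so all summands have the same norm bound, and the variance D M - M^2 is at
  most D M. Both are governed by the effective dimension. The sign \<sigma> selects one of the two
  tails.\<close>

theorem leverage_sampling_tail:
  fixes r :: "nat \<Rightarrow> 'a" and lev :: "nat \<Rightarrow> real"
  assumes r: "\<And>j. r j \<in> S" "\<And>j. star (r j) = r j" "\<And>j. r j * r j = lev j *\<^sub>R r j"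
      "\<And>j. tr (r j) = lev j" "\<And>j. 0 \<le> lev j" "\<And>j. lev j = 0 \<Longrightarrow> r j = 0"
    and M: "M = (\<Sum>j<n. r j)" "form_le M 1"
    and D: "D = (\<Sum>j<n. lev j)" "0 < D"
    and P: "\<And>j. pmf P j = (if j < n then lev j / D else 0)"
    and \<epsilon>: "0 < \<epsilon>" "\<epsilon> < 1 / 4" and L: "1 \<le> L" and s: "64 * D / \<epsilon>\<^sup>2 * L \<le> real s"
    and \<sigma>: "\<sigma> = 1 \<or> \<sigma> = -1"
  shows "measure_pmf.prob (Pi_pmf {..<s} d (\<lambda>_. P))
      {f. \<exists>z\<in>S. z * star z * z = z \<and> tr (star z * z) = 1 \<and>
        \<epsilon> / 2 \<le> \<sigma> * tr (star z * ((\<Sum>c<s. (D / (real s * lev (f c))) *\<^sub>R r (f c)) - M) * z)}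
    \<le> 2 * D * exp (- (3 * L))"
proof -
  have s0: "0 < s"
  proof (rule ccontr)
    assume "\<not> 0 < s"
    then have "64 * D / \<epsilon>\<^sup>2 * L \<le> 0" using s by simp
    moreover have "0 < 64 * D / \<epsilon>\<^sup>2 * L" using D \<epsilon> L by simp
    ultimately show False by simp
  qed
  \<comment> \<open>Turns a deviation of \<epsilon>/2 into the threshold 4 L, while the total
    variance \<theta>^2 D / s stays at most L by the assumption on \<open>s\<close>.\<close>
  define \<theta> where "\<theta> = 8 * L / \<epsilon>"
  have \<theta>: "0 < \<theta>" using L \<epsilon> by (simp add: \<theta>_def)
  define b where "b = \<theta> / real s"
  have b: "0 < b" using \<theta> s0 by (simp add: b_def)
  \<comment> \<open>For \<open>lev j = 0\<close> division by zero yields \<open>u j = 0\<close>, in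
    agreement with \<open>r j = 0\<close>.\<close>
  define u where "u j = (1 / lev j) *\<^sub>R r j" for j
  define X where "X j = (\<sigma> * b) *\<^sub>R (D *\<^sub>R u j - M)" for j
  have sD: "64 * D * L \<le> real s * \<epsilon>\<^sup>2"
    using s \<epsilon> by (simp add: field_simps)
  have u: "u j \<in> S" "star (u j) = u j" "u j * u j = u j" for j
    using r by (auto simp: u_def)
  have ru: "lev j *\<^sub>R u j = r j" for j
    using r(6)[of j] by (cases "lev j = 0") (auto simp: u_def)
  have Pu: "pmf P j *\<^sub>R (D *\<^sub>R u j) = r j" if "j < n" for j
    using that D P ru[of j] by simp
  have M_S: "M \<in> S" "star M = M" using r M by auto
  have M_bd: "op_bounded D M"
  proof -
    have "op_bounded (lev j) (r j)" for j
      using op_bounded_scaleR[OF op_bounded_projection[OF u], of "lev j" j] r(5)[of j] by (simp add: ru)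
    then show ?thesis unfolding M D by (intro op_bounded_sum)
  qed
  have X_bd: "op_bounded 1 (X j)" for j
  proof -
    have "op_bounded (\<bar>\<sigma> * b\<bar> * (\<bar>D\<bar> * 1 + \<bar>-1\<bar> * D)) ((\<sigma> * b) *\<^sub>R (D *\<^sub>R u j + (-1) *\<^sub>R M))"
      by (intro op_bounded_scaleR op_bounded_add op_bounded_projection u M_bd)
    \<comment> \<open>The norm is at most 2 D b = 16 D L / (\<epsilon> s). The sample size controls
      s \<epsilon>^2, and \<epsilon> < 1/4 passes from there to s \<epsilon>.\<close>
    moreover have "\<bar>\<sigma> * b\<bar> * (\<bar>D\<bar> * 1 + \<bar>-1\<bar> * D) \<le> 1"
    proof -
      have "16 * D * L \<le> real s * \<epsilon>"
      proof -
        have "\<epsilon> * \<epsilon> \<le> \<epsilon> * (1/4)" using \<epsilon> by (intro mult_left_mono) auto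
        then have "real s * \<epsilon>\<^sup>2 \<le> real s * (\<epsilon> * (1/4))"
          by (intro mult_left_mono) (auto simp: power2_eq_square)
        then have "4 * (real s * \<epsilon>\<^sup>2) \<le> real s * \<epsilon>" by simp
        moreover have "64 * (D * L) \<le> real s * \<epsilon>\<^sup>2" using sD by (simp only: mult.assoc)
        moreover have "0 \<le> D * L" using D L by simp
        ultimately have "16 * (D * L) \<le> real s * \<epsilon>" by linarith
        then show ?thesis by (simp only: mult.assoc)
      qed
      then have "b * (2 * D) \<le> 1"
        using s0 \<epsilon> by (simp add: b_def \<theta>_def field_simps)
      then show ?thesis using \<sigma> b D by (auto simp: abs_mult)
    qed
    ultimately show ?thesis unfolding X_def by (auto intro: op_bounded_mono)
  qed
  have P1: "(\<Sum>j<n. pmf P j) = 1"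
    using D by (simp add: P sum_divide_distrib[symmetric])
  have EX: "(\<Sum>j<n. pmf P j *\<^sub>R X j) = 0"
  proof -
    have "(\<Sum>j<n. pmf P j *\<^sub>R X j) = (\<sigma> * b) *\<^sub>R (\<Sum>j<n. pmf P j *\<^sub>R (D *\<^sub>R u j) - pmf P j *\<^sub>R M)"
      by (simp add: X_def scaleR_right_diff_distrib scaleR_sum_right mult.left_commute mult.commute)
    also have "\<dots> = (\<sigma> * b) *\<^sub>R ((\<Sum>j<n. r j) - (\<Sum>j<n. pmf P j) *\<^sub>R M)"
      by (simp add: sum_subtractf Pu scaleR_sum_left del: scaleR_scaleR)
    finally show ?thesis by (simp add: P1 M(1))
  qed
  define a where "a = b\<^sup>2 * D"
  have EX2: "form_le (\<Sum>j<n. pmf P j *\<^sub>R (X j * X j)) (a *\<^sub>R M)"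
  proof -
    have \<sigma>b: "\<sigma> * b * (\<sigma> * b) = b\<^sup>2" using \<sigma> by (auto simp: power2_eq_square)
    have XX: "X j * X j = b\<^sup>2 *\<^sub>R (D *\<^sub>R (D *\<^sub>R u j) - (D *\<^sub>R u j) * M - M * (D *\<^sub>R u j) + M * M)" for j
    proof -
      have "X j * X j = (\<sigma> * b * (\<sigma> * b)) *\<^sub>R ((D *\<^sub>R u j - M) * (D *\<^sub>R u j - M))"
        by (simp add: X_def)
      also have "(D *\<^sub>R u j - M) * (D *\<^sub>R u j - M)
          = D *\<^sub>R (D *\<^sub>R u j) - (D *\<^sub>R u j) * M - M * (D *\<^sub>R u j) + M * M"
        using u(3)[of j] by (simp add: algebra_simps)
      finally show ?thesis by (simp only: \<sigma>b)
    qed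
    have "(\<Sum>j<n. pmf P j *\<^sub>R (X j * X j)) = b\<^sup>2 *\<^sub>R (\<Sum>j<n. D *\<^sub>R (pmf P j *\<^sub>R (D *\<^sub>R u j))
        - (pmf P j *\<^sub>R (D *\<^sub>R u j)) * M - M * (pmf P j *\<^sub>R (D *\<^sub>R u j)) + pmf P j *\<^sub>R (M * M))"
      by (simp add: XX scaleR_sum_right algebra_simps)
    also have "(\<Sum>j<n. D *\<^sub>R (pmf P j *\<^sub>R (D *\<^sub>R u j))
        - (pmf P j *\<^sub>R (D *\<^sub>R u j)) * M - M * (pmf P j *\<^sub>R (D *\<^sub>R u j)) + pmf P j *\<^sub>R (M * M))
      = (\<Sum>j<n. D *\<^sub>R r j - r j * M - M * r j + pmf P j *\<^sub>R (M * M))"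
      by (intro sum.cong refl) (simp only: Pu lessThan_iff)
    also have "\<dots> = D *\<^sub>R M - M * M - M * M + (\<Sum>j<n. pmf P j) *\<^sub>R (M * M)"
      by (simp only: sum.distrib sum_subtractf scaleR_sum_right[symmetric] sum_distrib_left[symmetric]
          sum_distrib_right[symmetric] scaleR_sum_left[symmetric] M(1)[symmetric])
    also have "\<dots> = D *\<^sub>R M - M * M"
      by (simp add: P1)
    finally have V: "(\<Sum>j<n. pmf P j *\<^sub>R (X j * X j)) = b\<^sup>2 *\<^sub>R (D *\<^sub>R M - M * M)" .
    show ?thesis unfolding form_le_def V
    proof
      fix z assume z: "z \<in> S"
      have "0 \<le> tr (star (M * z) * (M * z))" using M_S z by (intro tr_nonneg) simp
      then have "0 \<le> tr (star z * (M * M) * z)" using M_S by (simp add: mult.assoc)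
      then have "b\<^sup>2 * (D * tr (star z * M * z) - tr (star z * (M * M) * z)) \<le> b\<^sup>2 * (D * tr (star z * M * z))"
        by (intro mult_left_mono) auto
      then show "tr (star z * (b\<^sup>2 *\<^sub>R (D *\<^sub>R M - M * M)) * z) \<le> tr (star z * (a *\<^sub>R M) * z)"
        by (simp add: a_def left_diff_distrib right_diff_distrib)
    qed
  qed
  have trM: "tr M = D" using r M D by (simp add: tr_sum)
  define pr where "pr = measure_pmf.prob (Pi_pmf {..<s} d (\<lambda>_. P))
      {f. \<exists>z\<in>S. z * star z * z = z \<and> tr (star z * z) = 1 \<and>
        4 * L \<le> tr (star z * (\<Sum>c<s. X (f c)) * z)}"
  have "pr * (exp (4 * L) - 1 - 4 * L) \<le> tr M * (exp (a * s) - 1)"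
    unfolding pr_def
  proof (rule matrix_bernstein[where J = "{..<n}"])
    show "set_pmf P \<subseteq> {..<n}" by (auto simp: set_pmf_eq P)
  qed (use X_bd EX EX2 M M_S D L u \<sigma> trM in \<open>auto simp: X_def a_def\<close>)
  also have "\<dots> \<le> D * exp L"
  proof -
    have "a * real s \<le> L"
    proof -
      have "a * real s = L * (64 * D * L / (real s * \<epsilon>\<^sup>2))"
        using s0 \<epsilon> by (simp add: a_def b_def \<theta>_def power2_eq_square field_simps)
      also have "\<dots> \<le> L * 1"
        using sD s0 \<epsilon> L by (intro mult_left_mono) (auto simp: field_simps)
      finally show ?thesis by simp
    qed
    then have "exp (a * s) \<le> exp L" by simp
    then have "exp (a * s) - 1 \<le> exp L" by linarith
    then show ?thesis using D trM by (simp add: mult_left_mono)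
  qed
  finally have *: "pr * (exp (4 * L) - 1 - 4 * L) \<le> D * exp L" .
  \<comment> \<open>Since L >= 1, the quadratic Taylor bound 1 + 4L + 8L^2 is at least 2 + 8L, so
    the subtracted affine part is at most half of the exponential.\<close>
  have "exp (4 * L) / 2 \<le> exp (4 * L) - 1 - 4 * L"
  proof -
    have "1 + 4 * L + (4 * L)\<^sup>2 / 2 \<le> exp (4 * L)"
      using L by (intro exp_lower_Taylor_quadratic) auto
    moreover have "(4 * L)\<^sup>2 / 2 = 8 * (L * L)" by (simp add: power2_eq_square)
    moreover have "L * 1 \<le> L * L" using L by (intro mult_left_mono) auto
    ultimately show ?thesis using L by linarith
  qed
  then have "pr * (exp (4 * L) / 2) \<le> pr * (exp (4 * L) - 1 - 4 * L)"
    by (intro mult_left_mono) (simp_all add: pr_def)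
  also note *
  finally have "pr * (exp (4 * L) / 2) \<le> D * exp L" .
  then have "pr \<le> 2 * D * exp L * exp (- (4 * L))"
    by (simp add: exp_minus field_simps)
  also have "\<dots> = 2 * D * exp (- (3 * L))"
    by (simp add: mult_exp_exp)
  finally have "pr \<le> 2 * D * exp (- (3 * L))" .
  moreover have "(4 * L \<le> tr (star z * (\<Sum>c<s. X (f c)) * z)) \<longleftrightarrow> (\<epsilon> / 2 \<le> \<sigma> *
      tr (star z * ((\<Sum>c<s. (D / (real s * lev (f c))) *\<^sub>R r (f c)) - M) * z))" for z f
  proof -
    have "(\<Sum>c<s. X (f c)) = (\<sigma> * b) *\<^sub>R ((\<Sum>c<s. D *\<^sub>R u (f c)) - real s *\<^sub>R M)"
    proof -
      have "(\<Sum>c<s. M) = real s *\<^sub>R M" by (simp add: scaleR_conv_of_real)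
      then show ?thesis by (simp only: X_def scaleR_sum_right[symmetric] sum_subtractf)
    qed
    also have "\<dots> = (\<sigma> * \<theta>) *\<^sub>R ((\<Sum>c<s. (D / (real s * lev (f c))) *\<^sub>R r (f c)) - M)"
      using s0 by (simp add: b_def u_def scaleR_right_diff_distrib scaleR_sum_right mult.commute)
    finally have "tr (star z * (\<Sum>c<s. X (f c)) * z) = \<theta> * (\<sigma> *
        tr (star z * ((\<Sum>c<s. (D / (real s * lev (f c))) *\<^sub>R r (f c)) - M) * z))"
      by (simp add: mult.commute mult.left_commute)
    moreover have "4 * L = \<theta> * (\<epsilon> / 2)" using \<epsilon> by (simp add: \<theta>_def)
    ultimately show ?thesis using \<theta> by (simp only: mult_le_cancel_left_pos)
  qed
  ultimately show ?thesis by (simp add: pr_def)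
qed

end

section \<open>Finite matrices as a real algebra\<close>

text \<open>All dimensions have to live in one type, so that the ring laws are available without
  carrier conditions: infinite matrices with finite rows and columns, in which the \<open>d \<times> d\<close>
  matrices are a block.\<close>

typedef fmat = "{f :: nat \<Rightarrow> nat \<Rightarrow> real. \<forall>i. finite {j. f i j \<noteq> 0} \<and> finite {j. f j i \<noteq> 0}}"
  morphisms entry Fmat
  by (rule exI[of _ "\<lambda>_ _. 0"]) simp

lemma fmat_eqI: "(\<And>i j. entry A i j = entry B i j) \<Longrightarrow> A = B"
  by (metis entry_inject ext)

lemma finite_row: "finite {j. entry A i j \<noteq> 0}"
  and finite_column: "finite {j. entry A j i \<noteq> 0}"
  using entry[of A] by auto

lemma entry_Fmat:
  assumes "\<And>i. finite {j. f i j \<noteq> 0}" "\<And>i. finite {j. f j i \<noteq> 0}"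
  shows "entry (Fmat f) i j = f i j"
  using assms by (simp add: Fmat_inverse)

definition fmat_transpose :: "fmat \<Rightarrow> fmat" where
  "fmat_transpose A = Fmat (\<lambda>i j. entry A j i)"

lemma entry_transpose [simp]: "entry (fmat_transpose A) i j = entry A j i"
  by (simp add: fmat_transpose_def entry_Fmat finite_row finite_column)

instantiation fmat :: real_algebra_1
begin

definition "0 = Fmat (\<lambda>_ _. 0)"
definition "1 = Fmat (\<lambda>i j. if i = j then 1 else 0)"
definition "A + B = Fmat (\<lambda>i j. entry A i j + entry B i j)"
definition "A - B = Fmat (\<lambda>i j. entry A i j - entry B i j)"
definition "- A = Fmat (\<lambda>i j. - entry A i j)"
definition "c *\<^sub>R A = Fmat (\<lambda>i j. c * entry A i j)" for c :: real and A :: fmat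
definition "A * B = Fmat (\<lambda>i k. \<Sum>j | entry A i j \<noteq> 0. entry A i j * entry B j k)"

lemma entry_zero [simp]: "entry 0 i j = 0"
  by (simp add: zero_fmat_def entry_Fmat)

lemma entry_one [simp]: "entry 1 i j = (if i = j then 1 else 0)"
  by (simp add: one_fmat_def entry_Fmat)

lemma entry_add [simp]: "entry (A + B) i j = entry A i j + entry B i j"
  unfolding plus_fmat_def
proof (rule entry_Fmat)
  fix i
  show "finite {j. entry A i j + entry B i j \<noteq> 0}"
    by (rule finite_subset[OF _ finite_UnI[OF finite_row[of A i] finite_row[of B i]]]) auto
  show "finite {j. entry A j i + entry B j i \<noteq> 0}"
    by (rule finite_subset[OF _ finite_UnI[OF finite_column[of A i] finite_column[of B i]]]) auto
qed

lemma entry_diff [simp]: "entry (A - B) i j = entry A i j - entry B i j"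
  unfolding minus_fmat_def
proof (rule entry_Fmat)
  fix i
  show "finite {j. entry A i j - entry B i j \<noteq> 0}"
    by (rule finite_subset[OF _ finite_UnI[OF finite_row[of A i] finite_row[of B i]]]) auto
  show "finite {j. entry A j i - entry B j i \<noteq> 0}"
    by (rule finite_subset[OF _ finite_UnI[OF finite_column[of A i] finite_column[of B i]]]) auto
qed

lemma entry_uminus [simp]: "entry (- A) i j = - entry A i j"
  by (simp add: uminus_fmat_def entry_Fmat finite_row finite_column)

lemma entry_scaleR [simp]: "entry (c *\<^sub>R A) i j = c * entry A i j"
  unfolding scaleR_fmat_def
  by (rule entry_Fmat; rule finite_subset[OF _ finite_row[of A]]
      finite_subset[OF _ finite_column[of A]]) auto

text \<open>The product is defined by a sum over the support of a row of \<open>A\<close>. Any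
  finite index set off which the products vanish gives the same value, so each proof may sum over a
  row support, a column support or an initial segment.\<close>

lemma entry_mult:
  assumes K: "finite K" "\<And>j. j \<notin> K \<Longrightarrow> entry A i j * entry B j k = 0"
  shows "entry (A * B) i k = (\<Sum>j\<in>K. entry A i j * entry B j k)"
proof -
  let ?f = "\<lambda>i k. \<Sum>j | entry A i j \<noteq> 0. entry A i j * entry B j k"
  have ex: "\<exists>j. entry A i j \<noteq> 0 \<and> entry B j k \<noteq> 0" if "?f i k \<noteq> 0" for i k
  proof (rule ccontr)
    assume "\<nexists>j. entry A i j \<noteq> 0 \<and> entry B j k \<noteq> 0"
    then have "?f i k = 0" by (intro sum.neutral) auto
    with that show False by simp
  qed
  \<comment> \<open>A nonzero entry of the product passes through a common index; finitely many
    indices with finite supports therefore keep rows and columns finite.\<close>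
  have "finite {k. ?f i k \<noteq> 0}" for i
  proof (rule finite_subset)
    show "{k. ?f i k \<noteq> 0} \<subseteq> (\<Union>j\<in>{j. entry A i j \<noteq> 0}. {k. entry B j k \<noteq> 0})"
      using ex by blast
  qed (simp add: finite_row)
  moreover have "finite {i. ?f i k \<noteq> 0}" for k
  proof (rule finite_subset)
    show "{i. ?f i k \<noteq> 0} \<subseteq> (\<Union>j\<in>{j. entry B j k \<noteq> 0}. {i. entry A i j \<noteq> 0})"
      using ex by blast
  qed (simp add: finite_column)
  ultimately have "entry (A * B) i k = ?f i k"
    unfolding times_fmat_def by (rule entry_Fmat)
  also have "\<dots> = (\<Sum>j\<in>K \<union> {j. entry A i j \<noteq> 0}. entry A i j * entry B j k)"
    using K by (intro sum.mono_neutral_left) (auto simp: finite_row)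
  also have "\<dots> = (\<Sum>j\<in>K. entry A i j * entry B j k)"
    using K by (intro sum.mono_neutral_right) (auto simp: finite_row)
  finally show ?thesis .
qed

instance
proof
  fix A B C :: fmat and a b :: real
  show "A * B * C = A * (B * C)"
  proof (rule fmat_eqI)
    fix i l
    define J where "J = {j. entry A i j \<noteq> 0}"
    define K where "K = {k. entry C k l \<noteq> 0}"
    have fin: "finite J" "finite K" by (auto simp: J_def K_def finite_row finite_column)
    have "entry (A * B * C) i l = (\<Sum>k\<in>K. entry (A * B) i k * entry C k l)"
      using fin by (intro entry_mult) (auto simp: K_def)
    also have "\<dots> = (\<Sum>k\<in>K. (\<Sum>j\<in>J. entry A i j * entry B j k) * entry C k l)"
      using fin by (intro sum.cong refl arg_cong2[where f = times] entry_mult) (auto simp: J_def)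
    also have "\<dots> = (\<Sum>j\<in>J. entry A i j * (\<Sum>k\<in>K. entry B j k * entry C k l))"
      by (simp add: sum_distrib_left sum_distrib_right mult.assoc sum.swap[of _ J])
    also have "\<dots> = (\<Sum>j\<in>J. entry A i j * entry (B * C) j l)"
      using fin by (intro sum.cong refl arg_cong2[where f = times] entry_mult[symmetric])
        (auto simp: K_def)
    also have "\<dots> = entry (A * (B * C)) i l"
      using fin by (intro entry_mult[symmetric]) (auto simp: J_def)
    finally show "entry (A * B * C) i l = entry (A * (B * C)) i l" .
  qed
  have row: "entry (X * Y) i k = (\<Sum>j | entry X i j \<noteq> 0. entry X i j * entry Y j k)" for X Y i k
    by (rule entry_mult) (auto simp: finite_row)
  have column: "entry (X * Y) i k = (\<Sum>j | entry Y j k \<noteq> 0. entry X i j * entry Y j k)" for X Y i k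
    by (rule entry_mult) (auto simp: finite_column)
  show "(A + B) * C = A * C + B * C"
    by (rule fmat_eqI) (simp add: column[of _ C] distrib_right sum.distrib)
  show "A * (B + C) = A * B + A * C"
    by (rule fmat_eqI) (simp add: row[of A] distrib_left sum.distrib)
  show "1 * A = A"
    by (rule fmat_eqI, subst entry_mult[where K = "{i}" for i]) auto
  show "A * 1 = A"
    by (rule fmat_eqI) (subst entry_mult[where K = "{j}" for j], auto)
  show "a *\<^sub>R A * B = a *\<^sub>R (A * B)"
    by (rule fmat_eqI) (simp add: column[of _ B] sum_distrib_left mult.assoc)
  show "A * a *\<^sub>R B = a *\<^sub>R (A * B)"
    by (rule fmat_eqI) (simp add: row[of A] sum_distrib_left mult.left_commute)
  have "entry (0::fmat) 0 0 \<noteq> entry 1 0 0" by simp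
  then show "(0::fmat) \<noteq> 1" by metis
qed (rule fmat_eqI; simp add: algebra_simps)+

end

text \<open>Entries outside the leading block are left free, so that the global 1 belongs to the set
  for every \<open>d\<close>. The trace reads only the leading block, whence
  \<open>block_trace d 1 = d\<close>.\<close>

definition block_diagonal :: "nat \<Rightarrow> fmat set" where
  "block_diagonal d = {A. \<forall>i j. (i < d) \<noteq> (j < d) \<longrightarrow> entry A i j = 0}"

definition block_trace :: "nat \<Rightarrow> fmat \<Rightarrow> real" where
  "block_trace d A = (\<Sum>i<d. entry A i i)"

lemma entry_mult_block:
  assumes "A \<in> block_diagonal d \<or> B \<in> block_diagonal d" "i < d" "k < d"
  shows "entry (A * B) i k = (\<Sum>j<d. entry A i j * entry B j k)"
  using assms by (intro entry_mult) (auto simp: block_diagonal_def)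

interpretation fmat: trace_algebra "block_diagonal d" fmat_transpose "block_trace d" for d
proof
  fix A B :: fmat and c :: real
  show "1 \<in> block_diagonal d" by (auto simp: block_diagonal_def)
  show "A + B \<in> block_diagonal d" if "A \<in> block_diagonal d" "B \<in> block_diagonal d"
    using that by (auto simp: block_diagonal_def)
  show "A * B \<in> block_diagonal d" if AB: "A \<in> block_diagonal d" "B \<in> block_diagonal d"
    unfolding block_diagonal_def
  proof (intro CollectI allI impI)
    fix i k assume ik: "(i < d) \<noteq> (k < d)"
    have "entry (A * B) i k = (\<Sum>j\<in>{}. entry A i j * entry B j k)"
      using ik AB by (intro entry_mult) (auto simp: block_diagonal_def)
    then show "entry (A * B) i k = 0" by simp
  qed
  show "c *\<^sub>R A \<in> block_diagonal d" if "A \<in> block_diagonal d"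
    using that by (auto simp: block_diagonal_def)
  show "fmat_transpose A \<in> block_diagonal d" if "A \<in> block_diagonal d"
    using that by (auto simp: block_diagonal_def)
  show "fmat_transpose (A + B) = fmat_transpose A + fmat_transpose B"
    by (rule fmat_eqI) simp
  show "fmat_transpose (A * B) = fmat_transpose B * fmat_transpose A"
  proof (rule fmat_eqI)
    fix i k
    let ?J = "{j. entry A k j \<noteq> 0}"
    have "entry (A * B) k i = (\<Sum>j\<in>?J. entry A k j * entry B j i)"
      by (rule entry_mult) (auto simp: finite_row)
    moreover have "entry (fmat_transpose B * fmat_transpose A) i k
        = (\<Sum>j\<in>?J. entry (fmat_transpose B) i j * entry (fmat_transpose A) j k)"
      by (rule entry_mult) (auto simp: finite_row)
    ultimately show "entry (fmat_transpose (A * B)) i k = entry (fmat_transpose B * fmat_transpose A) i k"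
      by (simp add: mult.commute)
  qed
  show "fmat_transpose (c *\<^sub>R A) = c *\<^sub>R fmat_transpose A"
    by (rule fmat_eqI) simp
  show "fmat_transpose (fmat_transpose A) = A"
    by (rule fmat_eqI) simp
  show "block_trace d (A + B) = block_trace d A + block_trace d B"
    by (simp add: block_trace_def sum.distrib)
  show "block_trace d (c *\<^sub>R A) = c * block_trace d A"
    by (simp add: block_trace_def sum_distrib_left)
  show "block_trace d (fmat_transpose A) = block_trace d A"
    by (simp add: block_trace_def)
  show "block_trace d (A * B) = block_trace d (B * A)"
    if "A \<in> block_diagonal d" "B \<in> block_diagonal d"
    using that unfolding block_trace_def
    by (simp add: entry_mult_block[where d = d] mult.commute) (rule sum.swap)
  show "0 \<le> block_trace d (fmat_transpose A * A)" if "A \<in> block_diagonal d"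
    using that by (simp add: block_trace_def entry_mult_block[where d = d] sum_nonneg)
qed

section \<open>Rank one forms in the leading block\<close>

definition block :: "nat \<Rightarrow> (nat \<Rightarrow> nat \<Rightarrow> real) \<Rightarrow> fmat" where
  "block d f = Fmat (\<lambda>i j. if i < d \<and> j < d then f i j else 0)"

lemma entry_block [simp]: "entry (block d f) i j = (if i < d \<and> j < d then f i j else 0)"
  unfolding block_def by (rule entry_Fmat; rule finite_subset[of _ "{..<d}"]) auto

lemma block_diagonal_block [simp]: "block d f \<in> block_diagonal d"
  by (auto simp: block_diagonal_def)

lemma transpose_block [simp]: "fmat_transpose (block d f) = block d (\<lambda>i j. f j i)"
  by (rule fmat_eqI) auto

lemma block_mult [simp]: "block d f * block d g = block d (\<lambda>i k. \<Sum>j<d. f i j * g j k)"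
proof (rule fmat_eqI)
  fix i k
  have "entry (block d f * block d g) i k = (\<Sum>j<d. entry (block d f) i j * entry (block d g) j k)"
    by (rule entry_mult) auto
  then show "entry (block d f * block d g) i k = entry (block d (\<lambda>i k. \<Sum>j<d. f i j * g j k)) i k"
    by auto
qed

definition dot :: "nat \<Rightarrow> (nat \<Rightarrow> real) \<Rightarrow> (nat \<Rightarrow> real) \<Rightarrow> real" where
  "dot d u v = (\<Sum>i<d. u i * v i)"

text \<open>The dictionary between the two languages: the form of a rank one matrix at
  \<open>z\<close> splits over the columns of \<open>z\<close>, so inequalities between forms may be
  checked on vectors.\<close>

lemma trace_rank_one_form:
  assumes "z \<in> block_diagonal d"
  shows "block_trace d (fmat_transpose z * block d (\<lambda>a b. v a * v b) * z)
    = (\<Sum>c<d. (dot d v (\<lambda>a. entry z a c))\<^sup>2)"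
proof -
  have "entry (fmat_transpose z * block d (\<lambda>a b. v a * v b) * z) c c = (dot d v (\<lambda>a. entry z a c))\<^sup>2"
    if c: "c < d" for c
  proof -
    have "entry (fmat_transpose z * block d (\<lambda>a b. v a * v b) * z) c c
        = (\<Sum>b<d. (\<Sum>a<d. entry z a c * (v a * v b)) * entry z b c)"
      using assms c by (simp add: entry_mult_block[where d = d])
    also have "\<dots> = (\<Sum>b<d. (\<Sum>a<d. v a * entry z a c) * (v b * entry z b c))"
      by (simp add: sum_distrib_left sum_distrib_right mult_ac)
    also have "\<dots> = (dot d v (\<lambda>a. entry z a c))\<^sup>2"
      by (simp add: dot_def power2_eq_square sum_distrib_left)
    finally show ?thesis .
  qed
  then show ?thesis by (simp add: block_trace_def)
qed

text \<open>The two tails in the language of vectors. The bad events already quantify over all test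
  elements \<open>z\<close>, so the estimate holds for all \<open>u\<close> at once and the union
  bound concerns only the sign.\<close>

theorem leverage_sampling_concentration:
  fixes v :: "nat \<Rightarrow> nat \<Rightarrow> real"
  assumes d: "0 < d"
    and le1: "\<And>u. (\<Sum>j<n. (dot d (v j) u)\<^sup>2) \<le> dot d u u"
    and D: "D = (\<Sum>j<n. dot d (v j) (v j))" "0 < D"
    and P: "\<And>j. pmf P j = (if j < n then dot d (v j) (v j) / D else 0)"
    and \<epsilon>: "0 < \<epsilon>" "\<epsilon> < 1 / 4" and \<delta>: "0 < \<delta>"
    and s: "64 * (D / \<epsilon>\<^sup>2) * max 1 (ln (D / \<delta>)) \<le> real s"
  shows "measure_pmf.prob (Pi_pmf {..<s} x0 (\<lambda>_. P))
    {f. \<forall>u. \<bar>(\<Sum>c<s. D / (real s * dot d (v (f c)) (v (f c))) * (dot d (v (f c)) u)\<^sup>2)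
          - (\<Sum>j<n. (dot d (v j) u)\<^sup>2)\<bar> \<le> \<epsilon> / 2 * dot d u u} \<ge> 1 - \<delta>"
proof -
  define r where "r j = block d (\<lambda>a b. v j a * v j b)" for j
  define lev where "lev j = dot d (v j) (v j)" for j
  define M where "M = (\<Sum>j<n. r j)"
  define L where "L = max 1 (ln (D / \<delta>))"
  define Q where "Q = Pi_pmf {..<s} x0 (\<lambda>_. P)"
  define err where "err f u = (\<Sum>c<s. D / (real s * lev (f c)) * (dot d (v (f c)) u)\<^sup>2)
    - (\<Sum>j<n. (dot d (v j) u)\<^sup>2)" for f u
  define T where "T f = (\<Sum>c<s. (D / (real s * lev (f c))) *\<^sub>R r (f c)) - M" for f
  define bad where "bad \<sigma> = {f. \<exists>z\<in>block_diagonal d. z * fmat_transpose z * z = z \<and>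
    block_trace d (fmat_transpose z * z) = 1 \<and>
    \<epsilon> / 2 \<le> \<sigma> * block_trace d (fmat_transpose z * T f * z)}" for \<sigma>
  have lev_nonneg: "0 \<le> lev j" for j by (simp add: lev_def dot_def sum_nonneg)
  have lev0: "r j = 0" if "lev j = 0" for j
  proof -
    have "v j i = 0" if "i < d" for i
      using that \<open>lev j = 0\<close> by (simp add: lev_def dot_def sum_nonneg_eq_0_iff)
    then show ?thesis by (intro fmat_eqI) (simp add: r_def)
  qed
  have M1: "fmat.form_le d M 1"
    unfolding fmat.form_le_def
  proof
    fix z assume z: "z \<in> block_diagonal d"
    have "block_trace d (fmat_transpose z * M * z) = (\<Sum>j<n. \<Sum>c<d. (dot d (v j) (\<lambda>a. entry z a c))\<^sup>2)"
      by (simp add: M_def r_def sum_distrib_left sum_distrib_right fmat.tr_sum trace_rank_one_form[OF z])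
    also have "\<dots> = (\<Sum>c<d. \<Sum>j<n. (dot d (v j) (\<lambda>a. entry z a c))\<^sup>2)"
      by (rule sum.swap)
    also have "\<dots> \<le> (\<Sum>c<d. dot d (\<lambda>a. entry z a c) (\<lambda>a. entry z a c))"
      by (intro sum_mono le1)
    also have "\<dots> = block_trace d (fmat_transpose z * 1 * z)"
      using z by (simp add: block_trace_def entry_mult_block[where d = d] dot_def)
    finally show "block_trace d (fmat_transpose z * M * z) \<le> block_trace d (fmat_transpose z * 1 * z)" .
  qed
  have tail: "measure_pmf.prob Q (bad \<sigma>) \<le> 2 * D * exp (- (3 * L))" if "\<sigma> = 1 \<or> \<sigma> = -1" for \<sigma>
    unfolding Q_def bad_def T_def
  proof (rule fmat.leverage_sampling_tail[OF _ _ _ _ _ _ M_def M1 _ D(2) _ \<epsilon> _ _ that])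
    show "r j * r j = lev j *\<^sub>R r j" for j
      by (rule fmat_eqI) (simp add: r_def lev_def dot_def sum_distrib_right mult_ac)
    show "block_trace d (r j) = lev j" for j
      by (simp add: r_def block_trace_def lev_def dot_def)
    show "64 * D / \<epsilon>\<^sup>2 * L \<le> real s" using s by (simp add: L_def)
  qed (use P D lev_nonneg lev0 in \<open>auto simp: r_def lev_def L_def mult.commute\<close>)
  \<comment> \<open>The choice of \<open>L\<close> gives e^L >= D / \<delta>, and L >= 1 gives
    e^(2L) >= 4.\<close>
  have bd: "4 * D * exp (- (3 * L)) \<le> \<delta>"
  proof -
    have "ln (D / \<delta>) \<le> L" by (simp add: L_def)
    then have "D / \<delta> \<le> exp L" using D \<delta> by (metis divide_pos_pos exp_le_cancel_iff exp_ln)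
    then have "D \<le> \<delta> * exp L" using \<delta> by (simp add: field_simps)
    moreover have "4 \<le> exp (2 * L)"
    proof -
      have "1 + 2 + 2\<^sup>2 / 2 \<le> exp (2 :: real)" by (rule exp_lower_Taylor_quadratic) simp
      also have "\<dots> \<le> exp (2 * L)" by (simp add: L_def)
      finally show ?thesis by simp
    qed
    ultimately have "4 * D \<le> exp (2 * L) * (\<delta> * exp L)"
      using D by (intro mult_mono) auto
    also have "\<dots> = \<delta> * exp (3 * L)" by (simp add: mult_exp_exp)
    finally show ?thesis by (simp add: exp_minus field_simps)
  qed
  have good: "\<bar>err f u\<bar> \<le> \<epsilon> / 2 * dot d u u" if f: "f \<notin> bad 1 \<union> bad (-1)" for f u
  proof (cases "dot d u u = 0")
    case True
    then have "u i = 0" if "i < d" for i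
      using that by (simp add: dot_def sum_nonneg_eq_0_iff)
    then have "dot d w u = 0" for w by (simp add: dot_def)
    then show ?thesis by (simp add: err_def)
  next
    case False
    moreover have "0 \<le> dot d u u" by (simp add: dot_def sum_nonneg)
    ultimately have pos: "0 < dot d u u" by simp
    define c where "c = 1 / sqrt (dot d u u)"
    have c2: "c\<^sup>2 * dot d u u = 1" using pos by (simp add: c_def power_divide)
    \<comment> \<open>The normalized \<open>u\<close> is placed in column 0, which exists because d
      > 0. Then \<open>fmat_transpose z * z\<close> is a coordinate projection, so \<open>z\<close>
      is an admissible test element.\<close>
    define z where "z = block d (\<lambda>a b. if b = 0 then c * u a else 0)"
    have z_S: "z \<in> block_diagonal d" by (simp add: z_def)
    have zz: "fmat_transpose z * z = block d (\<lambda>a b. if a = 0 \<and> b = 0 then 1 else 0)"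
    proof -
      have "(\<Sum>j<d. c * u j * (c * u j)) = 1"
        using c2 by (simp add: dot_def sum_distrib_left power2_eq_square mult_ac)
      then show ?thesis by (intro fmat_eqI) (auto simp: z_def)
    qed
    have "(\<Sum>j<d. (if j = 0 then c * u i else 0) * (if j = 0 \<and> k = 0 then 1 else 0))
        = (\<Sum>j<d. if j = 0 then if k = 0 then c * u i else 0 else 0)" for i k :: nat
      by (intro sum.cong) auto
    then have "z * (fmat_transpose z * z) = z"
      unfolding zz unfolding z_def using d by (intro fmat_eqI) simp
    then have z1: "z * fmat_transpose z * z = z" by (simp add: mult.assoc)
    have z2: "block_trace d (fmat_transpose z * z) = 1"
      unfolding zz using d by (simp add: block_trace_def)
    have "block_trace d (fmat_transpose z * r j * z) = c\<^sup>2 * (dot d (v j) u)\<^sup>2" for j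
    proof -
      have "(dot d (v j) (\<lambda>a. entry z a b))\<^sup>2 = (if b = 0 then c\<^sup>2 * (dot d (v j) u)\<^sup>2 else 0)" if "b < d" for b
        using that by (simp add: z_def dot_def sum_distrib_left mult_ac flip: power_mult_distrib)
      then have "block_trace d (fmat_transpose z * r j * z)
          = (\<Sum>b<d. if b = 0 then c\<^sup>2 * (dot d (v j) u)\<^sup>2 else 0)"
        unfolding r_def trace_rank_one_form[OF z_S] by (intro sum.cong) auto
      then show ?thesis using d by simp
    qed
    then have "block_trace d (fmat_transpose z * T f * z) = c\<^sup>2 * err f u"
      by (simp add: T_def M_def err_def sum_distrib_left sum_distrib_right fmat.tr_sum algebra_simps)
    moreover have "\<not> \<epsilon> / 2 \<le> \<sigma> * block_trace d (fmat_transpose z * T f * z)"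
      if "\<sigma> = 1 \<or> \<sigma> = -1" for \<sigma>
      using f z_S z1 z2 that by (auto simp: bad_def)
    ultimately have "\<bar>c\<^sup>2 * err f u\<bar> \<le> \<epsilon> / 2"
      by (metis abs_le_iff linorder_le_cases mult_1 mult_minus1)
    then have "dot d u u * (c\<^sup>2 * \<bar>err f u\<bar>) \<le> dot d u u * (\<epsilon> / 2)"
      using pos by (intro mult_left_mono) (auto simp: abs_mult)
    then show ?thesis using c2 by (simp add: mult_ac)
  qed
  have "measure_pmf.prob Q (bad 1 \<union> bad (-1)) \<le> measure_pmf.prob Q (bad 1) + measure_pmf.prob Q (bad (-1))"
    by (rule measure_Un_le) auto
  also have "\<dots> \<le> 4 * D * exp (- (3 * L))" using tail[of 1] tail[of "-1"] by simp
  also note bd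
  finally have "1 - \<delta> \<le> measure_pmf.prob Q (- (bad 1 \<union> bad (-1)))"
    using measure_pmf.prob_compl[of "bad 1 \<union> bad (-1)" Q] by (simp add: Compl_eq_Diff_UNIV)
  also have "\<dots> \<le> measure_pmf.prob Q {f. \<forall>u. \<bar>err f u\<bar> \<le> \<epsilon> / 2 * dot d u u}"
    using good by (intro measure_pmf.finite_measure_mono) auto
  finally show ?thesis by (simp add: Q_def err_def lev_def)
qed

section \<open>Quadratic forms and singular values\<close>

lemma scalar_prod_eq_dot:
  "v \<in> carrier_vec d \<Longrightarrow> scalar_prod u v = dot d (vec_index u) (vec_index v)"
  by (auto simp: scalar_prod_def dot_def lessThan_atLeast0)

lemma norm2_eq_L2_set: "v \<in> carrier_vec d \<Longrightarrow> norm2 v = L2_set (vec_index v) {..<d}"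
  by (simp add: norm2_def scalar_prod_eq_dot dot_def L2_set_def power2_eq_square)

lemma norm2_nonneg [simp]: "0 \<le> norm2 v"
  using norm2_eq_L2_set[of v "dim_vec v"] by (simp add: L2_set_nonneg)

lemma scalar_prod_self_nonneg: "0 \<le> scalar_prod v (v :: real vec)"
  by (simp add: scalar_prod_def sum_nonneg)

lemma norm2_square: "(norm2 v)\<^sup>2 = scalar_prod v v"
  by (simp add: norm2_def scalar_prod_self_nonneg)

lemma norm2_eq_0_iff: "v \<in> carrier_vec d \<Longrightarrow> norm2 v = 0 \<longleftrightarrow> v = 0\<^sub>v d"
  by (auto simp: norm2_eq_L2_set L2_set_eq_0_iff)

lemma scalar_prod_self_pos:
  "v \<in> carrier_vec d \<Longrightarrow> v \<noteq> 0\<^sub>v d \<Longrightarrow> 0 < scalar_prod v (v :: real vec)"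
  using norm2_eq_0_iff[of v d] norm2_square[of v] scalar_prod_self_nonneg[of v]
  by (metis less_eq_real_def power2_eq_iff_nonneg order_refl norm2_nonneg power_zero_numeral)

lemma abs_scalar_prod_le:
  assumes "u \<in> carrier_vec d" "v \<in> carrier_vec d"
  shows "\<bar>scalar_prod u v\<bar> \<le> norm2 u * norm2 v"
proof -
  have "\<bar>scalar_prod u v\<bar> \<le> (\<Sum>i<d. \<bar>vec_index u i\<bar> * \<bar>vec_index v i\<bar>)"
    using assms sum_abs[of "\<lambda>i. vec_index u i * vec_index v i" "{..<d}"]
    by (simp add: scalar_prod_eq_dot dot_def abs_mult)
  also have "\<dots> \<le> norm2 u * norm2 v"
    using assms by (simp add: norm2_eq_L2_set L2_set_mult_ineq)
  finally show ?thesis .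
qed

lemma norm2_add_le:
  assumes "u \<in> carrier_vec d" "v \<in> carrier_vec d"
  shows "norm2 (u + v) \<le> norm2 u + norm2 v"
proof -
  have "norm2 (u + v) = L2_set (\<lambda>i. vec_index u i + vec_index v i) {..<d}"
    using assms by (subst norm2_eq_L2_set[of _ d]) (auto intro!: L2_set_cong)
  then show ?thesis
    using assms L2_set_triangle_ineq[of "vec_index u" "vec_index v" "{..<d}"]
    by (simp add: norm2_eq_L2_set)
qed

lemma norm2_smult: "norm2 (c \<cdot>\<^sub>v v) = \<bar>c\<bar> * norm2 v"
proof -
  have "(norm2 (c \<cdot>\<^sub>v v))\<^sup>2 = (\<bar>c\<bar> * norm2 v)\<^sup>2"
    by (simp add: norm2_square power_mult_distrib) (simp add: power2_eq_square)
  then show ?thesis by (simp add: power2_eq_iff_nonneg)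
qed

lemma norm2_minus_commute:
  assumes "u \<in> carrier_vec d" "v \<in> carrier_vec d"
  shows "norm2 (u - v) = norm2 (v - u)"
proof -
  have "u - v = (-1) \<cdot>\<^sub>v (v - u)" using assms by auto
  then show ?thesis by (simp add: norm2_smult)
qed

text \<open>A crude continuity bound whose size is irrelevant: it makes suprema over the unit sphere
  finite. Adding 1 keeps it positive for the zero matrix.\<close>

lemma norm2_mult_mat_vec_bound:
  fixes M :: "real mat"
  assumes M: "M \<in> carrier_mat m d"
  obtains \<rho> where "0 < \<rho>" "\<And>y. y \<in> carrier_vec d \<Longrightarrow> norm2 (M *\<^sub>v y) \<le> \<rho> * norm2 y"
proof
  let ?\<rho> = "(\<Sum>i<m. norm2 (row M i)) + 1"
  show "0 < ?\<rho>" by (simp add: add_nonneg_pos sum_nonneg)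
  fix y :: "real vec"
  assume y: "y \<in> carrier_vec d"
  have "M *\<^sub>v y \<in> carrier_vec m" using M y by (rule mult_mat_vec_carrier)
  then have "norm2 (M *\<^sub>v y) \<le> (\<Sum>i<m. \<bar>vec_index (M *\<^sub>v y) i\<bar>)"
    by (simp only: norm2_eq_L2_set L2_set_le_sum_abs)
  also have "\<dots> \<le> (\<Sum>i<m. norm2 (row M i) * norm2 y)"
    using M y by (intro sum_mono) (auto intro!: abs_scalar_prod_le[of _ d])
  also have "\<dots> \<le> ?\<rho> * norm2 y" by (simp add: sum_distrib_right distrib_right)
  finally show "norm2 (M *\<^sub>v y) \<le> ?\<rho> * norm2 y" .
qed

lemma norm2_mult_le_spectral_norm:
  fixes M :: "real mat"
  assumes M: "M \<in> carrier_mat d d" and y: "y \<in> carrier_vec d"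
  shows "norm2 (M *\<^sub>v y) \<le> spectral_norm M * norm2 y"
proof (cases "y = 0\<^sub>v d")
  case True
  moreover have "M *\<^sub>v 0\<^sub>v d = 0\<^sub>v d" using M by auto
  ultimately show ?thesis using norm2_eq_0_iff[of "0\<^sub>v d" d] by simp
next
  case False
  then have pos: "0 < norm2 y" using y norm2_eq_0_iff[of y d] norm2_nonneg[of y] by linarith
  obtain \<rho> where \<rho>: "\<And>y. y \<in> carrier_vec d \<Longrightarrow> norm2 (M *\<^sub>v y) \<le> \<rho> * norm2 y"
    using norm2_mult_mat_vec_bound[OF M] by blast
  define u where "u = (1 / norm2 y) \<cdot>\<^sub>v y"
  have u: "u \<in> carrier_vec d" "norm2 u = 1" using y pos by (auto simp: u_def norm2_smult)
  have "norm2 (M *\<^sub>v u) \<le> spectral_norm M"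
    unfolding spectral_norm_def
  proof (rule cSUP_upper)
    show "bdd_above ((\<lambda>v. norm2 (M *\<^sub>v v)) ` {v \<in> carrier_vec (dim_col M). norm2 v = 1})"
      using M \<rho> by (auto intro!: bdd_aboveI2[of _ _ \<rho>]) (metis mult.right_neutral)
  qed (use M u in auto)
  moreover have "M *\<^sub>v u = (1 / norm2 y) \<cdot>\<^sub>v (M *\<^sub>v y)"
    using M y by (simp add: u_def mult_mat_vec)
  ultimately show ?thesis using pos by (simp add: norm2_smult field_simps)
qed

section \<open>Symmetric forms and extreme singular values\<close>

lemma smult_mat_mult_vec:
  fixes A :: "real mat"
  assumes "A \<in> carrier_mat m d" "v \<in> carrier_vec d"
  shows "(c \<cdot>\<^sub>m A) *\<^sub>v v = c \<cdot>\<^sub>v (A *\<^sub>v v)"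
  using assms by (intro eq_vecI) (auto simp: scalar_prod_def sum_distrib_left mult.assoc)

lemma transpose_smult: "transpose_mat (c \<cdot>\<^sub>m A) = c \<cdot>\<^sub>m transpose_mat A"
  by (intro eq_matI) auto

lemma symmetric_scalar_prod:
  fixes M :: "real mat"
  assumes "M \<in> carrier_mat d d" "transpose_mat M = M" "u \<in> carrier_vec d" "v \<in> carrier_vec d"
  shows "scalar_prod u (M *\<^sub>v v) = scalar_prod (M *\<^sub>v u) v"
  using transpose_vec_mult_scalar[of M d d v u] assms by simp

lemma quadratic_form_add:
  fixes M :: "real mat"
  assumes M: "M \<in> carrier_mat d d" "transpose_mat M = M"
    and uv: "u \<in> carrier_vec d" "v \<in> carrier_vec d"
  shows "scalar_prod (u + c \<cdot>\<^sub>v v) (M *\<^sub>v (u + c \<cdot>\<^sub>v v))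
    = scalar_prod u (M *\<^sub>v u) + 2 * c * scalar_prod u (M *\<^sub>v v) + c\<^sup>2 * scalar_prod v (M *\<^sub>v v)"
proof -
  have car: "M *\<^sub>v u \<in> carrier_vec d" "M *\<^sub>v v \<in> carrier_vec d" "c \<cdot>\<^sub>v v \<in> carrier_vec d"
    using M uv by auto
  have "M *\<^sub>v (u + c \<cdot>\<^sub>v v) = M *\<^sub>v u + c \<cdot>\<^sub>v (M *\<^sub>v v)"
    using M uv by (simp add: mult_add_distrib_mat_vec[of _ d d] mult_mat_vec)
  moreover have "scalar_prod v (M *\<^sub>v u) = scalar_prod u (M *\<^sub>v v)"
    using symmetric_scalar_prod[OF M uv(2,1)] comm_scalar_prod[of "M *\<^sub>v v" d u] car uv by simp
  ultimately show ?thesis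
    using car uv
    by (simp add: add_scalar_prod_distrib[of _ d] scalar_prod_add_distrib[of _ d]
        power2_eq_square algebra_simps)
qed

text \<open>A symmetric positive semidefinite matrix is bounded below on the unit sphere if it is
  invertible, because \<open>|Py|\<^sup>2 \<le> \<rho> (y \<bullet> Py)\<close>.\<close>

lemma psd_singular_if_inf_zero:
  fixes P :: "real mat"
  assumes P: "P \<in> carrier_mat d d" "transpose_mat P = P"
    and psd: "\<And>y. y \<in> carrier_vec d \<Longrightarrow> 0 \<le> scalar_prod y (P *\<^sub>v y)"
    and inf: "\<And>c. 0 < c \<Longrightarrow> \<exists>y\<in>carrier_vec d. scalar_prod y y = 1 \<and> scalar_prod y (P *\<^sub>v y) < c"
  shows "\<exists>v\<in>carrier_vec d. v \<noteq> 0\<^sub>v d \<and> P *\<^sub>v v = 0\<^sub>v d"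
proof (rule ccontr)
  assume "\<not> ?thesis"
  then have "det P \<noteq> 0" using det_0_iff_vec_prod_zero_field[OF P(1)] by auto
  then obtain B where B: "B \<in> carrier_mat d d" "B * P = 1\<^sub>m d"
    using det_non_zero_imp_unit[OF P(1), where b = "()"] by (auto simp: Units_def ring_mat_def)
  obtain \<beta> where \<beta>: "0 < \<beta>" "\<And>y. y \<in> carrier_vec d \<Longrightarrow> norm2 (B *\<^sub>v y) \<le> \<beta> * norm2 y"
    using norm2_mult_mat_vec_bound[OF B(1)] by blast
  obtain \<rho> where \<rho>: "0 < \<rho>" "\<And>y. y \<in> carrier_vec d \<Longrightarrow> norm2 (P *\<^sub>v y) \<le> \<rho> * norm2 y"
    using norm2_mult_mat_vec_bound[OF P(1)] by blast
  have low: "1 \<le> \<beta>\<^sup>2 * \<rho> * scalar_prod y (P *\<^sub>v y)"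
    if y: "y \<in> carrier_vec d" "scalar_prod y y = 1" for y
  proof -
    let ?p = "P *\<^sub>v y"
    have p: "?p \<in> carrier_vec d" using P y by auto
    have "scalar_prod ?p (P *\<^sub>v ?p) \<le> norm2 ?p * (\<rho> * norm2 ?p)"
      using abs_scalar_prod_le[of ?p d "P *\<^sub>v ?p"] P p \<rho>(2)[OF p]
      by (smt (verit) mult_left_mono norm2_nonneg mult_mat_vec_carrier)
    also have "\<dots> = \<rho> * scalar_prod ?p ?p"
      by (simp add: norm2_square[symmetric] power2_eq_square)
    finally have pp: "scalar_prod ?p (P *\<^sub>v ?p) \<le> \<rho> * scalar_prod ?p ?p" .
    \<comment> \<open>Positivity at y - Py / \<rho> bounds |Py|^2 by \<rho> times the form at y. The
      inverse \<open>B\<close> then bounds the form below on the unit sphere, against the choice of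
      \<open>inf\<close>.\<close>
    have "0 \<le> scalar_prod (y + (- 1 / \<rho>) \<cdot>\<^sub>v ?p) (P *\<^sub>v (y + (- 1 / \<rho>) \<cdot>\<^sub>v ?p))"
      using y p by (intro psd) auto
    also have "\<dots> = scalar_prod y ?p - 2 / \<rho> * scalar_prod y (P *\<^sub>v ?p)
        + (1 / \<rho>\<^sup>2) * scalar_prod ?p (P *\<^sub>v ?p)"
      using quadratic_form_add[OF P y(1) p, of "- 1 / \<rho>"] by (simp add: power2_eq_square)
    also have "scalar_prod y (P *\<^sub>v ?p) = scalar_prod ?p ?p"
      using symmetric_scalar_prod[OF P y(1) p] .
    also have "(1 / \<rho>\<^sup>2) * scalar_prod ?p (P *\<^sub>v ?p) \<le> (1 / \<rho>\<^sup>2) * (\<rho> * scalar_prod ?p ?p)"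
      using pp by (intro mult_left_mono) auto
    finally have "0 \<le> scalar_prod y ?p - scalar_prod ?p ?p / \<rho>"
      using \<rho>(1) by (simp add: power2_eq_square field_simps)
    then have "scalar_prod ?p ?p \<le> \<rho> * scalar_prod y ?p"
      using \<rho>(1) by (simp add: field_simps)
    moreover have "1 \<le> \<beta>\<^sup>2 * scalar_prod ?p ?p"
    proof -
      have "B *\<^sub>v ?p = y" using B P y by (simp add: assoc_mult_mat_vec[symmetric, of _ d d])
      then have "norm2 y \<le> \<beta> * norm2 ?p" using \<beta>(2)[OF p] by simp
      then have "(norm2 y)\<^sup>2 \<le> (\<beta> * norm2 ?p)\<^sup>2" by (intro power_mono) auto
      then show ?thesis using y by (simp add: power_mult_distrib norm2_square)
    qed
    ultimately show ?thesis using \<beta>(1)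
      by (smt (verit) mult.assoc mult_left_mono zero_le_power2)
  qed
  obtain y where y: "y \<in> carrier_vec d" "scalar_prod y y = 1"
    "scalar_prod y (P *\<^sub>v y) < 1 / (\<beta>\<^sup>2 * \<rho>)"
    using inf[of "1 / (\<beta>\<^sup>2 * \<rho>)"] \<beta> \<rho> by auto
  then show False using low[OF y(1,2)] \<beta> \<rho> by (simp add: field_simps)
qed

lemma singular_value_of_eigenvector:
  fixes H :: "real mat"
  assumes H: "H \<in> carrier_mat d d" "transpose_mat H = H"
    and v: "v \<in> carrier_vec d" "v \<noteq> 0\<^sub>v d" "H *\<^sub>v v = \<mu> \<cdot>\<^sub>v v" and \<mu>: "0 \<le> \<mu>"
  shows "\<mu> \<in> singular_values H"
proof -
  have "(transpose_mat H * H) *\<^sub>v v = \<mu>\<^sup>2 \<cdot>\<^sub>v v"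
    using H v by (simp add: assoc_mult_mat_vec[of _ d d] mult_mat_vec power2_eq_square smult_smult_assoc)
  then have "eigenvector (transpose_mat H * H) v (\<mu>\<^sup>2)"
    using H v by (auto simp: eigenvector_def)
  then have "\<mu>\<^sup>2 \<in> spectrum (transpose_mat H * H)"
    by (auto simp: spectrum_def eigenvalue_def)
  then show ?thesis unfolding singular_values_def using \<mu> by (auto intro!: image_eqI[of _ _ "\<mu>\<^sup>2"])
qed

lemma quadratic_form_scale:
  fixes M :: "real mat"
  assumes "M \<in> carrier_mat d d" "y \<in> carrier_vec d"
  shows "scalar_prod (c \<cdot>\<^sub>v y) (M *\<^sub>v (c \<cdot>\<^sub>v y)) = c\<^sup>2 * scalar_prod y (M *\<^sub>v y)"
  using assms by (simp add: mult_mat_vec power2_eq_square)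

text \<open>Let \<mu> and \<nu> be the infimum and supremum of the form on the unit sphere. The
  semidefinite matrices H - \<mu> I and \<nu> I - H have infimum 0 there and are therefore singular,
  so \<mu> and \<nu> are eigenvalues of H and, being nonnegative, singular values. Hence they lie
  between \<open>sigma_min H\<close> and \<open>sigma_max H\<close>.\<close>

lemma sigma_bounds:
  fixes H :: "real mat"
  assumes d: "0 < d" and H: "H \<in> carrier_mat d d" "transpose_mat H = H"
    and pd: "\<And>y. y \<in> carrier_vec d \<Longrightarrow> y \<noteq> 0\<^sub>v d \<Longrightarrow> 0 < scalar_prod y (H *\<^sub>v y)"
  shows sigma_min_pos: "0 < sigma_min H"
    and sigma_min_le: "\<And>y. y \<in> carrier_vec d \<Longrightarrow> sigma_min H * scalar_prod y y \<le> scalar_prod y (H *\<^sub>v y)"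
    and sigma_max_ge: "\<And>y. y \<in> carrier_vec d \<Longrightarrow> scalar_prod y (H *\<^sub>v y) \<le> sigma_max H * scalar_prod y y"
proof -
  define R where "R = (\<lambda>y. scalar_prod y (H *\<^sub>v y)) ` {y \<in> carrier_vec d. scalar_prod y y = 1}"
  define \<mu> \<nu> where "\<mu> = Inf R" and "\<nu> = Sup R"
  have HH: "transpose_mat H * H \<in> carrier_mat d d" using H by auto
  have fin: "finite (singular_values H)"
    using card_finite_spectrum(1)[OF HH] by (simp add: singular_values_def)
  have unit: "unit_vec d 0 \<in> carrier_vec d" "scalar_prod (unit_vec d 0) (unit_vec d 0 :: real vec) = 1"
    using d by auto
  have ne: "R \<noteq> {}" unfolding R_def using unit by blast
  have nz: "y \<noteq> 0\<^sub>v d" if "y \<in> carrier_vec d" "scalar_prod y y = (1::real)" for y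
    using that by auto
  have Rpos: "0 \<le> r" if "r \<in> R" for r
    using that pd nz by (force simp: R_def less_imp_le)
  then have bb: "bdd_below R" by (rule bdd_belowI)
  obtain \<rho> where \<rho>: "\<And>y. y \<in> carrier_vec d \<Longrightarrow> norm2 (H *\<^sub>v y) \<le> \<rho> * norm2 y"
    using norm2_mult_mat_vec_bound[OF H(1)] by blast
  have "r \<le> \<rho>" if "r \<in> R" for r
  proof -
    obtain y where y: "y \<in> carrier_vec d" "scalar_prod y y = 1" "r = scalar_prod y (H *\<^sub>v y)"
      using \<open>r \<in> R\<close> by (auto simp: R_def)
    then have "norm2 y = 1" by (simp add: norm2_def)
    then show ?thesis using abs_scalar_prod_le[of y d "H *\<^sub>v y"] y H \<rho>[OF y(1)] by auto
  qed
  then have ba: "bdd_above R" by (rule bdd_aboveI)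
  have \<mu>0: "0 \<le> \<mu>" unfolding \<mu>_def using ne Rpos by (intro cInf_greatest)
  have \<nu>0: "0 \<le> \<nu>" using ne Rpos cSup_upper[OF _ ba] unfolding \<nu>_def by (meson all_not_in_conv order_trans)
  have between: "\<mu> * scalar_prod y y \<le> scalar_prod y (H *\<^sub>v y)
      \<and> scalar_prod y (H *\<^sub>v y) \<le> \<nu> * scalar_prod y y" if y: "y \<in> carrier_vec d" for y
  proof (cases "y = 0\<^sub>v d")
    case True
    then show ?thesis using H y by auto
  next
    case False
    then have pos: "0 < scalar_prod y y" using y by (rule scalar_prod_self_pos[rotated])
    define c where "c = 1 / norm2 y"
    have c2: "c\<^sup>2 = 1 / scalar_prod y y" by (simp add: c_def power_divide norm2_square)
    have "scalar_prod (c \<cdot>\<^sub>v y) (c \<cdot>\<^sub>v y) = c\<^sup>2 * scalar_prod y y"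
      using y by (simp add: power2_eq_square)
    then have "scalar_prod (c \<cdot>\<^sub>v y) (c \<cdot>\<^sub>v y) = 1"
      using c2 pos by simp
    then have "c\<^sup>2 * scalar_prod y (H *\<^sub>v y) \<in> R"
      unfolding R_def quadratic_form_scale[OF H(1) y, symmetric] using y by (intro imageI) simp
    then have "\<mu> \<le> c\<^sup>2 * scalar_prod y (H *\<^sub>v y)" "c\<^sup>2 * scalar_prod y (H *\<^sub>v y) \<le> \<nu>"
      unfolding \<mu>_def \<nu>_def using bb ba by (auto intro: cInf_lower cSup_upper)
    then show ?thesis using pos by (simp add: c2 field_simps)
  qed
  have form: "scalar_prod y ((H + c \<cdot>\<^sub>m 1\<^sub>m d) *\<^sub>v y) = scalar_prod y (H *\<^sub>v y) + c * scalar_prod y y"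
    "(H + c \<cdot>\<^sub>m 1\<^sub>m d) *\<^sub>v y = H *\<^sub>v y + c \<cdot>\<^sub>v y"
    if "y \<in> carrier_vec d" for y c
  proof -
    show *: "(H + c \<cdot>\<^sub>m 1\<^sub>m d) *\<^sub>v y = H *\<^sub>v y + c \<cdot>\<^sub>v y"
      using H that by (simp add: add_mult_distrib_mat_vec[of _ d d] smult_mat_mult_vec[of _ d d])
    show "scalar_prod y ((H + c \<cdot>\<^sub>m 1\<^sub>m d) *\<^sub>v y) = scalar_prod y (H *\<^sub>v y) + c * scalar_prod y y"
      unfolding * using H that by (simp add: scalar_prod_add_distrib[of _ d])
  qed
  have "\<mu> \<in> singular_values H"
  proof -
    define P where "P = H + (- \<mu>) \<cdot>\<^sub>m 1\<^sub>m d"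
    have "\<exists>v\<in>carrier_vec d. v \<noteq> 0\<^sub>v d \<and> P *\<^sub>v v = 0\<^sub>v d"
    proof (rule psd_singular_if_inf_zero)
      show "P \<in> carrier_mat d d" using H by (auto simp: P_def)
      show "transpose_mat P = P" using H by (auto simp: P_def transpose_add[of _ d d])
      show "0 \<le> scalar_prod y (P *\<^sub>v y)" if "y \<in> carrier_vec d" for y
        using that form between by (simp add: P_def)
      fix c :: real assume "0 < c"
      then obtain y where "y \<in> carrier_vec d" "scalar_prod y y = 1" "scalar_prod y (H *\<^sub>v y) < \<mu> + c"
        using cInf_lessD[OF ne, of "\<mu> + c"] by (auto simp: \<mu>_def R_def)
      then show "\<exists>y\<in>carrier_vec d. scalar_prod y y = 1 \<and> scalar_prod y (P *\<^sub>v y) < c"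
        using form(1)[of y "- \<mu>"] by (intro bexI[of _ y]) (auto simp: P_def)
    qed
    then obtain v where v: "v \<in> carrier_vec d" "v \<noteq> 0\<^sub>v d" "P *\<^sub>v v = 0\<^sub>v d" by blast
    have "H *\<^sub>v v = \<mu> \<cdot>\<^sub>v v"
    proof (rule eq_vecI)
      fix i assume "i < dim_vec (\<mu> \<cdot>\<^sub>v v)"
      then have i: "i < d" using v by simp
      have "H *\<^sub>v v + (- \<mu>) \<cdot>\<^sub>v v = 0\<^sub>v d"
        using v(3) unfolding P_def form(2)[OF v(1)] .
      then have "vec_index (H *\<^sub>v v + (- \<mu>) \<cdot>\<^sub>v v) i = 0"
        using i by (simp only: index_zero_vec)
      then show "vec_index (H *\<^sub>v v) i = vec_index (\<mu> \<cdot>\<^sub>v v) i" using i H v by simp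
    qed (use H v in auto)
    then show ?thesis using singular_value_of_eigenvector[OF H v(1,2) _ \<mu>0] by blast
  qed
  then have min: "sigma_min H \<le> \<mu>" using fin by (simp add: sigma_min_def)
  have "\<nu> \<in> singular_values H"
  proof -
    define P where "P = (- 1) \<cdot>\<^sub>m (H + (- \<nu>) \<cdot>\<^sub>m 1\<^sub>m d)"
    have Py: "P *\<^sub>v y = (-1) \<cdot>\<^sub>v ((H + (- \<nu>) \<cdot>\<^sub>m 1\<^sub>m d) *\<^sub>v y)" if "y \<in> carrier_vec d" for y
      using that H by (simp add: P_def smult_mat_mult_vec[of _ d d])
    have form': "scalar_prod y (P *\<^sub>v y) = \<nu> * scalar_prod y y - scalar_prod y (H *\<^sub>v y)"
      if "y \<in> carrier_vec d" for y
      unfolding Py[OF that] using that H form(1)[OF that, of "- \<nu>"] by simp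
    have "\<exists>v\<in>carrier_vec d. v \<noteq> 0\<^sub>v d \<and> P *\<^sub>v v = 0\<^sub>v d"
    proof (rule psd_singular_if_inf_zero)
      show "P \<in> carrier_mat d d" using H by (auto simp: P_def)
      show "transpose_mat P = P" using H by (auto simp: P_def transpose_add[of _ d d] transpose_smult)
      show "0 \<le> scalar_prod y (P *\<^sub>v y)" if "y \<in> carrier_vec d" for y
        using that form' between by simp
      fix c :: real assume "0 < c"
      then obtain y where "y \<in> carrier_vec d" "scalar_prod y y = 1" "\<nu> - c < scalar_prod y (H *\<^sub>v y)"
        using less_cSupD[OF ne, of "\<nu> - c"] by (auto simp: \<nu>_def R_def)
      then show "\<exists>y\<in>carrier_vec d. scalar_prod y y = 1 \<and> scalar_prod y (P *\<^sub>v y) < c"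
        using form'[of y] by (intro bexI[of _ y]) auto
    qed
    then obtain v where v: "v \<in> carrier_vec d" "v \<noteq> 0\<^sub>v d" "P *\<^sub>v v = 0\<^sub>v d" by blast
    have "H *\<^sub>v v = \<nu> \<cdot>\<^sub>v v"
    proof (rule eq_vecI)
      fix i assume "i < dim_vec (\<nu> \<cdot>\<^sub>v v)"
      then have i: "i < d" using v by simp
      have "(-1) \<cdot>\<^sub>v (H *\<^sub>v v + (- \<nu>) \<cdot>\<^sub>v v) = 0\<^sub>v d"
        using v(3) unfolding Py[OF v(1)] form(2)[OF v(1)] .
      then have "vec_index ((-1) \<cdot>\<^sub>v (H *\<^sub>v v + (- \<nu>) \<cdot>\<^sub>v v)) i = 0"
        using i by (simp only: index_zero_vec)
      then show "vec_index (H *\<^sub>v v) i = vec_index (\<nu> \<cdot>\<^sub>v v) i" using i H v by simp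
    qed (use H v in auto)
    then show ?thesis using singular_value_of_eigenvector[OF H v(1,2) _ \<nu>0] by blast
  qed
  then have max: "\<nu> \<le> sigma_max H" using fin by (simp add: sigma_max_def)
  \<comment> \<open>If k is an eigenvalue of H^T H at v, then k |v|^2 = |Hv|^2, and Hv is nonzero
    because the form of H is positive at v.\<close>
  have "0 < \<sigma>" if "\<sigma> \<in> singular_values H" for \<sigma>
  proof -
    obtain k where k: "\<sigma> = sqrt k" "k \<in> spectrum (transpose_mat H * H)"
      using \<open>\<sigma> \<in> singular_values H\<close> unfolding singular_values_def by blast
    then obtain v where v: "v \<in> carrier_vec d" "v \<noteq> 0\<^sub>v d" "(transpose_mat H * H) *\<^sub>v v = k \<cdot>\<^sub>v v"
      using H by (auto simp: spectrum_def eigenvalue_def eigenvector_def)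
    have Hv: "H *\<^sub>v v \<in> carrier_vec d" using H v by auto
    have "H *\<^sub>v v \<noteq> 0\<^sub>v d" using pd[OF v(1,2)] v(1) by auto
    then have "0 < scalar_prod (H *\<^sub>v v) (H *\<^sub>v v)" using Hv by (rule scalar_prod_self_pos[rotated])
    also have "\<dots> = scalar_prod v (H *\<^sub>v (H *\<^sub>v v))"
      using symmetric_scalar_prod[OF H v(1) Hv] by simp
    also have "H *\<^sub>v (H *\<^sub>v v) = k \<cdot>\<^sub>v v"
      using v H by (simp add: assoc_mult_mat_vec[of _ d d])
    also have "scalar_prod v (k \<cdot>\<^sub>v v) = k * scalar_prod v v" using v by simp
    finally have "0 < k" using scalar_prod_self_nonneg[of v] by (simp add: zero_less_mult_iff)
    then show ?thesis by (simp add: k)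
  qed
  then show "0 < sigma_min H"
    using Min_in[OF fin] \<open>\<mu> \<in> singular_values H\<close> by (force simp: sigma_min_def)
  show "sigma_min H * scalar_prod y y \<le> scalar_prod y (H *\<^sub>v y)" if "y \<in> carrier_vec d" for y
    using between[OF that] min mult_right_mono[OF min scalar_prod_self_nonneg[of y]] by linarith
  show "scalar_prod y (H *\<^sub>v y) \<le> sigma_max H * scalar_prod y y" if "y \<in> carrier_vec d" for y
    using between[OF that] max mult_right_mono[OF max scalar_prod_self_nonneg[of y]] by linarith
qed

section \<open>Positive definite matrices\<close>

lemma posdef_mat_inverse:
  fixes K :: "real mat"
  assumes K: "K \<in> carrier_mat d d"
    and pd: "\<And>y. y \<in> carrier_vec d \<Longrightarrow> y \<noteq> 0\<^sub>v d \<Longrightarrow> 0 < scalar_prod y (K *\<^sub>v y)"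
  obtains B where "mat_inverse K = Some B" "B \<in> carrier_mat d d" "K * B = 1\<^sub>m d" "B * K = 1\<^sub>m d"
proof -
  have "det K \<noteq> 0"
  proof
    assume "det K = 0"
    then obtain v where v: "v \<in> carrier_vec d" "v \<noteq> 0\<^sub>v d" "K *\<^sub>v v = 0\<^sub>v d"
      using det_0_iff_vec_prod_zero_field[OF K] by auto
    then show False using pd[OF v(1,2)] by simp
  qed
  then have "K \<in> Units (ring_mat TYPE(real) d ())" by (rule det_non_zero_imp_unit[OF K])
  then obtain B where "mat_inverse K = Some B"
    using mat_inverse(1)[OF K, where b = "()"] by (cases "mat_inverse K") auto
  then show ?thesis using mat_inverse(2)[OF K] that by blast
qed

text \<open>Gram--Schmidt for the inner product of K, with a determinant in place of the projection
  formula: fewer than d orthogonality conditions always have a nonzero common solution.\<close>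

lemma posdef_orthonormal_family:
  fixes K :: "real mat"
  assumes K: "K \<in> carrier_mat d d" "transpose_mat K = K"
    and pd: "\<And>y. y \<in> carrier_vec d \<Longrightarrow> y \<noteq> 0\<^sub>v d \<Longrightarrow> 0 < scalar_prod y (K *\<^sub>v y)"
    and m: "m \<le> d"
  shows "\<exists>t. (\<forall>i<m. t i \<in> carrier_vec d) \<and>
    (\<forall>i<m. \<forall>j<m. scalar_prod (t i) (K *\<^sub>v t j) = (if i = j then 1 else 0))"
  using m
proof (induction m)
  case (Suc m)
  then obtain t where t: "\<And>i. i < m \<Longrightarrow> t i \<in> carrier_vec d"
    "\<And>i j. i < m \<Longrightarrow> j < m \<Longrightarrow> scalar_prod (t i) (K *\<^sub>v t j) = (if i = j then 1 else 0)"
    by auto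
  \<comment> \<open>The conditions are padded by zero rows to a square matrix. Row \<open>m\<close>
    is zero, so the matrix is singular, and a kernel vector is K-orthogonal to all earlier
    vectors.\<close>
  define R where "R = mat d d (\<lambda>(i, a). if i < m then vec_index (K *\<^sub>v t i) a else 0)"
  have R: "R \<in> carrier_mat d d" by (simp add: R_def)
  have rowR: "row R i = (if i < m then K *\<^sub>v t i else 0\<^sub>v d)" if "i < d" for i
    using that K by (auto simp: R_def intro!: eq_vecI)
  have "transpose_mat R *\<^sub>v unit_vec d m = 0\<^sub>v d"
    using Suc.prems by (intro eq_vecI) (auto simp: R_def)
  moreover have "unit_vec d m \<noteq> (0\<^sub>v d :: real vec)" using Suc.prems by auto
  ultimately have "det (transpose_mat R) = 0"
    using det_0_iff_vec_prod_zero_field[of "transpose_mat R" d] R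
    by (meson transpose_carrier_mat unit_vec_carrier)
  then have "det R = 0" using det_transpose[OF R] by simp
  then obtain y where y: "y \<in> carrier_vec d" "y \<noteq> 0\<^sub>v d" "R *\<^sub>v y = 0\<^sub>v d"
    using det_0_iff_vec_prod_zero_field[OF R] by auto
  define c where "c = 1 / sqrt (scalar_prod y (K *\<^sub>v y))"
  define z where "z = c \<cdot>\<^sub>v y"
  have z: "z \<in> carrier_vec d" using y by (simp add: z_def)
  have "scalar_prod z (K *\<^sub>v z) = c\<^sup>2 * scalar_prod y (K *\<^sub>v y)"
    unfolding z_def by (rule quadratic_form_scale[OF K(1) y(1)])
  then have zz: "scalar_prod z (K *\<^sub>v z) = 1"
    using pd[OF y(1,2)] by (simp add: c_def power_divide)
  have tz: "scalar_prod (t i) (K *\<^sub>v z) = 0" if i: "i < m" for i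
  proof -
    have "vec_index (R *\<^sub>v y) i = 0" using y i Suc.prems by simp
    then have "scalar_prod (K *\<^sub>v t i) y = 0" using i Suc.prems R rowR[of i] by simp
    then have "scalar_prod (t i) (K *\<^sub>v y) = 0" using symmetric_scalar_prod[OF K t(1)[OF i] y(1)] by simp
    then show ?thesis
      using K y t(1)[OF i] by (simp add: z_def mult_mat_vec)
  qed
  have zt: "scalar_prod z (K *\<^sub>v t i) = 0" if i: "i < m" for i
    using tz[OF i] symmetric_scalar_prod[OF K z t(1)[OF i]] K z t(1)[OF i]
      comm_scalar_prod[of "K *\<^sub>v z" d "t i"] by simp
  show ?case
    by (rule exI[of _ "t(m := z)"]) (use t z zz tz zt in \<open>auto simp: less_Suc_eq\<close>)
qed simp

text \<open>\<open>T\<close> replaces the inverse square root of \<open>K\<close>. One identity says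
  that the form of \<open>K\<close> becomes the Euclidean one under \<open>T\<close>, the other that
  the inverse of \<open>K\<close> factors as \<open>T * transpose_mat T\<close>, which turns
  leverage scores into squared lengths.\<close>

lemma posdef_orthonormalizing_matrix:
  fixes K :: "real mat"
  assumes K: "K \<in> carrier_mat d d" "transpose_mat K = K"
    and pd: "\<And>y. y \<in> carrier_vec d \<Longrightarrow> y \<noteq> 0\<^sub>v d \<Longrightarrow> 0 < scalar_prod y (K *\<^sub>v y)"
  obtains T where "T \<in> carrier_mat d d" "T * transpose_mat T * K = 1\<^sub>m d" "transpose_mat T * K * T = 1\<^sub>m d"
proof -
  obtain t where t: "\<And>i. i < d \<Longrightarrow> t i \<in> carrier_vec d"
    "\<And>i j. i < d \<Longrightarrow> j < d \<Longrightarrow> scalar_prod (t i) (K *\<^sub>v t j) = (if i = j then 1 else 0)"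
    using posdef_orthonormal_family[OF K pd order_refl] by auto
  define T where "T = mat d d (\<lambda>(a, i). vec_index (t i) a)"
  have T: "T \<in> carrier_mat d d" by (simp add: T_def)
  have col: "col T i = t i" if "i < d" for i
    using that t(1)[OF that] by (auto simp: T_def intro!: eq_vecI)
  have "transpose_mat T * (K * T) = 1\<^sub>m d"
  proof (rule eq_matI)
    fix i j assume "i < dim_row (1\<^sub>m d :: real mat)" "j < dim_col (1\<^sub>m d :: real mat)"
    then have ij: "i < d" "j < d" by auto
    have "(transpose_mat T * (K * T)) $$ (i, j) = scalar_prod (col T i) (col (K * T) j)"
      using T K ij by simp
    also have "col (K * T) j = K *\<^sub>v col T j" by (rule col_mult2[OF K(1) T ij(2)])
    finally show "(transpose_mat T * (K * T)) $$ (i, j) = 1\<^sub>m d $$ (i, j)"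
      using ij t(2)[OF ij] by (simp add: col)
  qed (use T in auto)
  then have *: "transpose_mat T * K * T = 1\<^sub>m d"
    using T K by (simp add: assoc_mult_mat[of _ d d _ d _ d])
  then have "T * (transpose_mat T * K) = 1\<^sub>m d"
    using mat_mult_left_right_inverse[OF _ T *] T K by simp
  then have "T * transpose_mat T * K = 1\<^sub>m d"
    using T K by (simp add: assoc_mult_mat[of _ d d _ d _ d])
  then show ?thesis using that T * by blast
qed

text \<open>The regularized Gram matrix is invertible for \<gamma> > 0, so leverage scores involve
  an ordinary inverse. For uniqueness, the first Penrose equation multiplied by \<open>B\<close>
  forces K X = 1.\<close>

lemma pinv_eq_inverse:
  fixes K :: "real mat"
  assumes K: "K \<in> carrier_mat d d" and B: "B \<in> carrier_mat d d" "B * K = 1\<^sub>m d"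
  shows "pinv K = B"
  unfolding pinv_def
proof (rule the_equality)
  have KB: "K * B = 1\<^sub>m d" using mat_mult_left_right_inverse[OF B(1) K B(2)] .
  show "B \<in> carrier_mat (dim_col K) (dim_row K) \<and> K * B * K = K \<and> B * K * B = B
      \<and> transpose_mat (K * B) = K * B \<and> transpose_mat (B * K) = B * K"
    using K B KB by auto
  fix X assume X: "X \<in> carrier_mat (dim_col K) (dim_row K) \<and> K * X * K = K \<and> X * K * X = X
      \<and> transpose_mat (K * X) = K * X \<and> transpose_mat (X * K) = X * K"
  then have Xc: "X \<in> carrier_mat d d" using K by auto
  have "K * X = K * X * (K * B)" using KB K Xc by simp
  also have "\<dots> = K * X * K * B" using K B Xc by (simp add: assoc_mult_mat[of _ d d _ d _ d])
  also have "\<dots> = 1\<^sub>m d" using X KB by simp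
  finally have "B * (K * X) = B" using B by simp
  moreover have "B * (K * X) = X"
    using K B Xc by (simp add: assoc_mult_mat[symmetric, of _ d d _ d _ d])
  ultimately show "X = B" by simp
qed

text \<open>Expand the form of \<open>Ht - H\<close> at \<open>g \<plusminus> \<epsilon> e\<close>.\<close>

lemma newton_contraction:
  fixes H :: "real mat"
  assumes H: "H \<in> carrier_mat d d" "transpose_mat H = H"
    and Ht: "Ht \<in> carrier_mat d d" "transpose_mat Ht = Ht"
    and psd: "\<And>y. y \<in> carrier_vec d \<Longrightarrow> 0 \<le> scalar_prod y (H *\<^sub>v y)"
    and approx: "\<And>y. y \<in> carrier_vec d \<Longrightarrow>
      \<bar>scalar_prod y (Ht *\<^sub>v y) - scalar_prod y (H *\<^sub>v y)\<bar> \<le> \<epsilon> / 2 * scalar_prod y (H *\<^sub>v y)"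
    and \<epsilon>: "0 < \<epsilon>" "\<epsilon> < 1 / 4"
    and ge: "g \<in> carrier_vec d" "e \<in> carrier_vec d" "Ht *\<^sub>v g = Ht *\<^sub>v e - H *\<^sub>v e"
  shows "scalar_prod g (H *\<^sub>v g) \<le> \<epsilon>\<^sup>2 * scalar_prod e (H *\<^sub>v e)"
proof -
  define a b c where "a = scalar_prod g (H *\<^sub>v g)" and "b = scalar_prod g (H *\<^sub>v e)"
    and "c = scalar_prod e (H *\<^sub>v e)"
  define a' b' c' where "a' = scalar_prod g (Ht *\<^sub>v g)" and "b' = scalar_prod g (Ht *\<^sub>v e)"
    and "c' = scalar_prod e (Ht *\<^sub>v e)"
  have a'b': "a' = b' - b"
    using ge H Ht by (simp add: a'_def b'_def b_def scalar_prod_minus_distrib[of _ d])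
  have ac: "0 \<le> a" "0 \<le> c" using psd ge by (auto simp: a_def c_def)
  have "\<bar>(a' + 2 * k * b' + k\<^sup>2 * c') - (a + 2 * k * b + k\<^sup>2 * c)\<bar> \<le> \<epsilon> / 2 * (a + 2 * k * b + k\<^sup>2 * c)" for k
    using approx[of "g + k \<cdot>\<^sub>v e"] quadratic_form_add[OF H ge(1,2), of k]
      quadratic_form_add[OF Ht ge(1,2), of k] ge
    by (simp add: a_def b_def c_def a'_def b'_def c'_def)
  \<comment> \<open>On adding the two bounds the diagonal terms cancel on the left and the cross
    terms on the right.\<close>
  note this[of \<epsilon>, THEN abs_le_D1] this[of "- \<epsilon>", THEN abs_le_D2]
  from add_mono[OF this] have "4 * \<epsilon> * (b' - b) \<le> \<epsilon> / 2 * (2 * a + 2 * \<epsilon>\<^sup>2 * c)"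
    by (simp add: algebra_simps)
  then have "\<epsilon> * (4 * (b' - b)) \<le> \<epsilon> * (a + \<epsilon>\<^sup>2 * c)" by (simp add: algebra_simps)
  then have 1: "4 * (b' - b) \<le> a + \<epsilon>\<^sup>2 * c" using \<epsilon> by simp
  have "a - \<epsilon> / 2 * a \<le> a'" using approx[OF ge(1)] unfolding a_def a'_def by linarith
  moreover have "\<epsilon> / 2 * a \<le> a / 8"
    using mult_right_mono[of "\<epsilon> / 2" "1 / 8" a] \<epsilon> ac by simp
  ultimately have 2: "7 * a \<le> 8 * a'" by linarith
  \<comment> \<open>As a' = b' - b, the same quantity is bounded below by 7a/8 and above by (a +
    \<epsilon>^2 c)/4, which leaves 5a <= 2 \<epsilon>^2 c.\<close>
  have "8 * a' \<le> 2 * a + 2 * (\<epsilon>\<^sup>2 * c)" using 1 unfolding a'b' by linarith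
  with 2 have "5 * a \<le> 2 * (\<epsilon>\<^sup>2 * c)" by linarith
  moreover have "0 \<le> \<epsilon>\<^sup>2 * c" using ac by simp
  ultimately have "a \<le> \<epsilon>\<^sup>2 * c" by linarith
  then show ?thesis by (simp add: a_def c_def)
qed

section \<open>Sketched Hessians\<close>

text \<open>Shared by three matrices: the regularized Gram matrix that defines the leverage scores,
  the exact Hessian, and the sketched Hessian, where \<open>B\<close> is
  \<open>transpose_mat U * A\<close>.\<close>

lemma gram_plus_scalar:
  fixes B :: "real mat"
  assumes B: "B \<in> carrier_mat m d" and M: "M = c \<cdot>\<^sub>m (transpose_mat B * B) + r \<cdot>\<^sub>m 1\<^sub>m d"
  shows "M \<in> carrier_mat d d" "transpose_mat M = M"
    and "\<And>u y. u \<in> carrier_vec d \<Longrightarrow> y \<in> carrier_vec d \<Longrightarrow>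
      scalar_prod u (M *\<^sub>v y) = c * scalar_prod (B *\<^sub>v u) (B *\<^sub>v y) + r * scalar_prod u y"
proof -
  have BB: "transpose_mat B * B \<in> carrier_mat d d" using B by auto
  show "M \<in> carrier_mat d d" using BB M by auto
  have "transpose_mat (transpose_mat B * B) = transpose_mat B * B"
    using B transpose_mult[of "transpose_mat B" d m B d] by simp
  then show "transpose_mat M = M"
    unfolding M using BB by (simp add: transpose_add[of _ d d] transpose_smult)
  fix u y :: "real vec" assume u: "u \<in> carrier_vec d" and y: "y \<in> carrier_vec d"
  have By: "B *\<^sub>v y \<in> carrier_vec m" "B *\<^sub>v u \<in> carrier_vec m"
    using B y u by (auto intro: mult_mat_vec_carrier)
  have "M *\<^sub>v y = c \<cdot>\<^sub>v (transpose_mat B *\<^sub>v (B *\<^sub>v y)) + r \<cdot>\<^sub>v y"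
  proof -
    have "M *\<^sub>v y = (c \<cdot>\<^sub>m (transpose_mat B * B)) *\<^sub>v y + (r \<cdot>\<^sub>m 1\<^sub>m d) *\<^sub>v y"
      unfolding M using BB y by (intro add_mult_distrib_mat_vec[of _ d d]) auto
    moreover have "(c \<cdot>\<^sub>m (transpose_mat B * B)) *\<^sub>v y = c \<cdot>\<^sub>v ((transpose_mat B * B) *\<^sub>v y)"
      using BB y by (rule smult_mat_mult_vec)
    moreover have "(r \<cdot>\<^sub>m 1\<^sub>m d) *\<^sub>v y = r \<cdot>\<^sub>v y"
      using y by (simp add: smult_mat_mult_vec[of _ d d])
    moreover have "(transpose_mat B * B) *\<^sub>v y = transpose_mat B *\<^sub>v (B *\<^sub>v y)"
      using B y by (intro assoc_mult_mat_vec[of _ d m _ d]) auto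
    ultimately show ?thesis by simp
  qed
  moreover have "scalar_prod u (transpose_mat B *\<^sub>v (B *\<^sub>v y)) = scalar_prod (B *\<^sub>v u) (B *\<^sub>v y)"
  proof -
    have BtBy: "transpose_mat B *\<^sub>v (B *\<^sub>v y) \<in> carrier_vec d"
      using B By by (intro mult_mat_vec_carrier[of _ d m]) auto
    have "scalar_prod (transpose_mat B *\<^sub>v (B *\<^sub>v y)) u = scalar_prod (B *\<^sub>v y) (B *\<^sub>v u)"
      by (rule transpose_vec_mult_scalar[OF B u By(1)])
    then show ?thesis
      using comm_scalar_prod[OF BtBy u] comm_scalar_prod[OF By] by simp
  qed
  moreover have "transpose_mat B *\<^sub>v (B *\<^sub>v y) \<in> carrier_vec d"
    using B By by (intro mult_mat_vec_carrier[of _ d m]) auto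
  ultimately show "scalar_prod u (M *\<^sub>v y) = c * scalar_prod (B *\<^sub>v u) (B *\<^sub>v y) + r * scalar_prod u y"
    using u y by (simp add: scalar_prod_add_distrib[of _ d])
qed

text \<open>The Hessian in algebraic form, the counterpart of \<open>sketched_hess\<close>.
  Concentration concerns this matrix alone; its identification with second derivatives is a separate
  matter.\<close>

definition exact_hess :: "real \<Rightarrow> real mat \<Rightarrow> real mat" where
  "exact_hess \<gamma> A = (1 / real (dim_row A)) \<cdot>\<^sub>m (transpose_mat A * A) + \<gamma> \<cdot>\<^sub>m 1\<^sub>m (dim_col A)"

lemma exact_hess:
  assumes "A \<in> carrier_mat n d"
  shows "exact_hess \<gamma> A \<in> carrier_mat d d" "transpose_mat (exact_hess \<gamma> A) = exact_hess \<gamma> A"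
    and "\<And>u y. u \<in> carrier_vec d \<Longrightarrow> y \<in> carrier_vec d \<Longrightarrow>
      scalar_prod u (exact_hess \<gamma> A *\<^sub>v y) = 1 / real n * scalar_prod (A *\<^sub>v u) (A *\<^sub>v y) + \<gamma> * scalar_prod u y"
proof -
  have "exact_hess \<gamma> A = (1 / real n) \<cdot>\<^sub>m (transpose_mat A * A) + \<gamma> \<cdot>\<^sub>m 1\<^sub>m d"
    using assms by (simp add: exact_hess_def)
  note gram_plus_scalar[OF assms this]
  then show "exact_hess \<gamma> A \<in> carrier_mat d d" "transpose_mat (exact_hess \<gamma> A) = exact_hess \<gamma> A"
    "\<And>u y. u \<in> carrier_vec d \<Longrightarrow> y \<in> carrier_vec d \<Longrightarrow>
      scalar_prod u (exact_hess \<gamma> A *\<^sub>v y) = 1 / real n * scalar_prod (A *\<^sub>v u) (A *\<^sub>v y) + \<gamma> * scalar_prod u y"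
    by auto
qed

lemma exact_hess_posdef:
  assumes A: "A \<in> carrier_mat n d" and \<gamma>: "0 < \<gamma>" and y: "y \<in> carrier_vec d" "y \<noteq> 0\<^sub>v d"
  shows "0 < scalar_prod y (exact_hess \<gamma> A *\<^sub>v y)"
  using exact_hess(3)[OF A y(1,1), of \<gamma>] \<gamma> scalar_prod_self_pos[OF y]
    scalar_prod_self_nonneg[of "A *\<^sub>v y"] by (simp add: add_nonneg_pos)

lemma sketched_hess:
  assumes A: "A \<in> carrier_mat n d" and U: "U \<in> carrier_mat n s"
  shows "sketched_hess \<gamma> A U \<in> carrier_mat d d"
    and "transpose_mat (sketched_hess \<gamma> A U) = sketched_hess \<gamma> A U"
    and "\<And>y. y \<in> carrier_vec d \<Longrightarrow> scalar_prod y (sketched_hess \<gamma> A U *\<^sub>v y)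
      = 1 / real n * (norm2 (transpose_mat U *\<^sub>v (A *\<^sub>v y)))\<^sup>2 + \<gamma> * scalar_prod y y"
proof -
  let ?B = "transpose_mat U * A"
  have B: "?B \<in> carrier_mat s d" using A U by auto
  have "transpose_mat ?B * ?B = transpose_mat A * U * transpose_mat U * A"
  proof -
    have "transpose_mat ?B = transpose_mat A * U"
      using transpose_mult[of "transpose_mat U" s n A d] A U by simp
    then show ?thesis
      using A U assoc_mult_mat[of "transpose_mat A * U" d s "transpose_mat U" n A d] by simp
  qed
  then have "sketched_hess \<gamma> A U = (1 / real n) \<cdot>\<^sub>m (transpose_mat ?B * ?B) + \<gamma> \<cdot>\<^sub>m 1\<^sub>m d"
    using A by (simp add: sketched_hess_def)
  note * = gram_plus_scalar[OF B this]
  show "sketched_hess \<gamma> A U \<in> carrier_mat d d"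
    and "transpose_mat (sketched_hess \<gamma> A U) = sketched_hess \<gamma> A U" by fact+
  fix y :: "real vec" assume y: "y \<in> carrier_vec d"
  have "?B *\<^sub>v y = transpose_mat U *\<^sub>v (A *\<^sub>v y)"
    using A U y by (intro assoc_mult_mat_vec[of _ s n _ d]) auto
  then show "scalar_prod y (sketched_hess \<gamma> A U *\<^sub>v y)
      = 1 / real n * (norm2 (transpose_mat U *\<^sub>v (A *\<^sub>v y)))\<^sup>2 + \<gamma> * scalar_prod y y"
    using *(3)[OF y y] by (simp add: norm2_square)
qed

section \<open>Sampling matrices and spectral approximation\<close>

lemma norm2_square_mult_mat_vec:
  assumes "A \<in> carrier_mat n d"
  shows "(norm2 (A *\<^sub>v y))\<^sup>2 = (\<Sum>j<n. (scalar_prod (row A j) y)\<^sup>2)"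
proof -
  have "A *\<^sub>v y \<in> carrier_vec n" using assms by (intro carrier_vecI) auto
  then have "(norm2 (A *\<^sub>v y))\<^sup>2 = (\<Sum>j<n. (vec_index (A *\<^sub>v y) j)\<^sup>2)"
    by (simp only: norm2_eq_L2_set L2_set_def) (simp add: sum_nonneg)
  also have "\<dots> = (\<Sum>j<n. (scalar_prod (row A j) y)\<^sup>2)"
    using assms by (intro sum.cong) auto
  finally show ?thesis .
qed

lemma sampling_mat_carrier [simp]: "A \<in> carrier_mat n d \<Longrightarrow> sampling_mat \<gamma> A s k \<in> carrier_mat n s"
  by (simp add: sampling_mat_def)

text \<open>Every column of the sampling matrix selects one coordinate of \<open>w\<close>.
  Nonnegative probabilities ensure that the square roots square back.\<close>

lemma norm2_square_sampling_mat:
  assumes A: "A \<in> carrier_mat n d" and k: "\<And>c. c < s \<Longrightarrow> k c < n"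
    and w: "w \<in> carrier_vec n" and p: "\<And>j. j < n \<Longrightarrow> 0 \<le> ridge_prob \<gamma> A j"
  shows "(norm2 (transpose_mat (sampling_mat \<gamma> A s k) *\<^sub>v w))\<^sup>2
    = (\<Sum>c<s. 1 / (real s * ridge_prob \<gamma> A (k c)) * (vec_index w (k c))\<^sup>2)"
proof -
  let ?U = "sampling_mat \<gamma> A s k"
  have "scalar_prod (row (transpose_mat ?U) c) w = 1 / sqrt (real s * ridge_prob \<gamma> A (k c)) * vec_index w (k c)"
    if c: "c < s" for c
  proof -
    have "scalar_prod (row (transpose_mat ?U) c) w = (\<Sum>i<n. vec_index (col ?U c) i * vec_index w i)"
      using A w c by (simp add: scalar_prod_eq_dot[of _ n] dot_def sampling_mat_def)
    also have "\<dots> = (\<Sum>i<n. if i = k c then 1 / sqrt (real s * ridge_prob \<gamma> A i) * vec_index w i else 0)"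
      using A c by (intro sum.cong) (auto simp: sampling_mat_def)
    finally show ?thesis using k[OF c] by simp
  qed
  moreover have "transpose_mat ?U \<in> carrier_mat s n" using A by simp
  ultimately show ?thesis
    using p k by (simp add: norm2_square_mult_mat_vec[of _ s n] power_mult_distrib power_divide)
qed

text \<open>In coordinates y = T w the form of K becomes |w|^2 and row j of A becomes T^T a_j. An
  additive error (\<epsilon>/2) |w|^2 is thus a relative error for K, which is n times the exact
  Hessian; the regularizer is common to both Hessians and cancels in their difference.\<close>

theorem sketched_hess_approx:
  assumes A: "A \<in> carrier_mat n d" and n: "0 < n" and d: "0 < d" and \<gamma>: "0 < \<gamma>"
    and \<epsilon>: "0 < \<epsilon>" "\<epsilon> < 1 / 4" and \<delta>: "0 < \<delta>"
    and s: "64 * (eff_dim \<gamma> A / \<epsilon>\<^sup>2) * max 1 (ln (eff_dim \<gamma> A / \<delta>)) \<le> real s"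
  shows "measure_pmf.prob (ridge_sampling_pmf \<gamma> A s)
    {U \<in> carrier_mat n s. \<forall>y \<in> carrier_vec d.
      \<bar>scalar_prod y (sketched_hess \<gamma> A U *\<^sub>v y) - scalar_prod y (exact_hess \<gamma> A *\<^sub>v y)\<bar>
        \<le> \<epsilon> / 2 * scalar_prod y (exact_hess \<gamma> A *\<^sub>v y)} \<ge> 1 - \<delta>"
    (is "measure_pmf.prob _ ?good \<ge> _")
proof -
  define K where "K = transpose_mat A * A + (real n * \<gamma>) \<cdot>\<^sub>m 1\<^sub>m d"
  have K1: "K = 1 \<cdot>\<^sub>m (transpose_mat A * A) + (real n * \<gamma>) \<cdot>\<^sub>m 1\<^sub>m d"
    using A by (auto simp: K_def intro!: eq_matI)
  note K = gram_plus_scalar[OF A K1]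
  have Kform: "scalar_prod y (K *\<^sub>v y) = (\<Sum>j<n. (scalar_prod (row A j) y)\<^sup>2) + real n * \<gamma> * scalar_prod y y"
    if "y \<in> carrier_vec d" for y
    using K(3)[OF that that] norm2_square_mult_mat_vec[OF A, of y] by (simp add: norm2_square)
  have pd: "0 < scalar_prod y (K *\<^sub>v y)" if "y \<in> carrier_vec d" "y \<noteq> 0\<^sub>v d" for y
    using Kform[OF that(1)] scalar_prod_self_pos[OF that] n \<gamma> by (simp add: add_nonneg_pos sum_nonneg)
  obtain T where T: "T \<in> carrier_mat d d" "T * transpose_mat T * K = 1\<^sub>m d" "transpose_mat T * K * T = 1\<^sub>m d"
    using posdef_orthonormalizing_matrix[OF K(1,2) pd] by blast
  have Tt: "transpose_mat T \<in> carrier_mat d d" using T by simp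
  have row: "row A j \<in> carrier_vec d" if "j < n" for j using A that by simp
  define v where "v j = (if j < n then vec_index (transpose_mat T *\<^sub>v row A j) else (\<lambda>_. 0))" for j
  have vdot: "dot d (v j) (vec_index w) = scalar_prod (row A j) (T *\<^sub>v w)"
    if w: "w \<in> carrier_vec d" and j: "j < n" for w j
  proof -
    have "dot d (v j) (vec_index w) = scalar_prod (transpose_mat T *\<^sub>v row A j) w"
      using w j by (simp add: v_def scalar_prod_eq_dot)
    also have "\<dots> = scalar_prod (row A j) (T *\<^sub>v w)"
      by (rule transpose_vec_mult_scalar[OF T(1) w row[OF j]])
    finally show ?thesis .
  qed
  have wdot: "dot d (vec_index w) (vec_index w) = scalar_prod (T *\<^sub>v w) (K *\<^sub>v (T *\<^sub>v w))"
    if w: "w \<in> carrier_vec d" for w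
  proof -
    have Tw: "T *\<^sub>v w \<in> carrier_vec d" using T w by auto
    have KTw: "K *\<^sub>v (T *\<^sub>v w) \<in> carrier_vec d" using K Tw by auto
    have "transpose_mat T *\<^sub>v (K *\<^sub>v (T *\<^sub>v w)) = (transpose_mat T * K * T) *\<^sub>v w"
      using T(1) Tt K(1) w by (simp add: assoc_mult_mat_vec[of _ d d _ d])
    also have "\<dots> = w" unfolding T(3) using w by simp
    finally have "transpose_mat T *\<^sub>v (K *\<^sub>v (T *\<^sub>v w)) = w" .
    then have "scalar_prod w w = scalar_prod (transpose_mat T *\<^sub>v (K *\<^sub>v (T *\<^sub>v w))) w" by simp
    also have "\<dots> = scalar_prod (K *\<^sub>v (T *\<^sub>v w)) (T *\<^sub>v w)"
      by (rule transpose_vec_mult_scalar[OF T(1) w KTw])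
    also have "\<dots> = scalar_prod (T *\<^sub>v w) (K *\<^sub>v (T *\<^sub>v w))" by (rule comm_scalar_prod[OF KTw Tw])
    finally show ?thesis using w by (simp add: scalar_prod_eq_dot)
  qed
  have preimage: "\<exists>w\<in>carrier_vec d. T *\<^sub>v w = y" if y: "y \<in> carrier_vec d" for y
  proof
    show "transpose_mat T *\<^sub>v (K *\<^sub>v y) \<in> carrier_vec d" using Tt K y by auto
    have "T *\<^sub>v (transpose_mat T *\<^sub>v (K *\<^sub>v y)) = (T * transpose_mat T * K) *\<^sub>v y"
      using T(1) Tt K(1) y by (simp add: assoc_mult_mat_vec[of _ d d _ d])
    also have "\<dots> = y" unfolding T(2) using y by simp
    finally show "T *\<^sub>v (transpose_mat T *\<^sub>v (K *\<^sub>v y)) = y" .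
  qed
  have lev: "ridge_leverage \<gamma> A j = dot d (v j) (v j)" if j: "j < n" for j
  proof -
    have "pinv K = T * transpose_mat T" using T Tt K by (intro pinv_eq_inverse[of _ d]) auto
    then have "ridge_leverage \<gamma> A j = scalar_prod (row A j) ((T * transpose_mat T) *\<^sub>v row A j)"
      using A by (simp add: ridge_leverage_def K_def)
    also have "(T * transpose_mat T) *\<^sub>v row A j = T *\<^sub>v (transpose_mat T *\<^sub>v row A j)"
      by (rule assoc_mult_mat_vec[OF T(1) Tt row[OF j]])
    also have "scalar_prod (row A j) \<dots> = dot d (v j) (vec_index (transpose_mat T *\<^sub>v row A j))"
      using j Tt row[OF j] by (intro vdot[symmetric]) auto
    finally show ?thesis using j by (simp add: v_def)
  qed
  define D where "D = eff_dim \<gamma> A"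
  have D: "D = (\<Sum>j<n. dot d (v j) (v j))"
    using A lev by (simp add: D_def eff_dim_def)
  have dot_nonneg: "0 \<le> dot d u u" for u by (simp add: dot_def sum_nonneg)
  have D0: "0 \<le> D" unfolding D by (simp add: sum_nonneg dot_nonneg)
  have sampled: "(norm2 (transpose_mat (sampling_mat \<gamma> A s k) *\<^sub>v (A *\<^sub>v (T *\<^sub>v w))))\<^sup>2
      = (\<Sum>c<s. D / (real s * dot d (v (k c)) (v (k c))) * (dot d (v (k c)) (vec_index w))\<^sup>2)"
    if w: "w \<in> carrier_vec d" and k: "\<And>c. c < s \<Longrightarrow> k c < n" and p: "\<And>j. j < n \<Longrightarrow> 0 \<le> ridge_prob \<gamma> A j" for w k
  proof -
    have "A *\<^sub>v (T *\<^sub>v w) \<in> carrier_vec n" using A by (intro carrier_vecI) auto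
    from norm2_square_sampling_mat[OF A k this p]
    have "(norm2 (transpose_mat (sampling_mat \<gamma> A s k) *\<^sub>v (A *\<^sub>v (T *\<^sub>v w))))\<^sup>2
        = (\<Sum>c<s. 1 / (real s * ridge_prob \<gamma> A (k c)) * (vec_index (A *\<^sub>v (T *\<^sub>v w)) (k c))\<^sup>2)" .
    also have "\<dots> = (\<Sum>c<s. D / (real s * dot d (v (k c)) (v (k c))) * (dot d (v (k c)) (vec_index w))\<^sup>2)"
    proof (rule sum.cong[OF refl])
      fix c assume "c \<in> {..<s}"
      then have kc: "k c < n" using k by simp
      then have "vec_index (A *\<^sub>v (T *\<^sub>v w)) (k c) = dot d (v (k c)) (vec_index w)"
        using A vdot[OF w kc] by simp
      then show "1 / (real s * ridge_prob \<gamma> A (k c)) * (vec_index (A *\<^sub>v (T *\<^sub>v w)) (k c))\<^sup>2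
          = D / (real s * dot d (v (k c)) (v (k c))) * (dot d (v (k c)) (vec_index w))\<^sup>2"
        by (simp add: ridge_prob_def lev[OF kc] D_def)
    qed
    finally show ?thesis .
  qed
  show ?thesis
  proof (cases "D = 0")
    \<comment> \<open>The index law is unspecified here, but A vanishes on every vector, so each
      sketch reproduces the exact Hessian whatever is drawn.\<close>
    case True
    have "(\<Sum>j<n. (scalar_prod (row A j) y)\<^sup>2) = 0" if y: "y \<in> carrier_vec d" for y
    proof -
      obtain w where w: "w \<in> carrier_vec d" "T *\<^sub>v w = y" using preimage[OF y] by blast
      have "dot d (v j) (vec_index w) = 0" if "j < n" for j
      proof -
        have "dot d (v j) (v j) = 0"
          using True that unfolding D by (simp add: sum_nonneg_eq_0_iff dot_nonneg)
        then have "\<forall>i<d. v j i = 0" by (simp add: dot_def sum_nonneg_eq_0_iff)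
        then show ?thesis by (simp add: dot_def)
      qed
      then show ?thesis using w vdot[OF w(1)] by simp
    qed
    then have Ay: "A *\<^sub>v y = 0\<^sub>v n" if "y \<in> carrier_vec d" for y
      using norm2_square_mult_mat_vec[OF A, of y] norm2_eq_0_iff[of "A *\<^sub>v y" n] A that
        carrier_vecI[of "A *\<^sub>v y" n] by simp
    have zero: "(norm2 (M *\<^sub>v 0\<^sub>v n))\<^sup>2 = 0" if "M \<in> carrier_mat s n" for M
      using that by (simp add: norm2_square_mult_mat_vec[OF that])
    have "sampling_mat \<gamma> A s k \<in> ?good" for k
    proof -
      have U: "sampling_mat \<gamma> A s k \<in> carrier_mat n s" using A by simp
      have "scalar_prod y (sketched_hess \<gamma> A (sampling_mat \<gamma> A s k) *\<^sub>v y)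
          = scalar_prod y (exact_hess \<gamma> A *\<^sub>v y)"
        if y: "y \<in> carrier_vec d" for y
        unfolding sketched_hess(3)[OF A U y] exact_hess(3)[OF A y y] Ay[OF y]
        using U by (subst zero) auto
      moreover have "0 \<le> scalar_prod y (exact_hess \<gamma> A *\<^sub>v y)" if y: "y \<in> carrier_vec d" for y
        unfolding exact_hess(3)[OF A y y] using \<gamma> by (simp add: scalar_prod_self_nonneg)
      ultimately show ?thesis using U \<epsilon> by simp
    qed
    then have "sampling_mat \<gamma> A s -` ?good = UNIV" by auto
    then show ?thesis using \<delta> by (simp add: ridge_sampling_pmf_def measure_map_pmf)
  next
    case False
    then have Dpos: "0 < D" using D0 by simp
    have prob_eq: "ridge_prob \<gamma> A j = dot d (v j) (v j) / D" if "j < n" for j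
      using that by (simp add: ridge_prob_def lev D_def)
    \<comment> \<open>The embedding of the weights is meaningful once they are nonnegative and sum
      to 1; D > 0 guarantees both.\<close>
    have pmf_eq: "pmf (ridge_index_pmf \<gamma> A) j = (if j < n then dot d (v j) (v j) / D else 0)" for j
    proof -
      let ?f = "\<lambda>k. if k < dim_row A then ridge_prob \<gamma> A k else 0"
      have nonneg: "0 \<le> ?f k" for k using A Dpos dot_nonneg prob_eq by simp
      have "(\<integral>\<^sup>+ x. ennreal (?f x) \<partial>count_space UNIV) = (\<Sum>x<n. ennreal (?f x))"
        using A by (intro nn_integral_count_space') auto
      also have "\<dots> = ennreal (\<Sum>x<n. ?f x)"
        by (intro sum_ennreal nonneg)
      also have "(\<Sum>x<n. ?f x) = 1"
        using A Dpos by (simp add: prob_eq sum_divide_distrib[symmetric] flip: D)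
      finally show ?thesis
        unfolding ridge_index_pmf_def using A nonneg by (subst pmf_embed_pmf) (auto simp: prob_eq)
    qed
    define Q where "Q = Pi_pmf {..<s} 0 (\<lambda>_. ridge_index_pmf \<gamma> A)"
    define G where "G = {f. \<forall>u. \<bar>(\<Sum>c<s. D / (real s * dot d (v (f c)) (v (f c))) * (dot d (v (f c)) u)\<^sup>2)
          - (\<Sum>j<n. (dot d (v j) u)\<^sup>2)\<bar> \<le> \<epsilon> / 2 * dot d u u}"
    have "1 - \<delta> \<le> measure_pmf.prob Q G"
      unfolding Q_def G_def
    proof (rule leverage_sampling_concentration[OF d _ D Dpos pmf_eq \<epsilon> \<delta>])
      fix u :: "nat \<Rightarrow> real"
      define w where "w = vec d u"
      have w: "w \<in> carrier_vec d" by (simp add: w_def)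
      have uw: "dot d u' u = dot d u' (vec_index w)" for u' by (simp add: dot_def w_def)
      have Tw: "T *\<^sub>v w \<in> carrier_vec d" using T w by auto
      have "(\<Sum>j<n. (dot d (v j) u)\<^sup>2) = (\<Sum>j<n. (scalar_prod (row A j) (T *\<^sub>v w))\<^sup>2)"
        unfolding uw using vdot[OF w] by simp
      also have "\<dots> \<le> scalar_prod (T *\<^sub>v w) (K *\<^sub>v (T *\<^sub>v w))"
        unfolding Kform[OF Tw] using \<gamma> by (simp add: scalar_prod_self_nonneg)
      also have "\<dots> = dot d u u" unfolding wdot[OF w, symmetric] by (simp add: dot_def w_def)
      finally show "(\<Sum>j<n. (dot d (v j) u)\<^sup>2) \<le> dot d u u" .
    qed (use s in \<open>simp add: D_def\<close>)
    also have "measure_pmf.prob Q G \<le> measure_pmf.prob Q (sampling_mat \<gamma> A s -` ?good)"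
    proof (rule measure_pmf.finite_measure_mono_AE)
      \<comment> \<open>The inclusion holds only almost surely: a column whose index is not below
        \<open>n\<close> would be zero, so the indices must be taken from the support of the
        law.\<close>
      show "AE k in measure_pmf Q. k \<in> G \<longrightarrow> k \<in> sampling_mat \<gamma> A s -` ?good"
      proof (rule AE_pmfI, rule impI)
        fix k assume kQ: "k \<in> set_pmf Q" and kG: "k \<in> G"
        have k: "k c < n" if "c < s" for c
        proof -
          have "k c \<in> set_pmf (ridge_index_pmf \<gamma> A)"
            using kQ that set_Pi_pmf_subset'[of "{..<s}" 0 "\<lambda>_. ridge_index_pmf \<gamma> A"]
            by (auto simp: Q_def PiE_dflt_def)
          then have "pmf (ridge_index_pmf \<gamma> A) (k c) \<noteq> 0" by (simp add: set_pmf_iff)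
          then show ?thesis by (simp add: pmf_eq split: if_splits)
        qed
        have p: "0 \<le> ridge_prob \<gamma> A j" if "j < n" for j
          using Dpos dot_nonneg that by (simp add: prob_eq)
        have U: "sampling_mat \<gamma> A s k \<in> carrier_mat n s" using A by simp
        have "\<bar>scalar_prod y (sketched_hess \<gamma> A (sampling_mat \<gamma> A s k) *\<^sub>v y)
            - scalar_prod y (exact_hess \<gamma> A *\<^sub>v y)\<bar> \<le> \<epsilon> / 2 * scalar_prod y (exact_hess \<gamma> A *\<^sub>v y)"
          if y: "y \<in> carrier_vec d" for y
        proof -
          obtain w where w: "w \<in> carrier_vec d" "T *\<^sub>v w = y" using preimage[OF y] by blast
          let ?N = "(norm2 (transpose_mat (sampling_mat \<gamma> A s k) *\<^sub>v (A *\<^sub>v y)))\<^sup>2"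
          have N: "?N = (\<Sum>c<s. D / (real s * dot d (v (k c)) (v (k c))) * (dot d (v (k c)) (vec_index w))\<^sup>2)"
            using sampled[OF w(1) k p] w(2) by simp
          have Ay: "scalar_prod (A *\<^sub>v y) (A *\<^sub>v y) = (\<Sum>j<n. (dot d (v j) (vec_index w))\<^sup>2)"
            using norm2_square_mult_mat_vec[OF A, of y] vdot[OF w(1)] w(2) by (simp add: norm2_square)
          have "\<bar>?N - scalar_prod (A *\<^sub>v y) (A *\<^sub>v y)\<bar> \<le> \<epsilon> / 2 * scalar_prod y (K *\<^sub>v y)"
            using kG[unfolded G_def mem_Collect_eq, THEN spec, of "vec_index w"]
            unfolding N Ay wdot[OF w(1)] w(2) .
          then have "1 / real n * \<bar>?N - scalar_prod (A *\<^sub>v y) (A *\<^sub>v y)\<bar>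
              \<le> 1 / real n * (\<epsilon> / 2 * scalar_prod y (K *\<^sub>v y))"
            by (intro mult_left_mono) auto
          moreover have "scalar_prod y (K *\<^sub>v y) = real n * scalar_prod y (exact_hess \<gamma> A *\<^sub>v y)"
            unfolding K(3)[OF y y] exact_hess(3)[OF A y y] using n by (simp add: field_simps)
          moreover have "scalar_prod y (sketched_hess \<gamma> A (sampling_mat \<gamma> A s k) *\<^sub>v y)
            - scalar_prod y (exact_hess \<gamma> A *\<^sub>v y) = 1 / real n * (?N - scalar_prod (A *\<^sub>v y) (A *\<^sub>v y))"
            unfolding sketched_hess(3)[OF A U y] exact_hess(3)[OF A y y]
            by (simp add: algebra_simps)
          ultimately show ?thesis using n by (simp add: abs_mult)
        qed
        then show "k \<in> sampling_mat \<gamma> A s -` ?good" using U by simp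
      qed
    qed simp
    finally show ?thesis by (simp add: ridge_sampling_pmf_def measure_map_pmf Q_def)
  qed
qed

section \<open>The Newton step\<close>

text \<open>Tangent lines below the graph make the first derivative nondecreasing, whereas a
  negative second derivative would make it drop immediately to the right of
  \<open>u\<close>.\<close>

lemma convex_deriv_deriv_nonneg:
  fixes f :: "real \<Rightarrow> real"
  assumes f: "convex_on UNIV f" and d1: "\<And>u. f differentiable (at u)"
    and d2: "deriv f differentiable (at u)"
  shows "0 \<le> deriv (deriv f) u"
proof (rule ccontr)
  have D1: "DERIV f u :> deriv f u" for u
    using d1 by (simp add: DERIV_deriv_iff_real_differentiable)
  have tangent: "deriv f c * (y - c) \<le> f y - f c" for y c
    using f D1[of c] by (intro convex_on_imp_above_tangent[of UNIV]) auto
  have mono: "deriv f a \<le> deriv f b" if "a < b" for a b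
  proof -
    have "deriv f a * (b - a) \<le> deriv f b * (b - a)"
      using tangent[of a b] tangent[of b a] by (simp add: algebra_simps)
    then show ?thesis using that by simp
  qed
  assume "\<not> 0 \<le> deriv (deriv f) u"
  moreover have "DERIV (deriv f) u :> deriv (deriv f) u"
    using d2 by (simp add: DERIV_deriv_iff_real_differentiable)
  ultimately obtain e where e: "0 < e" "\<And>h. 0 < h \<Longrightarrow> h < e \<Longrightarrow> deriv f (u + h) < deriv f u"
    using DERIV_neg_dec_right[of "deriv f"] by (meson not_le)
  then have "deriv f (u + e / 2) < deriv f u" by (intro e(2)) auto
  then show False using mono[of u "u + e / 2"] e(1) by simp
qed

locale ridge_glm =
  fixes n d :: nat and x :: "nat \<Rightarrow> real vec" and l :: "nat \<Rightarrow> real \<Rightarrow> real" and \<gamma> :: real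
  assumes n: "0 < n" and d: "0 < d" and x: "\<And>j. j < n \<Longrightarrow> x j \<in> carrier_vec d" and \<gamma>: "0 < \<gamma>"
    and convex: "\<And>j. j < n \<Longrightarrow> convex_on UNIV (l j)"
    and diff1: "\<And>j u. j < n \<Longrightarrow> l j differentiable (at u)"
    and diff2: "\<And>j u. j < n \<Longrightarrow> deriv (l j) differentiable (at u)"
begin

section \<open>Gradient and Hessian of the regularized objective\<close>

definition gradient :: "real vec \<Rightarrow> real vec" where
  "gradient w = vec d (\<lambda>i.
    1 / real n * (\<Sum>j<n. deriv (l j) (scalar_prod (x j) w) * vec_index (x j) i) + \<gamma> * vec_index w i)"

definition Hessian :: "real vec \<Rightarrow> real mat" where
  "Hessian w = exact_hess \<gamma> (scaled_data n x l w)"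

lemma gradient_carrier [simp]: "gradient w \<in> carrier_vec d"
  by (simp add: gradient_def)

lemma dim_gradient [simp]: "dim_vec (gradient w) = d"
  by (simp add: gradient_def)

lemma scaled_data_carrier [simp]: "w \<in> carrier_vec d \<Longrightarrow> scaled_data n x l w \<in> carrier_mat n d"
  by (auto simp: scaled_data_def mat_of_rows_def)

lemma row_scaled_data:
  "w \<in> carrier_vec d \<Longrightarrow> j < n \<Longrightarrow>
    row (scaled_data n x l w) j = sqrt (deriv (deriv (l j)) (scalar_prod (x j) w)) \<cdot>\<^sub>v x j"
  unfolding scaled_data_def using x by (subst mat_of_rows_row) auto

lemma scalar_prod_gradient:
  assumes u: "u \<in> carrier_vec d" and w: "w \<in> carrier_vec d"
  shows "scalar_prod u (gradient w) =
    1 / real n * (\<Sum>j<n. deriv (l j) (scalar_prod (x j) w) * scalar_prod (x j) u) + \<gamma> * scalar_prod u w"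
proof -
  have xu: "scalar_prod (x j) u = (\<Sum>i<d. vec_index (x j) i * vec_index u i)" for j
    by (simp only: scalar_prod_eq_dot[OF u] dot_def)
  have uw: "scalar_prod u w = (\<Sum>i<d. vec_index u i * vec_index w i)"
    by (simp only: scalar_prod_eq_dot[OF w] dot_def)
  define a where "a j = deriv (l j) (scalar_prod (x j) w)" for j
  have "scalar_prod u (gradient w) = (\<Sum>i<d. vec_index u i *
      (1 / real n * (\<Sum>j<n. a j * vec_index (x j) i) + \<gamma> * vec_index w i))"
    unfolding scalar_prod_eq_dot[OF gradient_carrier] dot_def by (simp add: gradient_def a_def)
  also have "\<dots> = (\<Sum>i<d. \<Sum>j<n. 1 / real n * (a j * (vec_index (x j) i * vec_index u i)))
      + (\<Sum>i<d. \<gamma> * (vec_index u i * vec_index w i))"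
    by (simp add: distrib_left sum.distrib sum_distrib_left mult_ac)
  also have "(\<Sum>i<d. \<Sum>j<n. 1 / real n * (a j * (vec_index (x j) i * vec_index u i)))
      = (\<Sum>j<n. \<Sum>i<d. 1 / real n * (a j * (vec_index (x j) i * vec_index u i)))"
    by (rule sum.swap)
  finally show ?thesis
    by (simp only: xu uw a_def sum_distrib_left)
qed

lemma Hessian_carrier [simp]: "w \<in> carrier_vec d \<Longrightarrow> Hessian w \<in> carrier_mat d d"
  unfolding Hessian_def by (rule exact_hess(1)[OF scaled_data_carrier])

lemma Hessian_symmetric: "w \<in> carrier_vec d \<Longrightarrow> transpose_mat (Hessian w) = Hessian w"
  unfolding Hessian_def by (rule exact_hess(2)[OF scaled_data_carrier])

lemma scalar_prod_Hessian:
  assumes u: "u \<in> carrier_vec d" and h: "h \<in> carrier_vec d" and w: "w \<in> carrier_vec d"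
  shows "scalar_prod u (Hessian w *\<^sub>v h) = 1 / real n * (\<Sum>j<n. deriv (deriv (l j)) (scalar_prod (x j) w)
    * scalar_prod (x j) h * scalar_prod (x j) u) + \<gamma> * scalar_prod u h"
proof -
  let ?A = "scaled_data n x l w"
  have A: "?A \<in> carrier_mat n d" using w by simp
  have Ah: "?A *\<^sub>v h \<in> carrier_vec n" using A h by (rule mult_mat_vec_carrier)
  have ind: "vec_index (?A *\<^sub>v y) j = sqrt (deriv (deriv (l j)) (scalar_prod (x j) w)) * scalar_prod (x j) y"
    if y: "y \<in> carrier_vec d" and j: "j < n" for y j
  proof -
    have "vec_index (?A *\<^sub>v y) j = scalar_prod (row ?A j) y" using carrier_matD[OF A] j by simp
    then show ?thesis
      unfolding row_scaled_data[OF w j] smult_scalar_prod_distrib[OF x[OF j] y] .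
  qed
  have "scalar_prod (?A *\<^sub>v u) (?A *\<^sub>v h) = (\<Sum>j<n. vec_index (?A *\<^sub>v u) j * vec_index (?A *\<^sub>v h) j)"
    by (simp only: scalar_prod_eq_dot[OF Ah] dot_def)
  also have "\<dots> = (\<Sum>j<n. deriv (deriv (l j)) (scalar_prod (x j) w) * scalar_prod (x j) h * scalar_prod (x j) u)"
  proof (rule sum.cong[OF refl])
    fix j assume "j \<in> {..<n}"
    then have j: "j < n" by simp
    \<comment> \<open>Convexity is what makes the squares of the row weights recover the second
      derivatives.\<close>
    have "0 \<le> deriv (deriv (l j)) (scalar_prod (x j) w)"
      using convex diff1 diff2 j by (intro convex_deriv_deriv_nonneg) auto
    then have "sqrt (deriv (deriv (l j)) (scalar_prod (x j) w)) * sqrt (deriv (deriv (l j)) (scalar_prod (x j) w))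
        = deriv (deriv (l j)) (scalar_prod (x j) w)" by simp
    then show "vec_index (?A *\<^sub>v u) j * vec_index (?A *\<^sub>v h) j
        = deriv (deriv (l j)) (scalar_prod (x j) w) * scalar_prod (x j) h * scalar_prod (x j) u"
      unfolding ind[OF u j] ind[OF h j] by (metis mult.assoc mult.commute)
  qed
  finally show ?thesis
    unfolding Hessian_def exact_hess(3)[OF A u h] by simp
qed

lemma scalar_prod_line:
  fixes w h y :: "real vec"
  assumes "w \<in> carrier_vec d" "h \<in> carrier_vec d" "y \<in> carrier_vec d"
  shows "scalar_prod y (w + t \<cdot>\<^sub>v h) = scalar_prod y w + t * scalar_prod y h"
  using assms scalar_prod_add_distrib[of y d w "t \<cdot>\<^sub>v h"] scalar_prod_smult_distrib[of y d h t] by simp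

text \<open>All calculus happens along lines, as derivatives in one real variable. There each loss
  is composed with an affine function of \<open>t\<close>, and the regularizer is a quadratic
  polynomial in \<open>t\<close>.\<close>

lemma DERIV_objective:
  assumes w: "w \<in> carrier_vec d" and h: "h \<in> carrier_vec d"
  shows "DERIV (\<lambda>t. objective n x l \<gamma> (w + t \<cdot>\<^sub>v h)) t :> scalar_prod h (gradient (w + t \<cdot>\<^sub>v h))"
proof -
  have wt: "w + t \<cdot>\<^sub>v h \<in> carrier_vec d" for t using w h by simp
  define a b where "a j = scalar_prod (x j) w" and "b j = scalar_prod (x j) h" for j
  define p q r where "p = scalar_prod w w" and "q = scalar_prod h w" and "r = scalar_prod h h"
  have line: "scalar_prod (x j) (w + t \<cdot>\<^sub>v h) = a j + t * b j" if "j < n" for j t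
    unfolding a_def b_def by (rule scalar_prod_line[OF w h x[OF that]])
  have wh: "scalar_prod w h = q" unfolding q_def by (rule comm_scalar_prod[OF w h])
  have sq: "(norm2 (w + t \<cdot>\<^sub>v h))\<^sup>2 = p + 2 * t * q + t\<^sup>2 * r" for t
  proof -
    have "(norm2 (w + t \<cdot>\<^sub>v h))\<^sup>2 = scalar_prod (w + t \<cdot>\<^sub>v h) w + t * scalar_prod (w + t \<cdot>\<^sub>v h) h"
      unfolding norm2_square by (rule scalar_prod_line[OF w h wt])
    also have "scalar_prod (w + t \<cdot>\<^sub>v h) w = scalar_prod w (w + t \<cdot>\<^sub>v h)"
      by (rule comm_scalar_prod[OF wt w])
    also have "scalar_prod (w + t \<cdot>\<^sub>v h) h = scalar_prod h (w + t \<cdot>\<^sub>v h)"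
      by (rule comm_scalar_prod[OF wt h])
    finally show ?thesis
      unfolding scalar_prod_line[OF w h w] scalar_prod_line[OF w h h] wh
      by (simp add: p_def q_def r_def power2_eq_square algebra_simps)
  qed
  have "objective n x l \<gamma> (w + t \<cdot>\<^sub>v h)
      = 1 / real n * (\<Sum>j<n. l j (a j + t * b j)) + \<gamma> / 2 * (p + 2 * t * q + t\<^sup>2 * r)" for t
    unfolding objective_def sq using line by simp
  moreover have "DERIV (\<lambda>t. 1 / real n * (\<Sum>j<n. l j (a j + t * b j)) + \<gamma> / 2 * (p + 2 * t * q + t\<^sup>2 * r)) t
      :> 1 / real n * (\<Sum>j<n. deriv (l j) (a j + t * b j) * b j) + \<gamma> * (q + t * r)"
  proof -
    have "DERIV (\<lambda>t. l j (a j + t * b j)) t :> deriv (l j) (a j + t * b j) * b j" if "j < n" for j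
      by (rule DERIV_chain2[where f = "l j"])
        (use diff1[OF that] in \<open>auto simp: DERIV_deriv_iff_real_differentiable intro!: derivative_eq_intros\<close>)
    then have S: "DERIV (\<lambda>t. \<Sum>j<n. l j (a j + t * b j)) t :> (\<Sum>j<n. deriv (l j) (a j + t * b j) * b j)"
      by (intro DERIV_sum) auto
    have "DERIV (\<lambda>t. \<gamma> / 2 * (p + 2 * t * q + t\<^sup>2 * r)) t :> \<gamma> * (q + t * r)"
      by (auto intro!: derivative_eq_intros simp: algebra_simps)
    from DERIV_add[OF DERIV_cmult[OF S] this] show ?thesis .
  qed
  moreover have "scalar_prod h (gradient (w + t \<cdot>\<^sub>v h))
      = 1 / real n * (\<Sum>j<n. deriv (l j) (a j + t * b j) * b j) + \<gamma> * (q + t * r)"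
    unfolding scalar_prod_gradient[OF h wt] scalar_prod_line[OF w h h]
    using line by (simp add: b_def q_def r_def)
  ultimately show ?thesis by simp
qed

lemma DERIV_gradient:
  assumes w: "w \<in> carrier_vec d" and h: "h \<in> carrier_vec d" and u: "u \<in> carrier_vec d"
  shows "DERIV (\<lambda>t. scalar_prod u (gradient (w + t \<cdot>\<^sub>v h))) t
    :> scalar_prod u (Hessian (w + t \<cdot>\<^sub>v h) *\<^sub>v h)"
proof -
  have wt: "w + t \<cdot>\<^sub>v h \<in> carrier_vec d" for t using w h by simp
  define a b where "a j = scalar_prod (x j) w" and "b j = scalar_prod (x j) h" for j
  define c where "c j = scalar_prod (x j) u" for j
  define q r where "q = scalar_prod u w" and "r = scalar_prod u h"
  have line: "scalar_prod (x j) (w + t \<cdot>\<^sub>v h) = a j + t * b j" if "j < n" for j t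
    unfolding a_def b_def by (rule scalar_prod_line[OF w h x[OF that]])
  have "scalar_prod u (gradient (w + t \<cdot>\<^sub>v h))
      = 1 / real n * (\<Sum>j<n. deriv (l j) (a j + t * b j) * c j) + \<gamma> * (q + t * r)" for t
    unfolding scalar_prod_gradient[OF u wt] scalar_prod_line[OF w h u]
    using line by (simp add: c_def q_def r_def)
  moreover have "DERIV (\<lambda>t. 1 / real n * (\<Sum>j<n. deriv (l j) (a j + t * b j) * c j) + \<gamma> * (q + t * r)) t
      :> 1 / real n * (\<Sum>j<n. deriv (deriv (l j)) (a j + t * b j) * b j * c j) + \<gamma> * r"
  proof -
    have "DERIV (\<lambda>t. deriv (l j) (a j + t * b j)) t :> deriv (deriv (l j)) (a j + t * b j) * b j"
      if "j < n" for j
      by (rule DERIV_chain2[where f = "deriv (l j)"])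
        (use diff2[OF that] in \<open>auto simp: DERIV_deriv_iff_real_differentiable intro!: derivative_eq_intros\<close>)
    then have S: "DERIV (\<lambda>t. \<Sum>j<n. deriv (l j) (a j + t * b j) * c j) t
        :> (\<Sum>j<n. deriv (deriv (l j)) (a j + t * b j) * b j * c j)"
      by (intro DERIV_sum DERIV_cmult_right) auto
    have "DERIV (\<lambda>t. \<gamma> * (q + t * r)) t :> \<gamma> * r"
      by (auto intro!: derivative_eq_intros)
    from DERIV_add[OF DERIV_cmult[OF S] this] show ?thesis .
  qed
  moreover have "scalar_prod u (Hessian (w + t \<cdot>\<^sub>v h) *\<^sub>v h)
      = 1 / real n * (\<Sum>j<n. deriv (deriv (l j)) (a j + t * b j) * b j * c j) + \<gamma> * r"
    unfolding scalar_prod_Hessian[OF u h wt] using line by (simp add: b_def c_def r_def)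
  ultimately show ?thesis by simp
qed

lemma add_zero_smult [simp]:
  "w \<in> carrier_vec d \<Longrightarrow> h \<in> carrier_vec d \<Longrightarrow> w + 0 \<cdot>\<^sub>v h = (w :: real vec)"
  by auto

lemma grad_eq_gradient:
  assumes w: "w \<in> carrier_vec d"
  shows "grad (objective n x l \<gamma>) w = gradient w"
proof (rule eq_vecI)
  fix i assume "i < dim_vec (gradient w)"
  then have i: "i < d" by simp
  have e: "unit_vec d i \<in> carrier_vec d" by simp
  have "deriv (\<lambda>t. objective n x l \<gamma> (w + t \<cdot>\<^sub>v unit_vec d i)) 0 = scalar_prod (unit_vec d i) (gradient w)"
    using DERIV_imp_deriv[OF DERIV_objective[OF w e, of 0]] w by simp
  also have "\<dots> = vec_index (gradient w) i"
    using i by (intro scalar_prod_left_unit) auto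
  finally show "vec_index (grad (objective n x l \<gamma>) w) i = vec_index (gradient w) i"
    using i w by (simp add: grad_def)
qed (use w in \<open>simp add: grad_def\<close>)

lemma hess_eq_Hessian:
  assumes w: "w \<in> carrier_vec d"
  shows "hess (objective n x l \<gamma>) w = Hessian w"
proof (rule eq_matI)
  fix i j assume "i < dim_row (Hessian w)" "j < dim_col (Hessian w)"
  then have ij: "i < d" "j < d" using Hessian_carrier[OF w] by auto
  have e: "unit_vec d i \<in> carrier_vec d" "unit_vec d j \<in> carrier_vec d" by simp_all
  have wt: "w + t \<cdot>\<^sub>v unit_vec d j \<in> carrier_vec d" for t using w by simp
  have "vec_index (grad (objective n x l \<gamma>) (w + t \<cdot>\<^sub>v unit_vec d j)) i
      = scalar_prod (unit_vec d i) (gradient (w + t \<cdot>\<^sub>v unit_vec d j))" for t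
    unfolding grad_eq_gradient[OF wt] using ij by (intro scalar_prod_left_unit[symmetric]) auto
  then have "deriv (\<lambda>t. vec_index (grad (objective n x l \<gamma>) (w + t \<cdot>\<^sub>v unit_vec d j)) i) 0
      = scalar_prod (unit_vec d i) (Hessian w *\<^sub>v unit_vec d j)"
    using DERIV_imp_deriv[OF DERIV_gradient[OF w e(2,1), of 0]] w by simp
  also have "\<dots> = vec_index (Hessian w *\<^sub>v unit_vec d j) i"
    using ij Hessian_carrier[OF w] by (intro scalar_prod_left_unit) auto
  also have "\<dots> = Hessian w $$ (i, j)"
    using ij Hessian_carrier[OF w] by simp
  finally show "hess (objective n x l \<gamma>) w $$ (i, j) = Hessian w $$ (i, j)"
    using ij w by (simp add: hess_def)
qed (use w carrier_matD[OF Hessian_carrier[OF w]] in \<open>simp_all add: hess_def\<close>)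

lemma gradient_minimizer:
  assumes "unique_minimizer d (objective n x l \<gamma>) w"
  shows "gradient w = 0\<^sub>v d"
proof (rule eq_vecI)
  have w: "w \<in> carrier_vec d" using assms by (simp add: unique_minimizer_def)
  have min: "objective n x l \<gamma> w \<le> objective n x l \<gamma> y" if "y \<in> carrier_vec d" for y
    using assms that by (cases "y = w") (auto simp: unique_minimizer_def less_imp_le)
  fix i assume "i < dim_vec (0\<^sub>v d :: real vec)"
  then have i: "i < d" by simp
  have e: "unit_vec d i \<in> carrier_vec d" by simp
  have "DERIV (\<lambda>t. objective n x l \<gamma> (w + t \<cdot>\<^sub>v unit_vec d i)) 0 :> vec_index (gradient w) i"
    using DERIV_objective[OF w e, of 0] w i scalar_prod_left_unit[OF gradient_carrier i] by simp
  then have "vec_index (gradient w) i = 0"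
    by (rule DERIV_local_min[of _ _ _ 1]) (use w min in auto)
  then show "vec_index (gradient w) i = vec_index (0\<^sub>v d) i" using i by simp
qed simp

text \<open>First-order Taylor estimate for the gradient. Pairing with the remainder
  \<open>r\<close> itself reduces it to a function of one variable. The hypothesis is bilinear so
  that quadratic losses can use it directly with L = 0, and a spectral norm bound after
  Cauchy--Schwarz.\<close>

lemma gradient_remainder_le:
  assumes w: "w \<in> carrier_vec d" and h: "h \<in> carrier_vec d" and L: "0 \<le> L"
    and lip: "\<And>w' u. w' \<in> carrier_vec d \<Longrightarrow> u \<in> carrier_vec d \<Longrightarrow>
      \<bar>scalar_prod u (Hessian w' *\<^sub>v h) - scalar_prod u (Hessian w *\<^sub>v h)\<bar> \<le> L * norm2 (w' - w) * norm2 u * norm2 h"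
  shows "norm2 (gradient (w + h) - gradient w - Hessian w *\<^sub>v h) \<le> L / 2 * (norm2 h)\<^sup>2"
proof -
  have Hh: "Hessian w *\<^sub>v h \<in> carrier_vec d" using Hessian_carrier[OF w] h by (rule mult_mat_vec_carrier)
  define r where "r = gradient (w + h) - gradient w - Hessian w *\<^sub>v h"
  have r: "r \<in> carrier_vec d" using Hh by (simp add: r_def)
  define c where "c = scalar_prod r (Hessian w *\<^sub>v h)"
  define k where "k = L * norm2 r * (norm2 h)\<^sup>2"
  \<comment> \<open>The derivative of the first two terms is at most \<open>k * t\<close> on [0, 1].
    Subtracting the antiderivative of that bound makes \<phi> nonincreasing and yields the factor
    1/2 without an integral.\<close>
  define \<phi> where "\<phi> t = scalar_prod r (gradient (w + t \<cdot>\<^sub>v h)) - t * c - k * t\<^sup>2 / 2" for t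
  have "\<phi> 1 \<le> \<phi> 0"
  proof (rule DERIV_nonpos_imp_nonincreasing[of 0 1 \<phi>])
    fix t :: real assume t: "0 \<le> t" "t \<le> 1"
    have wt: "w + t \<cdot>\<^sub>v h \<in> carrier_vec d" using w h by simp
    have "DERIV \<phi> t :> scalar_prod r (Hessian (w + t \<cdot>\<^sub>v h) *\<^sub>v h) - c - k * t"
      unfolding \<phi>_def by (auto intro!: derivative_eq_intros DERIV_gradient w h r)
    moreover have "scalar_prod r (Hessian (w + t \<cdot>\<^sub>v h) *\<^sub>v h) - c - k * t \<le> 0"
    proof -
      have "w + t \<cdot>\<^sub>v h - w = t \<cdot>\<^sub>v h" using w h by auto
      then have "norm2 (w + t \<cdot>\<^sub>v h - w) = t * norm2 h" using t by (simp add: norm2_smult)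
      then have "\<bar>scalar_prod r (Hessian (w + t \<cdot>\<^sub>v h) *\<^sub>v h) - c\<bar> \<le> k * t"
        using lip[OF wt r] by (simp add: c_def k_def power2_eq_square mult_ac)
      then show ?thesis by linarith
    qed
    ultimately show "\<exists>y. DERIV \<phi> t :> y \<and> y \<le> 0" by blast
  qed simp
  then have "scalar_prod r (gradient (w + h)) - scalar_prod r (gradient w) - c \<le> k / 2"
    using w h by (simp add: \<phi>_def)
  moreover have "scalar_prod r r = scalar_prod r (gradient (w + h)) - scalar_prod r (gradient w) - c"
    using r Hh gradient_carrier unfolding c_def
    by (subst (2) r_def) (simp add: scalar_prod_minus_distrib[of _ d])
  ultimately have "norm2 r * norm2 r \<le> norm2 r * (L / 2 * (norm2 h)\<^sup>2)"
    using norm2_square[of r] by (simp add: k_def power2_eq_square mult_ac)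
  then have "norm2 r \<le> L / 2 * (norm2 h)\<^sup>2"
    using L norm2_nonneg[of r] by (cases "norm2 r = 0") (auto simp: mult_le_cancel_left)
  then show ?thesis by (simp add: r_def)
qed

section \<open>Passage between the Hessian norm and the Euclidean norm\<close>

lemma Hessian_posdef:
  "w \<in> carrier_vec d \<Longrightarrow> y \<in> carrier_vec d \<Longrightarrow> y \<noteq> 0\<^sub>v d \<Longrightarrow> 0 < scalar_prod y (Hessian w *\<^sub>v y)"
  unfolding Hessian_def by (rule exact_hess_posdef[OF scaled_data_carrier \<gamma>])

lemma Hessian_psd:
  "w \<in> carrier_vec d \<Longrightarrow> y \<in> carrier_vec d \<Longrightarrow> 0 \<le> scalar_prod y (Hessian w *\<^sub>v y)"
  using Hessian_posdef[of w y] mult_mat_vec_carrier[OF Hessian_carrier, of w "0\<^sub>v d"]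
  by (cases "y = 0\<^sub>v d") (auto simp: less_imp_le)

lemma
  assumes w: "w \<in> carrier_vec d"
  shows Hessian_sigma_min_pos: "0 < sigma_min (Hessian w)"
    and Hessian_sigma_min_le: "\<And>y. y \<in> carrier_vec d \<Longrightarrow>
      sigma_min (Hessian w) * scalar_prod y y \<le> scalar_prod y (Hessian w *\<^sub>v y)"
    and Hessian_sigma_max_ge: "\<And>y. y \<in> carrier_vec d \<Longrightarrow>
      scalar_prod y (Hessian w *\<^sub>v y) \<le> sigma_max (Hessian w) * scalar_prod y y"
  using sigma_bounds[OF d Hessian_carrier[OF w] Hessian_symmetric[OF w] Hessian_posdef[OF w]] by auto

text \<open>Leaving the H-norm costs the square root of the condition number. It is applied once,
  after all iterations, so this factor is not raised to the power t.\<close>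

lemma norm2_le_of_Hessian_form_le:
  assumes w: "w \<in> carrier_vec d" and g: "g \<in> carrier_vec d" and e: "e \<in> carrier_vec d" and k: "0 \<le> k"
    and le: "scalar_prod g (Hessian w *\<^sub>v g) \<le> k\<^sup>2 * scalar_prod e (Hessian w *\<^sub>v e)"
  shows "norm2 g \<le> k * sqrt (cond_num (Hessian w)) * norm2 e"
proof -
  let ?m = "sigma_min (Hessian w)" and ?M = "sigma_max (Hessian w)"
  have m: "0 < ?m" by (rule Hessian_sigma_min_pos[OF w]) 
  have "?m * 1 \<le> ?M * 1"
    using Hessian_sigma_min_le[OF w, of "unit_vec d 0"] Hessian_sigma_max_ge[OF w, of "unit_vec d 0"] d
    by simp
  then have M: "0 < ?M" using m by simp
  have "?m * (norm2 g)\<^sup>2 \<le> k\<^sup>2 * (?M * (norm2 e)\<^sup>2)"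
    unfolding norm2_square
    using Hessian_sigma_min_le[OF w g] le
      mult_left_mono[OF Hessian_sigma_max_ge[OF w e], of "k\<^sup>2"] by simp
  then have "(norm2 g)\<^sup>2 \<le> k\<^sup>2 * (?M / ?m) * (norm2 e)\<^sup>2"
    using m by (simp add: field_simps)
  also have "\<dots> = (k * sqrt (cond_num (Hessian w)) * norm2 e)\<^sup>2"
    using m M by (simp add: cond_num_def power_mult_distrib)
  finally show ?thesis
    by (rule power2_le_imp_le) (use k m M in \<open>simp add: cond_num_def\<close>)
qed

text \<open>The event on which the remaining argument is deterministic. It involves the iterate only
  through \<open>A\<close>.\<close>

definition good_sketch :: "nat \<Rightarrow> real \<Rightarrow> real mat \<Rightarrow> real mat \<Rightarrow> bool" where
  "good_sketch s \<epsilon> A U \<longleftrightarrow> U \<in> carrier_mat n s \<and> (\<forall>y \<in> carrier_vec d.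
      \<bar>scalar_prod y (sketched_hess \<gamma> A U *\<^sub>v y) - scalar_prod y (exact_hess \<gamma> A *\<^sub>v y)\<bar>
        \<le> \<epsilon> / 2 * scalar_prod y (exact_hess \<gamma> A *\<^sub>v y))"

text \<open>With e = w - v and K the sketched Hessian, the new error splits as g + p, where g = e -
  K^(-1) H e is the contracted part and p = K^(-1) r carries the Taylor remainder r of the gradient
  at v. The factor 8/7 reflects K >= (7/8) H, which holds since \<epsilon>/2 <= 1/8.\<close>

lemma ssn_step_error:
  assumes w: "w \<in> carrier_vec d" and v: "v \<in> carrier_vec d" "gradient v = 0\<^sub>v d"
    and good: "good_sketch s \<epsilon> (scaled_data n x l w) U" and \<epsilon>: "0 < \<epsilon>" "\<epsilon> < 1 / 4"
  obtains g p where "g \<in> carrier_vec d" "p \<in> carrier_vec d" "ssn_step n x l \<gamma> U w - v = g + p"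
    "ssn_step n x l \<gamma> U w \<in> carrier_vec d"
    "scalar_prod g (Hessian w *\<^sub>v g) \<le> \<epsilon>\<^sup>2 * scalar_prod (w - v) (Hessian w *\<^sub>v (w - v))"
    "sigma_min (Hessian w) * norm2 p \<le> 8 / 7 * norm2 (gradient v - gradient w - Hessian w *\<^sub>v (v - w))"
proof -
  define A H where "A = scaled_data n x l w" and "H = Hessian w"
  define K where "K = sketched_hess \<gamma> A U"
  have A: "A \<in> carrier_mat n d" using w by (simp add: A_def)
  have H: "H \<in> carrier_mat d d" "transpose_mat H = H"
    using Hessian_carrier[OF w] Hessian_symmetric[OF w] by (simp_all add: H_def)
  have U: "U \<in> carrier_mat n s" using good by (simp add: good_sketch_def)
  have K: "K \<in> carrier_mat d d" "transpose_mat K = K"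
    unfolding K_def by (rule sketched_hess(1)[OF A U], rule sketched_hess(2)[OF A U])
  have approx: "\<bar>scalar_prod y (K *\<^sub>v y) - scalar_prod y (H *\<^sub>v y)\<bar> \<le> \<epsilon> / 2 * scalar_prod y (H *\<^sub>v y)"
    if "y \<in> carrier_vec d" for y
    using good that by (simp add: good_sketch_def K_def H_def Hessian_def A_def)
  have lower: "7 / 8 * scalar_prod y (H *\<^sub>v y) \<le> scalar_prod y (K *\<^sub>v y)" if y: "y \<in> carrier_vec d" for y
  proof -
    have "\<epsilon> / 2 * scalar_prod y (H *\<^sub>v y) \<le> scalar_prod y (H *\<^sub>v y) / 8"
      using \<epsilon> Hessian_psd[OF w y] mult_right_mono[of "\<epsilon> / 2" "1 / 8" "scalar_prod y (H *\<^sub>v y)"]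
      by (simp add: H_def)
    then show ?thesis using approx[OF y] by linarith
  qed
  have Kpd: "0 < scalar_prod y (K *\<^sub>v y)" if "y \<in> carrier_vec d" "y \<noteq> 0\<^sub>v d" for y
    using lower[OF that(1)] Hessian_posdef[OF w that] by (simp add: H_def)
  obtain B where B: "mat_inverse K = Some B" "B \<in> carrier_mat d d" "K * B = 1\<^sub>m d" "B * K = 1\<^sub>m d"
    using posdef_mat_inverse[OF K(1) Kpd] by blast
  have KB: "K *\<^sub>v (B *\<^sub>v y) = y" if "y \<in> carrier_vec d" for y
  proof -
    have "K *\<^sub>v (B *\<^sub>v y) = (K * B) *\<^sub>v y"
      by (rule assoc_mult_mat_vec[OF K(1) B(2) that, symmetric])
    then show ?thesis using that by (simp only: B(3) one_mult_mat_vec)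
  qed
  have B_car: "B *\<^sub>v y \<in> carrier_vec d" if "y \<in> carrier_vec d" for y
    using B(2) that by (rule mult_mat_vec_carrier)
  have H_car: "H *\<^sub>v y \<in> carrier_vec d" if "y \<in> carrier_vec d" for y
    using H(1) that by (rule mult_mat_vec_carrier)
  define e where "e = w - v"
  have e: "e \<in> carrier_vec d" using w v by (simp add: e_def)
  define r where "r = gradient v - gradient w - H *\<^sub>v (v - w)"
  have r: "r \<in> carrier_vec d" using H_car[of "v - w"] v w by (simp add: r_def)
  define g where "g = e - B *\<^sub>v (H *\<^sub>v e)"
  define p where "p = B *\<^sub>v r"
  have g: "g \<in> carrier_vec d" using e B_car[OF H_car[OF e]] by (simp add: g_def)
  have p: "p \<in> carrier_vec d" using r B_car by (simp add: p_def)
  \<comment> \<open>Stationarity of \<open>v\<close> removes its gradient from the remainder and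
    leaves an expression for the gradient at \<open>w\<close>.\<close>
  have grad: "gradient w = H *\<^sub>v e - r"
  proof -
    have "v - w = (-1) \<cdot>\<^sub>v e" using v w by (auto simp: e_def)
    then have "H *\<^sub>v (v - w) = (-1) \<cdot>\<^sub>v (H *\<^sub>v e)"
      using mult_mat_vec[OF H(1) e, of "-1"] by simp
    then show ?thesis
      using H_car[OF e] carrier_matD[OF H(1)] unfolding r_def v(2)
      by (intro eq_vecI) auto
  qed
  have step: "ssn_step n x l \<gamma> U w = w - B *\<^sub>v gradient w"
    using B(1) by (simp add: ssn_step_def grad_eq_gradient[OF w] K_def A_def)
  have "B *\<^sub>v gradient w = B *\<^sub>v (H *\<^sub>v e) - p"
    unfolding grad p_def by (rule mult_minus_distrib_mat_vec[OF B(2) H_car[OF e] r])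
  then have "ssn_step n x l \<gamma> U w - v = g + p"
    unfolding step using w v p carrier_matD[OF B(2)] by (intro eq_vecI) (auto simp: g_def e_def)
  moreover have "ssn_step n x l \<gamma> U w \<in> carrier_vec d"
    unfolding step using w B_car[OF gradient_carrier] by simp
  moreover have "scalar_prod g (H *\<^sub>v g) \<le> \<epsilon>\<^sup>2 * scalar_prod e (H *\<^sub>v e)"
  proof (rule newton_contraction[OF H K _ approx \<epsilon> g e])
    show "K *\<^sub>v g = K *\<^sub>v e - H *\<^sub>v e"
      unfolding g_def using mult_minus_distrib_mat_vec[OF K(1) e B_car[OF H_car[OF e]]] KB[OF H_car[OF e]]
      by simp
  qed (use Hessian_psd[OF w] in \<open>auto simp: H_def\<close>)
  moreover have "sigma_min H * norm2 p \<le> 8 / 7 * norm2 r"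
  proof -
    \<comment> \<open>Since K p = r, the form of K at p is the inner product of p with r;
      Cauchy--Schwarz and division by |p| give the bound.\<close>
    have "7 / 8 * (sigma_min H * (norm2 p)\<^sup>2) \<le> 7 / 8 * scalar_prod p (H *\<^sub>v p)"
      unfolding H_def norm2_square by (intro mult_left_mono Hessian_sigma_min_le[OF w p]) simp
    also have "\<dots> \<le> scalar_prod p (K *\<^sub>v p)" by (rule lower[OF p])
    also have "\<dots> = scalar_prod p r" using KB[OF r] by (simp add: p_def)
    also have "\<dots> \<le> norm2 p * norm2 r" using abs_scalar_prod_le[OF p r] by simp
    finally have "norm2 p * (sigma_min H * norm2 p) \<le> norm2 p * (8 / 7 * norm2 r)"
      by (simp add: power2_eq_square mult_ac)
    then show ?thesis
      using norm2_nonneg[of p] norm2_nonneg[of r] by (cases "norm2 p = 0") (auto simp: mult_le_cancel_left)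
  qed
  ultimately show ?thesis
    using that[of g p] g p by (simp add: H_def e_def r_def)
qed

lemma good_sketch_prob:
  assumes w: "w \<in> carrier_vec d" and \<epsilon>: "0 < \<epsilon>" "\<epsilon> < 1 / 4" and \<delta>: "0 < \<delta>"
    and A: "A = scaled_data n x l w"
    and s: "64 * (eff_dim \<gamma> A / \<epsilon>\<^sup>2) * max 1 (ln (eff_dim \<gamma> A / \<delta>)) \<le> real s"
    and P: "\<And>U. good_sketch s \<epsilon> A U \<Longrightarrow> P U"
  shows "1 - \<delta> \<le> measure_pmf.prob (ridge_sampling_pmf \<gamma> A s) {U. P U}"
proof -
  have A_car: "A \<in> carrier_mat n d" using w by (simp add: A)
  have "1 - \<delta> \<le> measure_pmf.prob (ridge_sampling_pmf \<gamma> A s) {U. good_sketch s \<epsilon> A U}"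
    using sketched_hess_approx[OF A_car n d \<gamma> \<epsilon> \<delta> s] by (simp add: good_sketch_def)
  also have "\<dots> \<le> measure_pmf.prob (ridge_sampling_pmf \<gamma> A s) {U. P U}"
    using P by (intro measure_pmf.finite_measure_mono) auto
  finally show ?thesis .
qed

text \<open>The scaled data, and hence H and the condition on the sketch, are the same at every
  iterate. One good sketch therefore contracts each step in one fixed norm.\<close>

lemma ssn_quadratic:
  assumes v: "v \<in> carrier_vec d" "gradient v = 0\<^sub>v d"
    and quad: "\<And>j. j < n \<Longrightarrow> \<exists>a b c. \<forall>u. l j u = a * u\<^sup>2 + b * u + c"
    and w: "w \<in> carrier_vec d" and \<epsilon>: "0 < \<epsilon>" "\<epsilon> < 1 / 4"
    and good: "good_sketch s \<epsilon> (scaled_data n x l w) U"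
  shows "norm2 ((ssn_step n x l \<gamma> U ^^ t) w - v) \<le> \<epsilon> ^ t * sqrt (cond_num (Hessian w)) * norm2 (w - v)"
proof -
  have const: "deriv (deriv (l j)) u = deriv (deriv (l j)) 0" if "j < n" for j u
  proof -
    obtain a b c where "\<forall>u. l j u = a * u\<^sup>2 + b * u + c" using quad[OF \<open>j < n\<close>] by blast
    then have lj: "l j = (\<lambda>u. a * u\<^sup>2 + b * u + c)" by blast
    have "deriv (l j) = (\<lambda>u. 2 * a * u + b)"
    proof
      fix u
      have "DERIV (\<lambda>u. a * u\<^sup>2 + b * u + c) u :> 2 * a * u + b"
        by (auto intro!: derivative_eq_intros)
      then show "deriv (l j) u = 2 * a * u + b"
        unfolding lj by (rule DERIV_imp_deriv)
    qed
    moreover have "DERIV (\<lambda>u. 2 * a * u + b) u :> 2 * a" for u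
      by (auto intro!: derivative_eq_intros)
    ultimately show ?thesis by (simp add: DERIV_imp_deriv)
  qed
  have same: "scaled_data n x l y = scaled_data n x l w" if y: "y \<in> carrier_vec d" for y
  proof -
    have "map (\<lambda>j. sqrt (deriv (deriv (l j)) (scalar_prod (x j) y)) \<cdot>\<^sub>v x j) [0..<n]
        = map (\<lambda>j. sqrt (deriv (deriv (l j)) (scalar_prod (x j) w)) \<cdot>\<^sub>v x j) [0..<n]"
      using const by (intro map_cong refl) (metis atLeastLessThan_iff set_upt)
    then show ?thesis by (simp only: scaled_data_def carrier_vecD[OF y] carrier_vecD[OF w])
  qed
  have sameH: "Hessian y = Hessian w" if "y \<in> carrier_vec d" for y
    unfolding Hessian_def same[OF that] ..
  define q where "q y = scalar_prod (y - v) (Hessian w *\<^sub>v (y - v))" for y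
  define z where "z t = (ssn_step n x l \<gamma> U ^^ t) w" for t
  have z: "z t \<in> carrier_vec d \<and> q (z t) \<le> (\<epsilon> ^ t)\<^sup>2 * q w" for t
  proof (induction t)
    case 0
    then show ?case using w by (simp add: z_def)
  next
    case (Suc t)
    have zt: "z t \<in> carrier_vec d" using Suc by simp
    have good': "good_sketch s \<epsilon> (scaled_data n x l (z t)) U" using good same[OF zt] by simp
    have zSuc: "z (Suc t) = ssn_step n x l \<gamma> U (z t)" by (simp add: z_def)
    obtain g p where gp: "g \<in> carrier_vec d" "p \<in> carrier_vec d" "z (Suc t) - v = g + p"
      "z (Suc t) \<in> carrier_vec d"
      "scalar_prod g (Hessian (z t) *\<^sub>v g) \<le> \<epsilon>\<^sup>2 * scalar_prod (z t - v) (Hessian (z t) *\<^sub>v (z t - v))"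
      "sigma_min (Hessian (z t)) * norm2 p \<le>
        8 / 7 * norm2 (gradient v - gradient (z t) - Hessian (z t) *\<^sub>v (v - z t))"
      unfolding zSuc by (rule ssn_step_error[OF zt v good' \<epsilon>])
    \<comment> \<open>The Hessian is constant, so the Taylor estimate applies with L = 0 and the
      part p of the new error vanishes.\<close>
    have "norm2 (gradient (z t + (v - z t)) - gradient (z t) - Hessian (z t) *\<^sub>v (v - z t)) \<le> 0 / 2 * (norm2 (v - z t))\<^sup>2"
      using zt v sameH by (intro gradient_remainder_le) auto
    moreover have "z t + (v - z t) = v" using zt v by auto
    ultimately have "sigma_min (Hessian (z t)) * norm2 p \<le> 0" using gp(6) by simp
    then have "norm2 p = 0"
      using Hessian_sigma_min_pos[OF zt] norm2_nonneg[of p] by (simp add: mult_le_0_iff)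
    then have "p = 0\<^sub>v d" using norm2_eq_0_iff[OF gp(2)] by simp
    then have "z (Suc t) - v = g" using gp(1,3) by simp
    then have "q (z (Suc t)) \<le> \<epsilon>\<^sup>2 * q (z t)" using gp(5) by (simp add: q_def sameH[OF zt])
    also have "\<dots> \<le> \<epsilon>\<^sup>2 * ((\<epsilon> ^ t)\<^sup>2 * q w)" using Suc by (intro mult_left_mono) auto
    finally show ?case using gp(4) by (simp add: power_mult_distrib mult_ac)
  qed
  show ?thesis
    using z[of t] w v \<epsilon> by (intro norm2_le_of_Hessian_form_le) (auto simp: q_def z_def)
qed

text \<open>The contracted part gives the linear term, the Taylor remainder the quadratic
  one.\<close>

lemma ssn_step_Lipschitz:
  assumes v: "v \<in> carrier_vec d" "gradient v = 0\<^sub>v d"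
    and lip: "\<And>w w'. w \<in> carrier_vec d \<Longrightarrow> w' \<in> carrier_vec d \<Longrightarrow>
      spectral_norm (Hessian w - Hessian w') \<le> L * norm2 (w - w')"
    and w: "w \<in> carrier_vec d" and \<epsilon>: "0 < \<epsilon>" "\<epsilon> < 1 / 4"
    and good: "good_sketch s \<epsilon> (scaled_data n x l w) U"
  shows "norm2 (ssn_step n x l \<gamma> U w - v) \<le> \<epsilon> * sqrt (cond_num (Hessian w)) * norm2 (w - v)
    + L / sigma_min (Hessian w) * (norm2 (w - v))\<^sup>2"
proof -
  let ?m = "sigma_min (Hessian w)"
  have m: "0 < ?m" by (rule Hessian_sigma_min_pos[OF w])
  have diff: "Hessian y - Hessian y' \<in> carrier_mat d d" if "y \<in> carrier_vec d" "y' \<in> carrier_vec d" for y y'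
    using Hessian_carrier[OF that(2)] by (rule minus_carrier_mat)
  \<comment> \<open>The Lipschitz bound at two points of distance 1, available because d > 0, places
    \<open>L\<close> above a spectral norm.\<close>
  have L: "0 \<le> L"
  proof -
    have e: "unit_vec d 0 \<in> carrier_vec d" "(0\<^sub>v d :: real vec) \<in> carrier_vec d" by auto
    have n1: "norm2 (unit_vec d 0) = 1" using d by (simp add: norm2_def)
    have "unit_vec d 0 - 0\<^sub>v d = (unit_vec d 0 :: real vec)" by auto
    then have "spectral_norm (Hessian (unit_vec d 0) - Hessian (0\<^sub>v d)) \<le> L"
      using lip[OF e] n1 by simp
    moreover have "0 \<le> spectral_norm (Hessian (unit_vec d 0) - Hessian (0\<^sub>v d))"
      using norm2_mult_le_spectral_norm[OF diff[OF e] e(1)] n1 by (metis mult.right_neutral norm2_nonneg order_trans)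
    ultimately show ?thesis by linarith
  qed
  define h where "h = v - w"
  have h: "h \<in> carrier_vec d" "w + h = v" using v w by (auto simp: h_def)
  have "norm2 (gradient (w + h) - gradient w - Hessian w *\<^sub>v h) \<le> L / 2 * (norm2 h)\<^sup>2"
  proof (rule gradient_remainder_le[OF w h(1) L])
    fix y u :: "real vec" assume y: "y \<in> carrier_vec d" and u: "u \<in> carrier_vec d"
    let ?D = "Hessian y - Hessian w"
    have Dh: "?D *\<^sub>v h \<in> carrier_vec d" using diff[OF y w] h(1) by (rule mult_mat_vec_carrier)
    have Hh: "Hessian y *\<^sub>v h \<in> carrier_vec d" "Hessian w *\<^sub>v h \<in> carrier_vec d"
      using mult_mat_vec_carrier[OF Hessian_carrier h(1)] y w by auto
    have "?D *\<^sub>v h = Hessian y *\<^sub>v h - Hessian w *\<^sub>v h"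
      by (rule minus_mult_distrib_mat_vec[OF Hessian_carrier[OF y] Hessian_carrier[OF w] h(1)])
    then have "scalar_prod u (Hessian y *\<^sub>v h) - scalar_prod u (Hessian w *\<^sub>v h) = scalar_prod u (?D *\<^sub>v h)"
      using scalar_prod_minus_distrib[OF u Hh] by simp
    then have "\<bar>scalar_prod u (Hessian y *\<^sub>v h) - scalar_prod u (Hessian w *\<^sub>v h)\<bar> \<le> norm2 u * norm2 (?D *\<^sub>v h)"
      using abs_scalar_prod_le[OF u Dh] by simp
    also have "norm2 u * norm2 (?D *\<^sub>v h) \<le> norm2 u * (L * norm2 (y - w) * norm2 h)"
    proof (rule mult_left_mono)
      have "norm2 (?D *\<^sub>v h) \<le> spectral_norm ?D * norm2 h"
        by (rule norm2_mult_le_spectral_norm[OF diff[OF y w] h(1)])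
      also have "\<dots> \<le> L * norm2 (y - w) * norm2 h"
        using lip[OF y w] by (intro mult_right_mono) auto
      finally show "norm2 (?D *\<^sub>v h) \<le> L * norm2 (y - w) * norm2 h" .
    qed simp
    finally show "\<bar>scalar_prod u (Hessian y *\<^sub>v h) - scalar_prod u (Hessian w *\<^sub>v h)\<bar>
        \<le> L * norm2 (y - w) * norm2 u * norm2 h"
      by (simp only: mult_ac)
  qed
  then have rem: "norm2 (gradient v - gradient w - Hessian w *\<^sub>v (v - w)) \<le> L / 2 * (norm2 (w - v))\<^sup>2"
    unfolding h(2) using norm2_minus_commute[OF v(1) w] by (simp add: h_def)
  obtain g p where gp: "g \<in> carrier_vec d" "p \<in> carrier_vec d" "ssn_step n x l \<gamma> U w - v = g + p"
    "scalar_prod g (Hessian w *\<^sub>v g) \<le> \<epsilon>\<^sup>2 * scalar_prod (w - v) (Hessian w *\<^sub>v (w - v))"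
    "?m * norm2 p \<le> 8 / 7 * norm2 (gradient v - gradient w - Hessian w *\<^sub>v (v - w))"
    by (rule ssn_step_error[OF w v good \<epsilon>])
  have "norm2 g \<le> \<epsilon> * sqrt (cond_num (Hessian w)) * norm2 (w - v)"
    using gp w v \<epsilon> by (intro norm2_le_of_Hessian_form_le) auto
  moreover have "norm2 p \<le> L / ?m * (norm2 (w - v))\<^sup>2"
  proof -
    \<comment> \<open>The product of 8/7 and 1/2 is 4/7, so the stated constant 1 has room to
      spare.\<close>
    have "?m * norm2 p \<le> L * (norm2 (w - v))\<^sup>2"
    proof -
      have "0 \<le> L * (norm2 (w - v))\<^sup>2" using L by simp
      then show ?thesis using gp(5) rem by simp
    qed
    then show ?thesis using m by (simp add: field_simps)
  qed
  ultimately show ?thesis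
    unfolding gp(3) using norm2_add_le[OF gp(1,2)] by linarith
qed

end

theorem theorem3:
  shows "\<exists>C::real. C > 0 \<and>
    (\<forall>(n::nat) (d::nat) (x :: nat \<Rightarrow> real vec) (l :: nat \<Rightarrow> real \<Rightarrow> real)
      (\<gamma>::real) (wstar :: real vec) (\<epsilon>::real) (\<delta>::real) (s::nat).
      n \<ge> 1 \<longrightarrow> d \<ge> 1 \<longrightarrow> (\<forall>j<n. x j \<in> carrier_vec d) \<longrightarrow> \<gamma> > 0 \<longrightarrow>
      (\<forall>j<n. convex_on UNIV (l j) \<and>
         (\<forall>u. l j differentiable (at u) \<and> deriv (l j) differentiable (at u))) \<longrightarrow>
      unique_minimizer d (objective n x l \<gamma>) wstar \<longrightarrow>
      0 < \<epsilon> \<longrightarrow> \<epsilon> < 1/4 \<longrightarrow> 0 < \<delta> \<longrightarrow> \<delta> < 1 \<longrightarrow>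
      \<comment> \<open>(i) quadratic losses, one sampling matrix for all iterations;
        the logarithm is bounded below by 1 because for \<open>deff\<close> close to or below \<open>\<delta>\<close> the
        bare \<open>ln (deff / \<delta>)\<close> would ask for (almost) no samples\<close>
      ((\<forall>j<n. \<exists>a b c. \<forall>u. l j u = a * u\<^sup>2 + b * u + c) \<longrightarrow>
        (\<forall>w0 \<in> carrier_vec d.
          let A = scaled_data n x l w0; H = hess (objective n x l \<gamma>) w0; deff = eff_dim \<gamma> A in
          real s \<ge> C * (deff / \<epsilon>\<^sup>2) * max 1 (ln (deff / \<delta>)) \<longrightarrow>
          measure_pmf.prob (ridge_sampling_pmf \<gamma> A s)
            {U. \<forall>t. norm2 ((ssn_step n x l \<gamma> U ^^ t) w0 - wstar)
                     \<le> \<epsilon> ^ t * sqrt (cond_num H) * norm2 (w0 - wstar)} \<ge> 1 - \<delta>))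
      \<and>
      \<comment> \<open>(ii) Lipschitz Hessian, one step from a given iterate\<close>
      (\<forall>L::real.
        (\<forall>w \<in> carrier_vec d. \<forall>w' \<in> carrier_vec d.
           spectral_norm (hess (objective n x l \<gamma>) w - hess (objective n x l \<gamma>) w')
             \<le> L * norm2 (w - w')) \<longrightarrow>
        (\<forall>w \<in> carrier_vec d.
          let A = scaled_data n x l w; H = hess (objective n x l \<gamma>) w; deff = eff_dim \<gamma> A in
          real s \<ge> C * (deff / \<epsilon>\<^sup>2) * max 1 (ln (deff / \<delta>)) \<longrightarrow>
          measure_pmf.prob (ridge_sampling_pmf \<gamma> A s)
            {U. norm2 (ssn_step n x l \<gamma> U w - wstar)
                  \<le> \<epsilon> * sqrt (cond_num H) * norm2 (w - wstar)
                    + L / sigma_min H * (norm2 (w - wstar))\<^sup>2} \<ge> 1 - \<delta>)))"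
proof (intro exI[of _ 64] conjI allI impI)
  fix n d :: nat and x l and \<gamma> :: real and wstar and \<epsilon> \<delta> :: real and s :: nat
  assume a: "n \<ge> 1" "d \<ge> 1" "\<forall>j<n. x j \<in> carrier_vec d" "\<gamma> > 0"
    "\<forall>j<n. convex_on UNIV (l j) \<and>
         (\<forall>u. l j differentiable (at u) \<and> deriv (l j) differentiable (at u))"
    and min: "unique_minimizer d (objective n x l \<gamma>) wstar"
    and \<epsilon>: "0 < \<epsilon>" "\<epsilon> < 1/4" and \<delta>: "0 < \<delta>" "\<delta> < 1"
  interpret ridge_glm n d x l \<gamma>
    by standard (use a in auto)
  have v: "wstar \<in> carrier_vec d" "gradient wstar = 0\<^sub>v d"
    using min gradient_minimizer by (auto simp: unique_minimizer_def)
  {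
    assume quad: "\<forall>j<n. \<exists>a b c. \<forall>u. l j u = a * u\<^sup>2 + b * u + c"
    show "\<forall>w0 \<in> carrier_vec d.
          let A = scaled_data n x l w0; H = hess (objective n x l \<gamma>) w0; deff = eff_dim \<gamma> A in
          real s \<ge> 64 * (deff / \<epsilon>\<^sup>2) * max 1 (ln (deff / \<delta>)) \<longrightarrow>
          measure_pmf.prob (ridge_sampling_pmf \<gamma> A s)
            {U. \<forall>t. norm2 ((ssn_step n x l \<gamma> U ^^ t) w0 - wstar)
                     \<le> \<epsilon> ^ t * sqrt (cond_num H) * norm2 (w0 - wstar)} \<ge> 1 - \<delta>"
      unfolding Let_def
    proof (intro ballI impI)
      fix w assume w: "w \<in> carrier_vec d"
        and s: "64 * (eff_dim \<gamma> (scaled_data n x l w) / \<epsilon>\<^sup>2) *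
          max 1 (ln (eff_dim \<gamma> (scaled_data n x l w) / \<delta>)) \<le> real s"
      \<comment> \<open>The good event does not mention \<open>t\<close>, so the quantifier over all
        iterations stays inside the event at no cost in probability.\<close>
      show "1 - \<delta> \<le> measure_pmf.prob (ridge_sampling_pmf \<gamma> (scaled_data n x l w) s)
            {U. \<forall>t. norm2 ((ssn_step n x l \<gamma> U ^^ t) w - wstar)
                     \<le> \<epsilon> ^ t * sqrt (cond_num (hess (objective n x l \<gamma>) w)) * norm2 (w - wstar)}"
        unfolding hess_eq_Hessian[OF w]
        using quad by (intro good_sketch_prob[OF w \<epsilon> \<delta>(1) refl s] allI ssn_quadratic[OF v _ w \<epsilon>]) auto
    qed
  next
    fix L
    assume lip: "\<forall>w \<in> carrier_vec d. \<forall>w' \<in> carrier_vec d.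
           spectral_norm (hess (objective n x l \<gamma>) w - hess (objective n x l \<gamma>) w')
             \<le> L * norm2 (w - w')"
    show "\<forall>w \<in> carrier_vec d.
          let A = scaled_data n x l w; H = hess (objective n x l \<gamma>) w; deff = eff_dim \<gamma> A in
          real s \<ge> 64 * (deff / \<epsilon>\<^sup>2) * max 1 (ln (deff / \<delta>)) \<longrightarrow>
          measure_pmf.prob (ridge_sampling_pmf \<gamma> A s)
            {U. norm2 (ssn_step n x l \<gamma> U w - wstar)
                  \<le> \<epsilon> * sqrt (cond_num H) * norm2 (w - wstar)
                    + L / sigma_min H * (norm2 (w - wstar))\<^sup>2} \<ge> 1 - \<delta>"
      unfolding Let_def
    proof (intro ballI impI)
      fix w assume w: "w \<in> carrier_vec d"
        and s: "64 * (eff_dim \<gamma> (scaled_data n x l w) / \<epsilon>\<^sup>2) *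
          max 1 (ln (eff_dim \<gamma> (scaled_data n x l w) / \<delta>)) \<le> real s"
      show "1 - \<delta> \<le> measure_pmf.prob (ridge_sampling_pmf \<gamma> (scaled_data n x l w) s)
            {U. norm2 (ssn_step n x l \<gamma> U w - wstar)
                  \<le> \<epsilon> * sqrt (cond_num (hess (objective n x l \<gamma>) w)) * norm2 (w - wstar)
                    + L / sigma_min (hess (objective n x l \<gamma>) w) * (norm2 (w - wstar))\<^sup>2}"
        unfolding hess_eq_Hessian[OF w]
        using lip hess_eq_Hessian
        by (intro good_sketch_prob[OF w \<epsilon> \<delta>(1) refl s] ssn_step_Lipschitz[OF v _ w \<epsilon>]) auto
    qed
  }
qed simp

end
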